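(* Let $n\ge 0$, and let $(H_j,W_j)$, $j\in\{1,2,3,4\}$, be four spin decorated horospheres in $\mathbb{H}^{n+2}$, with lambda lengths $\lambda_{jk}$ from $(H_j,W_j)$ to $(H_k,W_k)$. Assume the lambda lengths $\lambda_{31}$, $\lambda_{42}$, $\lambda_{24}$ inverted below are non-zero (i.e. $H_1,H_3$ have distinct centres and $H_2,H_4$ have distinct centres). Then, in $\mathcal{C}\ell_{0,n}$, $$\lambda_{31}^{-1}\lambda_{23}^*\lambda_{42}^{-1}\lambda_{14}^*+\lambda_{31}^{-1}\lambda_{43}^*\lambda_{24}^{-1}\lambda_{12}^*=1 .$$
   Context: **Clifford algebra and spinors.** $\mathcal{C}\ell_{0,n}$ is the real unital associative algebra generated by $i_1,\dots,i_n$ with $i_j^2=-1$, $i_ji_k=-i_ki_j$ ($j\ne k$). $x'$ is the image of $x$ under the automorphism with $i_j\mapsto -i_j$; $x^*$ the image under the antiautomorphism fixing each $i_j$; $\overline{x}=(x')^*$; $N(x)=|x|^2=\mathrm{Re}(x\overline{x})$, $\mathrm{Re}$ being the coefficient of $1$. Paravectors: $\$\mathbb{R}^{n+1}=\mathbb{R}\oplus\mathrm{span}(i_1,\dots,i_n)$. $\$\Gamma_{n+1}$ is the group generated by non-zero paravectors; for $s\in\$\Gamma_{n+1}$, $\sigma(s)(\mathbf{V})=s\mathbf{V}s^*$ maps $\$\mathbb{R}^{n+1}$ to itself; $Spin(n+1)$ is realised as $\{s\in\$\Gamma_{n+1}:N(s)=1\}$, double covering $SO(\$\mathbb{R}^{n+1})$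 via $\sigma$. **Spin decorations.** $\mathbb{H}^{n+2}$ is hyperbolic space, modelled as the upper half-space $\{(z;\mathbf{x}):z>0,\ \mathbf{x}=x_0+\sum_jx_ji_j\in\$\mathbb{R}^{n+1}\}$ with metric $(dz^2+|d\mathbf{x}|^2)/z^2$, oriented so that $(\partial_z,\partial_{x_1},\dots,\partial_{x_n},\partial_{x_0})$ is positive. A decorated horosphere is a horosphere $H$ with an ordered $n$-tuple of oriented, mutually orthogonal line fields, each parallel in the Euclidean geometry of $H$. $\mathrm{Fr}^{n+2}$ is the bundle of positively oriented orthonormal frames of $\mathbb{H}^{n+2}$ and $S\mathrm{Fr}^{n+2}$ its spin double cover (a principal $Spin(n+2)$-bundle). On a decorated horosphere $H$ let $N^{out}$ be the unit normal pointing towards the centre (ideal point) of $H$, $N^{in}=-N^{out}$, $\widehat D_j$ the unit field directing the $j$-th line field, and $F^{out}=(N^{out},\widehat D_1,\dots,\widehat D_n,1^{out})$, $F^{in}=(N^{in},\widehat D_1,\dots,\widehat D_n,1^{in})$, where $1^{out},1^{in}$ complete positively oriented orthonormal frames. Outward (inward) spin frames are continuous lifts $W^{out}$ ($W^{in}$) of $F^{out}$ ($F^{in}$) along $H$ to $S\mathrm{Fr}^{n+2}$. The inward spin frame associated to $W^{out}$ is obtained by (continuously) rotating $W^{out}$ by $\pi$ in the plane of $N^{out},1^{out}$ from $N^{out}$ towards $1^{out}$; the outward one associated to $W^{in}$ by the inverse rotation. A spin decorated horosphere is $(H,W)$ with $H$ a decorated horosphere and $W=(W^{in},W^{out})$ an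 associated pair of spin frames. **Lambda length.** Let $(H_1,W_1),(H_2,W_2)$ be spin decorated horospheres. If $H_1,H_2$ have the same centre, $\lambda_{12}=0$. Otherwise let $\gamma$ be the geodesic oriented from the centre of $H_1$ to the centre of $H_2$, $p_k=\gamma\cap H_k$, and $d$ the signed hyperbolic distance from $p_1$ to $p_2$ along $\gamma$. Parallel transport the spin frame $W_1^{in}$ at $p_1$ along $\gamma$ to $p_2$; identify $\$\mathbb{R}^{n+1}$ isometrically with $T_{p_2}H_2$ by sending $i_j$ to the transported $\widehat D_j$ and $1$ to the transported $1^{in}$ of $W_1^{in}$. Under this identification $s\in Spin(n+1)$ acts on spin frames at $p_2$ by the lift of the rotation $\sigma(s)$ of $T_{p_2}H_2$ (fixing the normal direction), the lift being that of $Spin(n+1)\subset Spin(n+2)$ (so $1$ acts trivially and $-1$ exchanges the two lifts of a frame). Then $\lambda_{12}=e^{d/2}s\in\$\Gamma_{n+1}$, where $s\in Spin(n+1)$ is the unique element taking the transported $W_1^{in}$ to $W_2^{out}$ at $p_2$. The lambda length $\lambda_{jk}$ is defined in the same way for any ordered pair. *)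

theory Defs
  imports "HOL-Analysis.Analysis" "Jordan_Normal_Form.Determinant"
begin

section \<open>The Clifford algebras \<open>Cl(0,n)\<close>\<close>

text \<open>
  A single type carries all the algebras \<open>Cl(0,n)\<close> at once: an element is a finitely supported real
  combination of the monomials \<open>e\<^sub>A = i\<^sub>a \<cdots> i\<^sub>b\<close> (\<open>A = {a < \<cdots> < b}\<close> a finite set of naturals), and
  \<open>Cl(0,n)\<close> is the unital subalgebra of the elements supported on subsets of \<open>{1..n}\<close>.
  The dimension can therefore be an arbitrary natural number, including \<open>0\<close>.
\<close>

typedef clifford = "{f :: nat set \<Rightarrow> real. finite {A. f A \<noteq> 0} \<and> (\<forall>A. f A \<noteq> 0 \<longrightarrow> finite A)}"
  morphisms cl_coeff Clifford
  by (rule exI[of _ "\<lambda>_. 0"]) simp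

setup_lifting type_definition_clifford

definition supp :: "clifford \<Rightarrow> nat set set" where
  "supp x = {A. cl_coeff x A \<noteq> 0}"

lemma finite_supp [simp, intro]: "finite (supp x)"
  using cl_coeff[of x] by (simp add: supp_def)

lemma supp_finite: "A \<in> supp x \<Longrightarrow> finite A"
  using cl_coeff[of x] by (simp add: supp_def)

lemma not_in_supp: "A \<notin> supp x \<Longrightarrow> cl_coeff x A = 0"
  by (simp add: supp_def)

lemma clifford_eqI: "(\<And>A. cl_coeff x A = cl_coeff y A) \<Longrightarrow> x = y"
  using cl_coeff_inject[of x y] by (simp add: fun_eq_iff)

subsection \<open>Vector space and Euclidean structure\<close>

instantiation clifford :: real_vector
begin

lift_definition zero_clifford :: clifford is "\<lambda>_. 0" by simp

lift_definition plus_clifford :: "clifford \<Rightarrow> clifford \<Rightarrow> clifford" is "\<lambda>f g A. f A + g A"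
proof -
  fix f g :: "nat set \<Rightarrow> real"
  assume f: "finite {A. f A \<noteq> 0} \<and> (\<forall>A. f A \<noteq> 0 \<longrightarrow> finite A)"
    and g: "finite {A. g A \<noteq> 0} \<and> (\<forall>A. g A \<noteq> 0 \<longrightarrow> finite A)"
  have "finite {A. f A + g A \<noteq> 0}"
    by (rule finite_subset[of _ "{A. f A \<noteq> 0} \<union> {A. g A \<noteq> 0}"]) (use f g in auto)
  moreover have "finite A" if "f A + g A \<noteq> 0" for A
    using that f g by (cases "f A = 0") auto
  ultimately show "finite {A. f A + g A \<noteq> 0} \<and> (\<forall>A. f A + g A \<noteq> 0 \<longrightarrow> finite A)"
    by blast
qed

lift_definition scaleR_clifford :: "real \<Rightarrow> clifford \<Rightarrow> clifford" is "\<lambda>c f A. c * f A"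
  by (auto elim: finite_subset[rotated])

lift_definition uminus_clifford :: "clifford \<Rightarrow> clifford" is "\<lambda>f A. - f A"
  by auto

definition minus_clifford :: "clifford \<Rightarrow> clifford \<Rightarrow> clifford" where
  "minus_clifford x y = x + - y"

instance
  by standard
     (auto intro!: clifford_eqI simp: minus_clifford_def plus_clifford.rep_eq
        scaleR_clifford.rep_eq uminus_clifford.rep_eq zero_clifford.rep_eq algebra_simps)

end

lemma cl_coeff_zero [simp]: "cl_coeff 0 A = 0"
  by (simp add: zero_clifford.rep_eq)
lemma cl_coeff_add [simp]: "cl_coeff (x + y) A = cl_coeff x A + cl_coeff y A"
  by (simp add: plus_clifford.rep_eq)
lemma cl_coeff_scaleR [simp]: "cl_coeff (c *\<^sub>R x) A = c * cl_coeff x A"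
  by (simp add: scaleR_clifford.rep_eq)
lemma cl_coeff_uminus [simp]: "cl_coeff (- x) A = - cl_coeff x A"
  by (simp add: uminus_clifford.rep_eq)
lemma cl_coeff_diff [simp]: "cl_coeff (x - y) A = cl_coeff x A - cl_coeff y A"
  by (simp only: minus_clifford_def cl_coeff_add cl_coeff_uminus)
lemma cl_coeff_sum [simp]: "cl_coeff (\<Sum>i\<in>I. f i) A = (\<Sum>i\<in>I. cl_coeff (f i) A)"
  by (induction I rule: infinite_finite_induct) auto

text \<open>The inner product makes the monomials \<open>e\<^sub>A\<close> orthonormal; on each \<open>Cl(0,n)\<close> it induces the
  usual topology of a finite-dimensional space.\<close>

instantiation clifford :: real_inner
begin

definition inner_clifford :: "clifford \<Rightarrow> clifford \<Rightarrow> real" where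
  "inner_clifford x y = (\<Sum>A\<in>supp x. cl_coeff x A * cl_coeff y A)"

definition norm_clifford :: "clifford \<Rightarrow> real" where
  "norm_clifford x = sqrt (inner x x)"

definition sgn_clifford :: "clifford \<Rightarrow> clifford" where
  "sgn_clifford x = x /\<^sub>R norm x"

definition dist_clifford :: "clifford \<Rightarrow> clifford \<Rightarrow> real" where
  "dist_clifford x y = norm (x - y)"

definition uniformity_clifford :: "(clifford \<times> clifford) filter" where
  "uniformity_clifford = (INF e\<in>{0<..}. principal {(x, y). dist x y < e})"

definition open_clifford :: "clifford set \<Rightarrow> bool" where
  "open_clifford U \<longleftrightarrow> (\<forall>x\<in>U. eventually (\<lambda>(x', y). x' = x \<longrightarrow> y \<in> U) uniformity)"

lemma inner_clifford_superset:
  assumes "finite S" "supp x \<inter> supp y \<subseteq> S"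
  shows "inner x y = (\<Sum>A\<in>S. cl_coeff x A * cl_coeff y A)"
proof -
  have "inner x y = (\<Sum>A\<in>supp x \<inter> supp y. cl_coeff x A * cl_coeff y A)"
    unfolding inner_clifford_def
    by (rule sum.mono_neutral_right) (auto simp: not_in_supp)
  also have "\<dots> = (\<Sum>A\<in>S. cl_coeff x A * cl_coeff y A)"
    by (rule sum.mono_neutral_left) (use assms in \<open>auto simp: supp_def\<close>)
  finally show ?thesis .
qed

instance
proof
  fix x y z :: clifford and r :: real and U :: "clifford set"
  show "dist x y = norm (x - y)" by (rule dist_clifford_def)
  show "sgn x = x /\<^sub>R norm x" by (rule sgn_clifford_def)
  show "uniformity = (INF e\<in>{0<..}. principal {(x, y::clifford). dist x y < e})"
    by (rule uniformity_clifford_def)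
  show "open U = (\<forall>x\<in>U. eventually (\<lambda>(x', y). x' = x \<longrightarrow> y \<in> U) uniformity)"
    by (rule open_clifford_def)
  show "norm x = sqrt (inner x x)" by (rule norm_clifford_def)
  show "inner x y = inner y x"
    using inner_clifford_superset[of "supp x \<inter> supp y" x y]
      inner_clifford_superset[of "supp x \<inter> supp y" y x] by (simp add: mult.commute Int_commute)
  let ?S = "supp x \<union> supp y \<union> supp z"
  show "inner (x + y) z = inner x z + inner y z"
    using inner_clifford_superset[of ?S "x + y" z] inner_clifford_superset[of ?S x z]
      inner_clifford_superset[of ?S y z]
    by (simp add: sum.distrib[symmetric] distrib_right le_infI2 le_supI1 le_supI2)
  show "inner (r *\<^sub>R x) y = r * inner x y"
    using inner_clifford_superset[of ?S "r *\<^sub>R x" y] inner_clifford_superset[of ?S x y]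
    by (simp add: sum_distrib_left mult.assoc le_infI2 le_infI1 le_supI1 le_supI2)
  show "0 \<le> inner x x"
    by (simp add: inner_clifford_def sum_nonneg)
  show "inner x x = 0 \<longleftrightarrow> x = 0"
  proof
    assume "inner x x = 0"
    then have "\<forall>A\<in>supp x. cl_coeff x A = 0"
      unfolding inner_clifford_def by (subst (asm) sum_nonneg_eq_0_iff) auto
    then have "cl_coeff x A = cl_coeff 0 A" for A
      by (cases "A \<in> supp x") (auto simp: not_in_supp)
    then show "x = 0" by (rule clifford_eqI)
  qed (simp add: inner_clifford_def)
qed

end

subsection \<open>The Clifford product\<close>

text \<open>\<open>e\<^sub>A e\<^sub>B\<close> equals \<open>\<plusminus>e\<^sub>C\<close> with \<open>C\<close> the symmetric difference: sorting the
  juxtaposed generators costs one sign for each inversion \<open>b < a\<close>, and each repeated generator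
  contributes another one because \<open>i\<^sub>j\<^sup>2 = -1\<close>.\<close>

definition blade_sign :: "nat set \<Rightarrow> nat set \<Rightarrow> real" where
  "blade_sign A B = (-1) ^ card {(a, b). a \<in> A \<and> b \<in> B \<and> b \<le> a}"

lift_definition blade :: "nat set \<Rightarrow> clifford" is
  "\<lambda>A B. if finite A \<and> B = A then 1 else 0"
  by (auto elim: finite_subset[rotated])

lemma cl_coeff_blade: "cl_coeff (blade A) B = (if finite A \<and> B = A then 1 else 0)"
  by (simp add: blade.rep_eq)

lemma supp_blade: "finite A \<Longrightarrow> supp (blade A) = {A}"
  by (auto simp: supp_def cl_coeff_blade)

instantiation clifford :: times
begin

definition times_clifford :: "clifford \<Rightarrow> clifford \<Rightarrow> clifford" where
  "x * y = (\<Sum>A\<in>supp x. \<Sum>B\<in>supp y.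
     (cl_coeff x A * cl_coeff y B * blade_sign A B) *\<^sub>R blade (sym_diff A B))"

instance ..

end

lemma times_superset:
  assumes "finite S" "supp x \<subseteq> S" "finite T" "supp y \<subseteq> T"
  shows "x * y = (\<Sum>A\<in>S. \<Sum>B\<in>T.
     (cl_coeff x A * cl_coeff y B * blade_sign A B) *\<^sub>R blade (sym_diff A B))"
proof -
  have "x * y = (\<Sum>A\<in>supp x. \<Sum>B\<in>T.
     (cl_coeff x A * cl_coeff y B * blade_sign A B) *\<^sub>R blade (sym_diff A B))"
    unfolding times_clifford_def
    by (intro sum.cong refl sum.mono_neutral_left) (use assms in \<open>auto simp: not_in_supp\<close>)
  also have "\<dots> = (\<Sum>A\<in>S. \<Sum>B\<in>T.
     (cl_coeff x A * cl_coeff y B * blade_sign A B) *\<^sub>R blade (sym_diff A B))"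
    by (intro sum.mono_neutral_left) (use assms in \<open>auto simp: not_in_supp\<close>)
  finally show ?thesis .
qed

lemma supp_add: "supp (x + y) \<subseteq> supp x \<union> supp y"
  by (auto simp: supp_def)

lemma supp_scaleR: "supp (c *\<^sub>R x) \<subseteq> supp x"
  by (auto simp: supp_def)

lemma times_add_left: "(x + y) * z = x * z + y * (z :: clifford)"
  using times_superset[of "supp x \<union> supp y" "x + y" "supp z" z]
    times_superset[of "supp x \<union> supp y" x "supp z" z]
    times_superset[of "supp x \<union> supp y" y "supp z" z] supp_add[of x y]
  by (simp add: sum.distrib[symmetric] distrib_right scaleR_add_left)

lemma times_add_right: "z * (x + y) = z * x + z * (y :: clifford)"
  using times_superset[of "supp z" z "supp x \<union> supp y" "x + y"]
    times_superset[of "supp z" z "supp x \<union> supp y" x]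
    times_superset[of "supp z" z "supp x \<union> supp y" y] supp_add[of x y]
  by (simp add: sum.distrib[symmetric] distrib_right distrib_left scaleR_add_left)

lemma times_scaleR_left: "(c *\<^sub>R x) * y = c *\<^sub>R (x * (y :: clifford))"
  using times_superset[of "supp x" "c *\<^sub>R x" "supp y" y]
    times_superset[of "supp x" x "supp y" y] supp_scaleR[of c x]
  by (simp add: scaleR_sum_right mult.assoc)

lemma times_scaleR_right: "x * (c *\<^sub>R y) = c *\<^sub>R (x * (y :: clifford))"
  using times_superset[of "supp x" x "supp y" "c *\<^sub>R y"]
    times_superset[of "supp x" x "supp y" y] supp_scaleR[of c y]
  by (simp add: scaleR_sum_right mult.assoc mult.left_commute)

lemma blade_times_blade:
  "finite A \<Longrightarrow> finite B \<Longrightarrow> blade A * blade B = blade_sign A B *\<^sub>R blade (sym_diff A B)"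
  by (simp add: times_clifford_def supp_blade cl_coeff_blade)

lemma clifford_expand: "x = (\<Sum>A\<in>supp x. cl_coeff x A *\<^sub>R blade A)"
proof (rule clifford_eqI)
  fix B
  have "(\<Sum>A\<in>supp x. cl_coeff x A * cl_coeff (blade A) B) = (\<Sum>A\<in>supp x. if A = B then cl_coeff x B else 0)"
    by (intro sum.cong refl) (auto simp: cl_coeff_blade supp_finite)
  then show "cl_coeff x B = cl_coeff (\<Sum>A\<in>supp x. cl_coeff x A *\<^sub>R blade A) B"
    by (simp add: not_in_supp)
qed

lemma clifford_induct [case_names blade add scaleR]:
  assumes "\<And>A. finite A \<Longrightarrow> P (blade A)" and "\<And>x y. P x \<Longrightarrow> P y \<Longrightarrow> P (x + y)"
    and "\<And>c x. P x \<Longrightarrow> P (c *\<^sub>R x)"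
  shows "P x"
proof -
  have 0: "P 0" using assms(3)[of "blade {}" 0] assms(1)[of "{}"] by simp
  have "P (\<Sum>A\<in>S. cl_coeff x A *\<^sub>R blade A)" if "finite S" "\<forall>A\<in>S. finite A" for S
    using that by (induction S rule: finite_induct) (auto intro: assms 0)
  then show ?thesis
    by (subst clifford_expand) (auto intro: supp_finite)
qed

lemma minus_one_power_card_sym_diff:
  assumes "finite X" "finite Y"
  shows "(-1 :: real) ^ card (sym_diff X Y) = (-1) ^ card X * (-1) ^ card Y"
proof -
  have "card (sym_diff X Y) = card (X - Y) + card (Y - X)"
    by (rule card_Un_disjoint) (use assms in auto)
  moreover have "card X = card (X - Y) + card (X \<inter> Y)"
    using assms by (metis card_Diff_subset_Int card_mono finite_Int inf_le1 le_add_diff_inverse2)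
  moreover have "card Y = card (Y - X) + card (X \<inter> Y)"
    using assms by (metis card_Diff_subset_Int card_mono finite_Int inf_commute inf_le1 le_add_diff_inverse2)
  ultimately show ?thesis
    by (simp add: power_add flip: power_mult_distrib)
qed

lemma finite_pairs: "finite A \<Longrightarrow> finite B \<Longrightarrow> finite {(a, b). a \<in> A \<and> b \<in> B \<and> b \<le> (a :: nat)}"
  by (rule finite_subset[of _ "A \<times> B"]) auto

lemma blade_sign_left:
  assumes "finite A" "finite A'" "finite B"
  shows "blade_sign (sym_diff A A') B = blade_sign A B * blade_sign A' B"
proof -
  let ?p = "\<lambda>A. {(a, b). a \<in> A \<and> b \<in> B \<and> b \<le> a}"
  have "?p (sym_diff A A') = (?p A - ?p A') \<union> (?p A' - ?p A)" by auto
  then show ?thesis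
    using minus_one_power_card_sym_diff[of "?p A" "?p A'"] assms
    by (simp add: blade_sign_def finite_pairs)
qed

lemma blade_sign_right:
  assumes "finite A" "finite B" "finite B'"
  shows "blade_sign A (sym_diff B B') = blade_sign A B * blade_sign A B'"
proof -
  let ?p = "\<lambda>B. {(a, b). a \<in> A \<and> b \<in> B \<and> b \<le> a}"
  have "?p (sym_diff B B') = (?p B - ?p B') \<union> (?p B' - ?p B)" by auto
  then show ?thesis
    using minus_one_power_card_sym_diff[of "?p B" "?p B'"] assms
    by (simp add: blade_sign_def finite_pairs)
qed

lemma blade_sign_square [simp]: "blade_sign A B * blade_sign A B = 1"
  by (simp add: blade_sign_def flip: power_mult_distrib)

lemma blade_times_assoc:
  assumes "finite A" "finite B" "finite C"
  shows "(blade A * blade B) * blade C = blade A * (blade B * blade C)"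
proof -
  have "(A - B \<union> (B - A) - C) \<union> (C - (A - B \<union> (B - A)))
      = (A - (B - C \<union> (C - B))) \<union> (B - C \<union> (C - B) - A)" by auto
  then show ?thesis
    using assms
    by (simp add: blade_times_blade times_scaleR_left times_scaleR_right blade_sign_left blade_sign_right)
qed

lemma clifford_times_assoc: "(x * y) * z = x * (y * (z :: clifford))"
proof (induction x rule: clifford_induct)
  case (blade A)
  show ?case
  proof (induction y rule: clifford_induct)
    case (blade B)
    show ?case
      by (induction z rule: clifford_induct)
         (use blade \<open>finite A\<close> in \<open>simp_all add: blade_times_assoc times_add_right times_scaleR_right\<close>)
  qed (simp_all add: times_add_left times_add_right times_scaleR_left times_scaleR_right)
qed (simp_all add: times_add_left times_scaleR_left)

instantiation clifford :: real_algebra_1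
begin

definition one_clifford :: clifford where "one_clifford = blade {}"

instance
proof
  fix x y z :: clifford and c :: real
  show "x * y * z = x * (y * z)" by (rule clifford_times_assoc)
  show "(x + y) * z = x * z + y * z" by (rule times_add_left)
  show "x * (y + z) = x * y + x * z" by (rule times_add_right)
  show "c *\<^sub>R x * y = c *\<^sub>R (x * y)" by (rule times_scaleR_left)
  show "x * c *\<^sub>R y = c *\<^sub>R (x * y)" by (rule times_scaleR_right)
  show "1 * x = x"
    by (induction x rule: clifford_induct)
       (simp_all add: one_clifford_def blade_times_blade blade_sign_def times_add_right times_scaleR_right)
  show "x * 1 = x"
    by (induction x rule: clifford_induct)
       (simp_all add: one_clifford_def blade_times_blade blade_sign_def times_add_left times_scaleR_left)
  have "cl_coeff (0 :: clifford) {} \<noteq> cl_coeff 1 {}" by (simp add: one_clifford_def cl_coeff_blade)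
  then show "(0 :: clifford) \<noteq> 1" by metis
qed

end

text \<open>The inverse is the two-sided inverse of the ring, and \<open>0\<close> for non-units.\<close>

instantiation clifford :: inverse
begin

definition inverse_clifford :: "clifford \<Rightarrow> clifford" where
  "inverse_clifford x =
     (if \<exists>y. x * y = 1 \<and> y * x = 1 then THE y. x * y = 1 \<and> y * x = 1 else 0)"

definition divide_clifford :: "clifford \<Rightarrow> clifford \<Rightarrow> clifford" where
  "divide_clifford x y = x * inverse y"

instance ..

end

lemma clifford_inverse_unique:
  fixes x y :: clifford
  assumes "x * y = 1" "y * x = 1"
  shows "inverse x = y"
proof -
  have "z = y" if "x * z = 1" for z
    using that assms by (metis mult.assoc mult.left_neutral mult.right_neutral)
  then have "(THE y. x * y = 1 \<and> y * x = 1) = y"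
    using assms by blast
  moreover have "\<exists>y. x * y = 1 \<and> y * x = 1" using assms by blast
  ultimately show ?thesis
    by (simp only: inverse_clifford_def if_True)
qed

definition gen :: "nat \<Rightarrow> clifford" where "gen j = blade {j}"

lemma gen_square: "gen j * gen j = - 1"
proof -
  have "{(a, b). a \<in> {j} \<and> b \<in> {j} \<and> b \<le> a} = {(j, j)}" by auto
  then show ?thesis
    unfolding gen_def one_clifford_def by (subst blade_times_blade) (auto simp: blade_sign_def)
qed

lemma gen_anticommute:
  assumes "j \<noteq> k"
  shows "gen j * gen k = - (gen k * gen j)"
proof -
  have *: "{(a, b). a \<in> {j} \<and> b \<in> {k} \<and> b \<le> a} = (if k \<le> j then {(j, k)} else {})" for j k :: nat
    by auto
  have "sym_diff {j} {k} = sym_diff {k} {j}" by auto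
  then have "gen j * gen k = blade_sign {j} {k} *\<^sub>R blade (sym_diff {k} {j})"
    and "gen k * gen j = blade_sign {k} {j} *\<^sub>R blade (sym_diff {k} {j})"
    by (simp_all only: gen_def blade_times_blade finite.intros)
  moreover have "blade_sign {j} {k} = - blade_sign {k} {j}"
    using assms by (cases j k rule: linorder_cases) (simp_all only: blade_sign_def *, simp_all)
  ultimately show ?thesis by simp
qed

lemma blade_insert_Max:
  assumes "finite A" "\<forall>a\<in>A. a < j"
  shows "blade (insert j A) = blade A * gen j"
proof -
  have 1: "{(a, b). a \<in> A \<and> b \<in> {j} \<and> b \<le> a} = {}"
    using assms(2) by auto
  have "sym_diff A {j} = insert j A" using assms(2) by auto
  moreover have "blade_sign A {j} = 1" by (simp only: blade_sign_def 1) simp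
  ultimately show ?thesis
    using assms(1) unfolding gen_def by (subst blade_times_blade) auto
qed

subsection \<open>Involutions, norm and the Clifford group\<close>

lift_definition grade :: "clifford \<Rightarrow> clifford" is "\<lambda>f A. (-1) ^ card A * f A"
  by auto

text \<open>Reversing a product of \<open>k\<close> distinct generators costs \<open>k choose 2\<close> transpositions.\<close>

lift_definition star :: "clifford \<Rightarrow> clifford" is "\<lambda>f A. (-1) ^ (card A choose 2) * f A"
  by auto

definition cl_conj :: "clifford \<Rightarrow> clifford" where "cl_conj x = star (grade x)"

lemma cl_coeff_grade: "cl_coeff (grade x) A = (-1) ^ card A * cl_coeff x A"
  by (simp add: grade.rep_eq)

lemma cl_coeff_star: "cl_coeff (star x) A = (-1) ^ (card A choose 2) * cl_coeff x A"
  by (simp add: star.rep_eq)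

lemma grade_linear: "grade (x + y) = grade x + grade y" "grade (c *\<^sub>R x) = c *\<^sub>R grade x"
  by (auto intro!: clifford_eqI simp: cl_coeff_grade algebra_simps)

lemma star_linear: "star (x + y) = star x + star y" "star (c *\<^sub>R x) = c *\<^sub>R star x"
  by (auto intro!: clifford_eqI simp: cl_coeff_star algebra_simps)

lemma grade_blade: "grade (blade A) = (-1) ^ card A *\<^sub>R blade A"
  by (auto intro!: clifford_eqI simp: cl_coeff_grade cl_coeff_blade)

lemma star_blade: "star (blade A) = (-1) ^ (card A choose 2) *\<^sub>R blade A"
  by (auto intro!: clifford_eqI simp: cl_coeff_star cl_coeff_blade)

lemma grade_gen: "grade (gen j) = - gen j"
  by (simp add: gen_def grade_blade)

lemma star_gen: "star (gen j) = gen j"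
  by (simp add: gen_def star_blade binomial_eq_0)

lemma grade_one [simp]: "grade 1 = 1"
  by (simp add: one_clifford_def grade_blade)

lemma star_one [simp]: "star 1 = 1"
  by (simp add: one_clifford_def star_blade numeral_2_eq_2)

lemma grade_mult: "grade (x * y) = grade x * grade y"
proof (induction x rule: clifford_induct)
  case (blade A)
  show ?case
    by (induction y rule: clifford_induct)
       (use blade in \<open>simp_all add: blade_times_blade grade_blade grade_linear distrib_left
          minus_one_power_card_sym_diff\<close>)
qed (simp_all add: grade_linear distrib_right)

lemma blade_sign_self:
  "finite A \<Longrightarrow> (-1) ^ (card A choose 2) = (-1) ^ card A * blade_sign A A"
proof (induction A rule: finite_linorder_max_induct)
  case empty
  show ?case by (simp add: blade_sign_def numeral_2_eq_2)
next
  case (insert m A)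
  let ?p = "\<lambda>A. {(a, b). a \<in> A \<and> b \<in> A \<and> b \<le> a}"
  have fin: "finite (?p A)" using insert by (simp add: finite_pairs)
  have "?p (insert m A) = ?p A \<union> Pair m ` insert m A"
    using insert by fastforce
  moreover have "card (?p A \<union> Pair m ` insert m A) = card (?p A) + card (Pair m ` insert m A)"
    by (rule card_Un_disjoint) (use insert fin in auto)
  moreover have "card (Pair m ` insert m A) = Suc (card A)"
    using insert by (subst card_image) (auto simp: inj_on_def)
  ultimately have "card (?p (insert m A)) = card (?p A) + Suc (card A)"
    by (simp only:)
  then have "blade_sign (insert m A) (insert m A) = blade_sign A A * (-1) ^ Suc (card A)"
    by (simp add: blade_sign_def power_add)
  moreover have "card (insert m A) = Suc (card A)" using insert by auto
  moreover have "(Suc (card A) choose 2) = (card A choose 2) + card A"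
    by (simp add: numeral_2_eq_2)
  ultimately show ?case
    using insert.IH by (simp add: power_add flip: power_mult_distrib)
qed

lemma star_mult: "star (x * y) = star y * star x"
proof (induction x rule: clifford_induct)
  case (blade A)
  show ?case
  proof (induction y rule: clifford_induct)
    case (blade B)
    have "blade_sign A B * (-1) ^ (card (sym_diff A B) choose 2)
        = (-1) ^ (card B choose 2) * (-1) ^ (card A choose 2) * blade_sign B A"
      using blade \<open>finite A\<close> blade_sign_square[of A B]
      by (simp add: blade_sign_self blade_sign_left blade_sign_right minus_one_power_card_sym_diff)
    then show ?case
      using blade \<open>finite A\<close>
      by (simp add: blade_times_blade star_blade star_linear Un_commute mult.assoc)
  qed (simp_all add: star_linear distrib_right distrib_left)
qed (simp_all add: star_linear distrib_left distrib_right)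

definition cl_norm :: "clifford \<Rightarrow> real" where
  "cl_norm x = cl_coeff (x * cl_conj x) {}"

text \<open>\<open>paravectors n\<close> is the \<open>(n+1)\<close>-dimensional space \<open>$R\<^sup>n\<^sup>+\<^sup>1\<close> in \<open>Cl(0,n)\<close>. Likewise, in the
  following definitions the argument is the number \<open>n\<close> of generators: \<open>clifford_group n\<close> is
  \<open>$\<Gamma>\<^sub>n\<^sub>+\<^sub>1\<close> and \<open>spin_group n\<close> is \<open>Spin(n+1)\<close>.\<close>

definition paravectors :: "nat \<Rightarrow> clifford set" where
  "paravectors n = span (insert 1 (gen ` {1..n}))"

inductive_set clifford_group :: "nat \<Rightarrow> clifford set" for n :: nat where
  paravector: "v \<in> paravectors n \<Longrightarrow> v \<noteq> 0 \<Longrightarrow> v \<in> clifford_group n"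
| mult: "x \<in> clifford_group n \<Longrightarrow> y \<in> clifford_group n \<Longrightarrow> x * y \<in> clifford_group n"
| inverse: "x \<in> clifford_group n \<Longrightarrow> inverse x \<in> clifford_group n"

definition spin_group :: "nat \<Rightarrow> clifford set" where
  "spin_group n = {s \<in> clifford_group n. cl_norm s = 1}"

definition sigma :: "clifford \<Rightarrow> clifford \<Rightarrow> clifford" where
  "sigma s v = s * v * star s"


section \<open>Upper half-space\<close>

text \<open>Points \<open>(z; x)\<close> of hyperbolic \<open>(n+2)\<close>-space and tangent vectors at them are both pairs in
  \<open>R \<times> $R\<^sup>n\<^sup>+\<^sup>1\<close>.\<close>

type_synonym hvec = "real \<times> clifford"

definition tangent :: "nat \<Rightarrow> hvec set" where
  "tangent n = UNIV \<times> paravectors n"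

definition upper_half :: "nat \<Rightarrow> hvec set" where
  "upper_half n = {p \<in> tangent n. fst p > 0}"

definition hmetric :: "hvec \<Rightarrow> hvec \<Rightarrow> hvec \<Rightarrow> real" where
  "hmetric p v w = inner v w / (fst p)\<^sup>2"

text \<open>The Christoffel symbols of the metric, as a bilinear form: the Levi-Civita derivative of a
  vector field \<open>V\<close> along a curve \<open>c\<close> is \<open>V' + christoffel c c' V\<close>. The two lemmas are the
  characterising properties (torsion-freeness and compatibility with the metric).\<close>

definition christoffel :: "hvec \<Rightarrow> hvec \<Rightarrow> hvec \<Rightarrow> hvec" where
  "christoffel p v w =
     (1 / fst p) *\<^sub>R (inner v w *\<^sub>R (1, 0) - fst v *\<^sub>R w - fst w *\<^sub>R v)"

lemma christoffel_commute: "christoffel p v w = christoffel p w v"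
  unfolding christoffel_def inner_commute[of v w] by (simp add: diff_diff_eq add.commute)

lemma christoffel_metric:
  assumes "fst p > 0"
  shows "((\<lambda>t. hmetric (p + t *\<^sub>R v) w w') has_real_derivative
           hmetric p (christoffel p v w) w' + hmetric p w (christoffel p v w')) (at 0)"
proof -
  have *: "hmetric p (christoffel p v w) w' + hmetric p w (christoffel p v w')
      = - 2 * fst v * inner w w' / (fst p) ^ 3"
  proof -
    have "inner (1, 0 :: clifford) u = fst u" "inner u (1, 0 :: clifford) = fst u" for u
      by (cases u; simp)+
    then show ?thesis
      using assms
      by (simp only: hmetric_def christoffel_def inner_scaleR_left inner_scaleR_right
            inner_diff_left inner_diff_right inner_commute[of w v])
         (simp add: field_simps power2_eq_square power3_eq_cube)
  qed
  have "((\<lambda>t. C / (a + t * b)\<^sup>2) has_real_derivative - 2 * b * C / a ^ 3) (at 0)"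
    if "a > 0" for a b C :: real
    using that
    by (auto intro!: derivative_eq_intros simp: field_simps power2_eq_square power3_eq_cube)
  from this[OF assms, of "inner w w'" "fst v"] show ?thesis
    unfolding * by (simp add: hmetric_def)
qed

definition parallel_along :: "(real \<Rightarrow> hvec) \<Rightarrow> (real \<Rightarrow> hvec) \<Rightarrow> bool" where
  "parallel_along c V \<longleftrightarrow>
     (\<forall>t. (V has_vector_derivative
             - christoffel (c t) (vector_derivative c (at t)) (V t)) (at t))"

definition unit_speed_geodesic :: "nat \<Rightarrow> (real \<Rightarrow> hvec) \<Rightarrow> bool" where
  "unit_speed_geodesic n c \<longleftrightarrow>
     (\<forall>t. c t \<in> upper_half n \<and> c differentiable (at t) \<and>
          hmetric (c t) (vector_derivative c (at t)) (vector_derivative c (at t)) = 1) \<and>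
     parallel_along c (\<lambda>t. vector_derivative c (at t))"

datatype ideal_point = Infinity | Boundary clifford

definition tends_to_ideal :: "(real \<Rightarrow> hvec) \<Rightarrow> ideal_point \<Rightarrow> real filter \<Rightarrow> bool" where
  "tends_to_ideal c e F = (case e of
     Infinity \<Rightarrow> filterlim c at_infinity F
   | Boundary a \<Rightarrow> (c \<longlongrightarrow> (0, a)) F)"

definition geodesic_from_to :: "nat \<Rightarrow> ideal_point \<Rightarrow> ideal_point \<Rightarrow> (real \<Rightarrow> hvec) \<Rightarrow> bool" where
  "geodesic_from_to n e e' c \<longleftrightarrow>
     unit_speed_geodesic n c \<and> tends_to_ideal c e at_bot \<and> tends_to_ideal c e' at_top"


section \<open>Frames and spin frames\<close>

text \<open>The positively ordered coordinate vectors
  \<open>\<partial>\<^sub>z, \<partial>\<^sub>x\<^sub>1, \<dots>, \<partial>\<^sub>x\<^sub>n, \<partial>\<^sub>x\<^sub>0\<close>, indexed by \<open>0, \<dots>, n+1\<close>. Frames are indexed in the same way.\<close>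

definition std_vec :: "nat \<Rightarrow> nat \<Rightarrow> hvec" where
  "std_vec n k = (if k = 0 then (1, 0) else if k \<le> n then (0, gen k) else (0, 1))"

definition oriented_frame :: "nat \<Rightarrow> hvec \<Rightarrow> (nat \<Rightarrow> hvec) \<Rightarrow> bool" where
  "oriented_frame n p f \<longleftrightarrow>
     (\<forall>k\<le>n+1. f k \<in> tangent n) \<and>
     (\<forall>j\<le>n+1. \<forall>k\<le>n+1. hmetric p (f j) (f k) = (if j = k then 1 else 0)) \<and>
     Determinant.det (mat (n+2) (n+2) (\<lambda>(j, k). inner (f j) (std_vec n k))) > 0"

text \<open>\<open>Spin(n+2)\<close> acts through \<^const>\<open>sigma\<close> on the paravectors of \<open>Cl(0,n+1)\<close>, and
  \<open>(a; v) \<mapsto> v + a i\<^sub>n\<^sub>+\<^sub>1\<close> identifies \<open>R \<times> $R\<^sup>n\<^sup>+\<^sup>1\<close> with these; the subgroup \<open>Spin(n+1)\<close> then acts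
  on the second component and fixes the first.\<close>

definition to_para :: "nat \<Rightarrow> hvec \<Rightarrow> clifford" where
  "to_para n v = snd v + fst v *\<^sub>R gen (n+1)"

definition of_para :: "nat \<Rightarrow> clifford \<Rightarrow> hvec" where
  "of_para n x = (cl_coeff x {n+1}, x - cl_coeff x {n+1} *\<^sub>R gen (n+1))"

text \<open>The frame bundle of the half-space is trivialised by the fields \<open>z \<partial>\<close>, so its spin double
  cover is \<open>upper_half n \<times> spin_group (n+1)\<close>, with the group acting by right multiplication and the
  element \<open>u\<close> over \<open>p = (z; x)\<close> covering the frame with vectors \<open>z \<sigma>(u) \<partial>\<close>. A spin frame at \<open>p\<close> is
  thus represented by its component \<open>u\<close>.\<close>

definition frame_of :: "nat \<Rightarrow> hvec \<Rightarrow> clifford \<Rightarrow> nat \<Rightarrow> hvec" where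
  "frame_of n p u k = fst p *\<^sub>R of_para n (sigma u (to_para n (std_vec n k)))"

definition spin_lift :: "nat \<Rightarrow> hvec \<Rightarrow> (nat \<Rightarrow> hvec) \<Rightarrow> clifford \<Rightarrow> bool" where
  "spin_lift n p f u \<longleftrightarrow> u \<in> spin_group (n+1) \<and> (\<forall>k\<le>n+1. frame_of n p u k = f k)"

definition spin_frame_field :: "nat \<Rightarrow> hvec set \<Rightarrow> (hvec \<Rightarrow> nat \<Rightarrow> hvec) \<Rightarrow> (hvec \<Rightarrow> clifford) \<Rightarrow> bool" where
  "spin_frame_field n H F W \<longleftrightarrow> continuous_on H W \<and> (\<forall>p\<in>H. spin_lift n p (F p) (W p))"

text \<open>Parallel transport of spin frames: the continuous lift of the parallel transport of the
  underlying frames.\<close>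

definition spin_parallel_along :: "nat \<Rightarrow> (real \<Rightarrow> hvec) \<Rightarrow> (real \<Rightarrow> clifford) \<Rightarrow> bool" where
  "spin_parallel_along n c w \<longleftrightarrow>
     continuous_on UNIV w \<and> (\<forall>t. w t \<in> spin_group (n+1)) \<and>
     (\<forall>k\<le>n+1. parallel_along c (\<lambda>t. frame_of n (c t) (w t) k))"

text \<open>Rotation of a frame by the angle \<open>\<theta>\<close> in the plane of its first and last vectors, from the
  first towards the last.\<close>

definition rotate_frame :: "nat \<Rightarrow> real \<Rightarrow> (nat \<Rightarrow> hvec) \<Rightarrow> nat \<Rightarrow> hvec" where
  "rotate_frame n \<theta> f = f
     (0 := cos \<theta> *\<^sub>R f 0 + sin \<theta> *\<^sub>R f (n+1), n+1 := - sin \<theta> *\<^sub>R f 0 + cos \<theta> *\<^sub>R f (n+1))"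

definition rotated_spin_frame ::
  "nat \<Rightarrow> hvec \<Rightarrow> real \<Rightarrow> (nat \<Rightarrow> hvec) \<Rightarrow> clifford \<Rightarrow> clifford \<Rightarrow> bool" where
  "rotated_spin_frame n p \<phi> f u u' \<longleftrightarrow>
     (\<exists>r. continuous_on {0..\<phi>} r \<and> (\<forall>\<theta>\<in>{0..\<phi>}. spin_lift n p (rotate_frame n \<theta> f) (r \<theta>)) \<and>
          r 0 = u \<and> r \<phi> = u')"


section \<open>Spin decorated horospheres\<close>

text \<open>A horosphere is given by its centre and a positive real: its height if the centre is
  \<open>\<infinity>\<close>, and its Euclidean radius otherwise. The oriented line fields are
  given by the unit fields \<open>line_field S j\<close> (\<open>1 \<le> j \<le> n\<close>) directing them.\<close>

record spin_horosphere =
  centre :: ideal_point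
  hsize :: real
  line_field :: "nat \<Rightarrow> hvec \<Rightarrow> hvec"
  W_in :: "hvec \<Rightarrow> clifford"
  W_out :: "hvec \<Rightarrow> clifford"

definition horo :: "nat \<Rightarrow> spin_horosphere \<Rightarrow> hvec set" where
  "horo n S = (case centre S of
     Infinity \<Rightarrow> {p \<in> upper_half n. fst p = hsize S}
   | Boundary a \<Rightarrow> {p \<in> upper_half n. dist p (hsize S, a) = hsize S})"

text \<open>The metric being conformal, the hyperbolic normal towards the ideal point is vertical, respectively the
  rescaled inner Euclidean normal of the sphere.\<close>

definition normal_out :: "spin_horosphere \<Rightarrow> hvec \<Rightarrow> hvec" where
  "normal_out S p = (case centre S of
     Infinity \<Rightarrow> (fst p, 0)
   | Boundary a \<Rightarrow> (fst p / hsize S) *\<^sub>R ((hsize S, a) - p))"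

definition normal_in :: "spin_horosphere \<Rightarrow> hvec \<Rightarrow> hvec" where
  "normal_in S p = - normal_out S p"

lemma normal_out_unit:
  assumes "hsize S > 0" "p \<in> horo n S"
  shows "hmetric p (normal_out S p) (normal_out S p) = 1"
proof (cases "centre S")
  case Infinity
  then show ?thesis
    using assms by (auto simp: horo_def normal_out_def hmetric_def power2_eq_square)
next
  case (Boundary a)
  then have "fst p > 0" and "norm ((hsize S, a) - p) = hsize S"
    using assms by (auto simp: horo_def upper_half_def dist_norm norm_minus_commute)
  then have "inner ((hsize S, a) - p) ((hsize S, a) - p) = (hsize S)\<^sup>2"
    by (metis power2_norm_eq_inner)
  then show ?thesis
    using assms(1) \<open>fst p > 0\<close> Boundary
    by (simp only: normal_out_def hmetric_def ideal_point.case inner_scaleR_left inner_scaleR_right)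
       (simp add: power2_eq_square)
qed

text \<open>A tangent field to the horosphere is parallel for the induced (flat) metric iff its ambient
  covariant derivative along every curve in the horosphere is normal to it, the induced Levi-Civita
  connection being the tangential part of the ambient one.\<close>

definition parallel_on_horo :: "nat \<Rightarrow> spin_horosphere \<Rightarrow> (hvec \<Rightarrow> hvec) \<Rightarrow> bool" where
  "parallel_on_horo n S V \<longleftrightarrow>
     (\<forall>c c' t. (\<forall>s. c s \<in> horo n S) \<longrightarrow> (c has_vector_derivative c') (at t) \<longrightarrow>
        (\<exists>V'. ((\<lambda>s. V (c s)) has_vector_derivative V') (at t) \<and>
              V' + christoffel (c t) c' (V (c t)) \<in> span {normal_out S (c t)}))"

definition decorated_horosphere :: "nat \<Rightarrow> spin_horosphere \<Rightarrow> bool" where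
  "decorated_horosphere n S \<longleftrightarrow>
     hsize S > 0 \<and> (\<forall>a. centre S = Boundary a \<longrightarrow> a \<in> paravectors n) \<and>
     (\<forall>j\<in>{1..n}.
        (\<forall>p\<in>horo n S. line_field S j p \<in> tangent n \<and>
           hmetric p (line_field S j p) (normal_out S p) = 0 \<and>
           (\<forall>k\<in>{1..n}. hmetric p (line_field S j p) (line_field S k p) = (if j = k then 1 else 0))) \<and>
        parallel_on_horo n S (line_field S j))"

definition complete_frame :: "nat \<Rightarrow> hvec \<Rightarrow> (nat \<Rightarrow> hvec) \<Rightarrow> nat \<Rightarrow> hvec" where
  "complete_frame n p f = f(n+1 := (THE v. oriented_frame n p (f(n+1 := v))))"

definition F_out :: "nat \<Rightarrow> spin_horosphere \<Rightarrow> hvec \<Rightarrow> nat \<Rightarrow> hvec" where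
  "F_out n S p = complete_frame n p (\<lambda>k. if k = 0 then normal_out S p else line_field S k p)"

definition F_in :: "nat \<Rightarrow> spin_horosphere \<Rightarrow> hvec \<Rightarrow> nat \<Rightarrow> hvec" where
  "F_in n S p = complete_frame n p (\<lambda>k. if k = 0 then normal_in S p else line_field S k p)"

definition spin_decorated_horosphere :: "nat \<Rightarrow> spin_horosphere \<Rightarrow> bool" where
  "spin_decorated_horosphere n S \<longleftrightarrow>
     decorated_horosphere n S \<and>
     spin_frame_field n (horo n S) (F_out n S) (W_out S) \<and>
     spin_frame_field n (horo n S) (F_in n S) (W_in S) \<and>
     (\<forall>p\<in>horo n S. rotated_spin_frame n p pi (F_out n S p) (W_out S p) (W_in S p))"


section \<open>Lambda lengths\<close>

text \<open>\<open>c\<close> having unit speed, \<open>t\<^sub>2 - t\<^sub>1\<close> is the signed distance between the points \<open>c t\<^sub>1\<close>, \<open>c t\<^sub>2\<close>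
  where it meets the horospheres. If \<open>u\<close> is the spin frame at \<open>c t\<^sub>2\<close> transported from the first
  horosphere, the rotation \<open>\<sigma>(s)\<close> of the horosphere's tangent space, expressed in the frame of \<open>u\<close>
  (\<open>i\<^sub>j\<close> and \<open>1\<close> corresponding to the frame vectors), takes \<open>u\<close> to \<open>u * s\<close>.\<close>

definition lambda_length :: "nat \<Rightarrow> spin_horosphere \<Rightarrow> spin_horosphere \<Rightarrow> clifford" where
  "lambda_length n S\<^sub>1 S\<^sub>2 =
     (if centre S\<^sub>1 = centre S\<^sub>2 then 0
      else THE l. \<exists>c t\<^sub>1 t\<^sub>2 w s.
        geodesic_from_to n (centre S\<^sub>1) (centre S\<^sub>2) c \<and>
        c t\<^sub>1 \<in> horo n S\<^sub>1 \<and> c t\<^sub>2 \<in> horo n S\<^sub>2 \<and>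
        spin_parallel_along n c w \<and> w t\<^sub>1 = W_in S\<^sub>1 (c t\<^sub>1) \<and>
        s \<in> spin_group n \<and> w t\<^sub>2 * s = W_out S\<^sub>2 (c t\<^sub>2) \<and>
        l = exp ((t\<^sub>2 - t\<^sub>1) / 2) *\<^sub>R s)"

end

theory Submission
  imports Defs
begin

text \<open>
  Each spin decorated horosphere is encoded by a pair \<open>(\<xi>, \<eta>)\<close> of Clifford elements in such a way that the
  lambda length becomes the bracket \<open>\<lambda>\<^sub>1\<^sub>2 = \<xi>\<^sub>1\<^sup>* \<eta>\<^sub>2 - \<eta>\<^sub>1\<^sup>* \<xi>\<^sub>2\<close>. The bracket is right linear in the
  second pair, satisfies \<open>\<lambda>\<^sub>j\<^sub>k\<^sup>* = - \<lambda>\<^sub>k\<^sub>j\<close> and vanishes for \<open>j = k\<close>; so the first pair is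
  \<open>\<kappa>\<^sub>1 = \<kappa>\<^sub>2 \<lambda>\<^sub>4\<^sub>2\<^sup>-\<^sup>1 \<lambda>\<^sub>4\<^sub>1 + \<kappa>\<^sub>4 \<lambda>\<^sub>2\<^sub>4\<^sup>-\<^sup>1 \<lambda>\<^sub>2\<^sub>1\<close>, and pairing this with the third one is the Ptolemy relation.

  The pairs come from the inversion in the centre \<open>e\<close> of the horosphere. It carries constant frames to frames
  that are parallel along the horosphere and along every geodesic ending at \<open>e\<close>; on spin frames its differential is
  left multiplication by the unit paravector \<open>nav\<close> pointing from \<open>e\<close>. Hence the outward spin
  frame is \<open>nav * \<kappa>\<close> with a constant \<open>\<kappa>\<close> in \<open>Spin(n+1)\<close>, the parallel spin frames along a geodesic from \<open>e\<close>
  are \<open>nav * k\<close> with \<open>k\<close> constant, and the lambda length only involves the product of the two values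
  of \<open>nav\<close> at one point of the geodesic.
\<close>

section \<open>Clifford algebra\<close>

text \<open>The definite description in \<open>lambda_length\<close> ranges over all geodesics,
  parametrisations and transported frames, so one good witness is not enough: every candidate has to
  give the same value. No uniqueness theorem for differential equations enters. Geodesics are
  determined by first integrals. A transported frame has constant metric products with the explicit
  parallel fields \<open>nav_field\<close>, which fixes it as a frame, and continuity on a connected
  set then fixes the sign of its lift. The group \<open>spin_group\<close> is given by generators,
  which makes membership hard to test; \<open>para_unitary\<close> describes it by closed conditions
  instead (\<open>spin_group_eq\<close>). The generator \<open>gen (n + 1)\<close> enters a lambda
  length twice: as the half-angle rotation by \<pi> between outward and inward frame, and in the
  relative position of the two values of \<open>nav\<close>. Moving one copy past the constant of
  the first horosphere turns \<open>cl_conj\<close> into \<open>star\<close>, and the two copies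
  square to -1. Hence the result lies in Cl(0,n), and the bracket contains
  \<open>star\<close>.\<close>

definition cl :: "nat \<Rightarrow> clifford set" where
  "cl n = {x. \<forall>A. \<not> A \<subseteq> {1..n} \<longrightarrow> cl_coeff x A = 0}"

lemma subspace_cl: "subspace (cl n)"
  by (simp add: cl_def subspace_def)

lemma cl_scaleR: "x \<in> cl n \<Longrightarrow> c *\<^sub>R x \<in> cl n"
  by (rule subspace_scale[OF subspace_cl])

lemma cl_uminus: "x \<in> cl n \<Longrightarrow> - x \<in> cl n"
  by (rule subspace_neg[OF subspace_cl])

lemma blade_cl: "A \<subseteq> {1..n} \<Longrightarrow> blade A \<in> cl n"
  by (simp add: cl_def cl_coeff_blade)

lemma cl_one [simp, intro]: "1 \<in> cl n"
  by (simp add: one_clifford_def blade_cl)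

lemma cl_mult: "x \<in> cl n \<Longrightarrow> y \<in> cl n \<Longrightarrow> x * y \<in> cl n"
  unfolding times_clifford_def
  by (intro subspace_sum[OF subspace_cl] cl_scaleR blade_cl) (auto simp: cl_def supp_def)

lemma cl_grade: "x \<in> cl n \<Longrightarrow> grade x \<in> cl n"
  by (simp add: cl_def cl_coeff_grade)

lemma cl_star: "x \<in> cl n \<Longrightarrow> star x \<in> cl n"
  by (simp add: cl_def cl_coeff_star)

lemma cl_conj: "x \<in> cl n \<Longrightarrow> cl_conj x \<in> cl n"
  by (simp add: cl_conj_def cl_grade cl_star)

lemma cl_sigma: "s \<in> cl n \<Longrightarrow> v \<in> cl n \<Longrightarrow> sigma s v \<in> cl n"
  by (simp add: sigma_def cl_mult cl_star)

lemma gen_cl: "j \<in> {1..n} \<Longrightarrow> gen j \<in> cl n"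
  by (simp add: gen_def blade_cl)

lemma cl_0_scalar:
  assumes "x \<in> cl 0"
  shows "x = cl_coeff x {} *\<^sub>R 1"
  using assms by (intro clifford_eqI) (auto simp: cl_def one_clifford_def cl_coeff_blade)

text \<open>Compare coefficients at a blade \<open>A\<close> containing the new generator. On the
  left the generator meets only itself, with sign -1; on the right it passes all of
  \<open>A\<close>, with sign \<open>(-1) ^ card A\<close>, which \<open>grade\<close> undoes. Such
  a coefficient is therefore its own negative.\<close>

lemma cl_Suc_eliminate:
  assumes "x \<in> cl (Suc n)" "x * gen (Suc n) = gen (Suc n) * grade x"
  shows "x \<in> cl n"
proof -
  let ?j = "Suc n"
  have sd: "sym_diff A {?j} = sym_diff B {?j} \<longleftrightarrow> B = A" "sym_diff A {?j} = sym_diff {?j} B \<longleftrightarrow> B = A"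
    for A B :: "nat set" by auto
  have L: "cl_coeff (x * gen ?j) (sym_diff A {?j}) = cl_coeff x A * blade_sign A {?j}" if "finite A" for A
  proof -
    have "x * gen ?j = (\<Sum>B\<in>supp x. (cl_coeff x B * blade_sign B {?j}) *\<^sub>R blade (sym_diff B {?j}))"
      by (simp add: times_clifford_def gen_def supp_blade[of "{?j}"] cl_coeff_blade[of "{?j}"] del: Diff_insert0)
    then have "cl_coeff (x * gen ?j) (sym_diff A {?j}) =
       (\<Sum>B\<in>supp x. if B = A then cl_coeff x A * blade_sign A {?j} else 0)"
      by (simp only: cl_coeff_sum cl_coeff_scaleR cl_coeff_blade sd)
        (intro sum.cong refl, auto simp: that)
    then show ?thesis by (simp add: not_in_supp)
  qed
  have R: "cl_coeff (gen ?j * y) (sym_diff A {?j}) = cl_coeff y A * blade_sign {?j} A" if "finite A" for A y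
  proof -
    have "gen ?j * y = (\<Sum>B\<in>supp y. (cl_coeff y B * blade_sign {?j} B) *\<^sub>R blade (sym_diff {?j} B))"
    proof -
      have "supp (gen ?j) = {{?j}}" "cl_coeff (gen ?j) {?j} = 1"
        by (simp_all add: gen_def supp_blade cl_coeff_blade)
      then show ?thesis by (simp only: times_clifford_def) simp
    qed
    then have "cl_coeff (gen ?j * y) (sym_diff A {?j}) =
       (\<Sum>B\<in>supp y. if B = A then cl_coeff y A * blade_sign {?j} A else 0)"
      by (simp only: cl_coeff_sum cl_coeff_scaleR cl_coeff_blade sd)
        (intro sum.cong refl, auto simp: that)
    then show ?thesis by (simp add: not_in_supp)
  qed
  have "?j \<notin> A" if "cl_coeff x A \<noteq> 0" for A
  proof
    assume j: "?j \<in> A"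
    have A: "A \<subseteq> {1..?j}" using assms(1) that by (auto simp: cl_def)
    then have fin: "finite A" by (rule finite_subset) simp
    have "{(a, b). a \<in> A \<and> b \<in> {?j} \<and> b \<le> a} = {(?j, ?j)}"
      using A j by fastforce
    then have s1: "blade_sign A {?j} = -1" by (simp add: blade_sign_def)
    have "{(a, b). a \<in> {?j} \<and> b \<in> A \<and> b \<le> a} = Pair ?j ` A"
      using A by force
    then have s2: "blade_sign {?j} A = (-1) ^ card A"
      by (simp only: blade_sign_def) (simp add: card_image inj_on_def)
    have "cl_coeff x A * -1 = (-1) ^ card A * cl_coeff x A * (-1) ^ card A"
      using L[OF fin] R[OF fin, of "grade x"] unfolding assms(2) s1 s2 by (simp add: cl_coeff_grade)
    also have "\<dots> = cl_coeff x A * ((-1) ^ card A * (-1) ^ card A)" by simp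
    also have "\<dots> = cl_coeff x A" by (simp flip: power_mult_distrib)
    finally show False using that by simp
  qed
  then show ?thesis
    using assms(1) unfolding cl_def
    by (auto simp: subset_iff) (metis le_SucE)
qed

subsection \<open>Involutions and the inner product\<close>

lemma grade_grade [simp]: "grade (grade x) = x"
  by (rule clifford_eqI) (simp add: cl_coeff_grade flip: mult.assoc power_mult_distrib)

lemma star_star [simp]: "star (star x) = x"
  by (rule clifford_eqI) (simp add: cl_coeff_star flip: mult.assoc power_mult_distrib)

lemma star_grade: "star (grade x) = grade (star x)"
  by (rule clifford_eqI) (simp add: cl_coeff_star cl_coeff_grade)

lemma cl_conj_conj [simp]: "cl_conj (cl_conj x) = x"
  by (simp add: cl_conj_def flip: star_grade)

lemma cl_conj_mult: "cl_conj (x * y) = cl_conj y * cl_conj x"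
  by (simp add: cl_conj_def grade_mult star_mult)

lemma cl_conj_linear: "cl_conj (x + y) = cl_conj x + cl_conj y" "cl_conj (c *\<^sub>R x) = c *\<^sub>R cl_conj x"
  by (simp_all add: cl_conj_def grade_linear star_linear)

lemma grade_uminus: "grade (- x) = - grade x" and star_uminus: "star (- x) = - star x"
  and cl_conj_uminus: "cl_conj (- x) = - cl_conj x"
  using grade_linear(2)[of "-1" x] star_linear(2)[of "-1" x] cl_conj_linear(2)[of "-1" x] by simp_all

lemma star_diff: "star (x - y) = star x - star y"
  using star_linear(1)[of x "-y"] by (simp add: star_uminus)

lemma cl_conj_one [simp]: "cl_conj 1 = 1"
  by (simp add: cl_conj_def)

lemma grade_zero [simp]: "grade 0 = 0" and star_zero [simp]: "star 0 = 0"
  and cl_conj_zero [simp]: "cl_conj 0 = 0"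
  using grade_linear(2)[of 0 0] star_linear(2)[of 0 0] cl_conj_linear(2)[of 0 0] by simp_all

lemma cl_conj_gen: "cl_conj (gen j) = - gen j"
  by (simp add: cl_conj_def grade_gen star_uminus star_gen)

lemma star_cl_conj: "star (cl_conj x) = grade x" "cl_conj (star x) = grade x"
  "grade (cl_conj x) = star x" "cl_conj (grade x) = star x"
  by (simp_all add: cl_conj_def star_grade)

lemma inner_blade: "finite A \<Longrightarrow> inner (blade A) (blade B) = (if A = B then 1 else 0)"
  by (auto simp: inner_clifford_def supp_blade cl_coeff_blade)

text \<open>The sign of \<open>cl_conj\<close> on a blade is the sign of the square of that blade
  (\<open>blade_sign_self\<close>), so a blade times its conjugate is 1, while two different blades
  multiply to one without scalar part.\<close>

lemma scalar_part_mult_conj: "cl_coeff (x * cl_conj y) {} = inner x y"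
proof (induction x rule: clifford_induct)
  case (blade A)
  show ?case
  proof (induction y rule: clifford_induct)
    case (blade B)
    have s: "(-1) ^ card A * ((-1) ^ (card A choose 2) * blade_sign A A) = (1 :: real)"
    proof -
      have "(-1) ^ card A * ((-1) ^ (card A choose 2) * blade_sign A A) =
        ((-1) ^ card A * (-1) ^ card A) * (blade_sign A A * blade_sign A A)"
        unfolding blade_sign_self[OF \<open>finite A\<close>] by (simp only: mult_ac)
      then show ?thesis by (simp flip: power_mult_distrib)
    qed
    have "{} = sym_diff A B \<longleftrightarrow> A = B" by auto
    then show ?case
      using \<open>finite A\<close> \<open>finite B\<close> s
      by (auto simp: cl_conj_def grade_blade star_blade star_linear blade_times_blade cl_coeff_blade
          inner_blade times_scaleR_right mult_ac)
  qed (simp_all add: cl_conj_linear inner_add_right distrib_left)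
qed (simp_all add: inner_add_left distrib_right)

text \<open>The type is infinite-dimensional, so boundedness is not automatic. Right multiplication
  by a blade preserves \<open>inner\<close>, because the blade times its conjugate is 1, and
  \<open>k\<close> is a finite combination of blades.\<close>

lemma bounded_linear_mult_right_clifford: "bounded_linear (\<lambda>x. x * (k :: clifford))"
proof (induction k rule: clifford_induct)
  case (blade A)
  have "inner (x * blade A) (x * blade A) = inner x x" for x
  proof -
    have "blade A * cl_conj (blade A) = 1"
    proof -
      have "blade A * cl_conj (blade A) = cl_coeff (blade A * cl_conj (blade A)) {} *\<^sub>R 1"
        using blade by (intro cl_0_scalar) (simp add: cl_conj_def grade_blade star_blade star_linear
            blade_times_blade cl_def cl_coeff_blade)
      also have "\<dots> = 1" using blade by (simp add: scalar_part_mult_conj inner_blade)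
      finally show ?thesis .
    qed
    then have "x * blade A * cl_conj (x * blade A) = x * cl_conj x"
      by (metis cl_conj_mult mult.assoc mult.right_neutral)
    then show ?thesis
      by (simp flip: scalar_part_mult_conj)
  qed
  then have "norm (x * blade A) \<le> norm x * 1" for x
    by (simp add: norm_eq_sqrt_inner)
  then show ?case
    by (intro bounded_linear_intro[where K = 1]) (auto simp: distrib_right)
next
  case (add x y)
  then show ?case by (simp add: distrib_left bounded_linear_add)
next
  case (scaleR c x)
  then show ?case
    by (simp add: bounded_linear_compose[OF bounded_linear_scaleR_right])
qed

subsection \<open>Paravectors\<close>

lemma subspace_paravectors: "subspace (paravectors n)"
  by (simp add: paravectors_def)

lemma para_zero [simp, intro]: "0 \<in> paravectors n"
  by (rule subspace_0[OF subspace_paravectors])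

lemma para_add: "x \<in> paravectors n \<Longrightarrow> y \<in> paravectors n \<Longrightarrow> x + y \<in> paravectors n"
  by (rule subspace_add[OF subspace_paravectors])

lemma para_scaleR: "x \<in> paravectors n \<Longrightarrow> c *\<^sub>R x \<in> paravectors n"
  by (rule subspace_scale[OF subspace_paravectors])

lemma para_uminus: "x \<in> paravectors n \<Longrightarrow> - x \<in> paravectors n"
  by (rule subspace_neg[OF subspace_paravectors])

lemma para_diff: "x \<in> paravectors n \<Longrightarrow> y \<in> paravectors n \<Longrightarrow> x - y \<in> paravectors n"
  by (rule subspace_diff[OF subspace_paravectors])

lemma para_one [simp, intro]: "1 \<in> paravectors n"
  by (simp add: paravectors_def span_base)

lemma para_gen: "j \<in> {1..n} \<Longrightarrow> gen j \<in> paravectors n"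
  by (simp add: paravectors_def span_base)

lemma paravectors_iff:
  "v \<in> paravectors n \<longleftrightarrow> (\<forall>A. \<not> (A = {} \<or> (\<exists>j\<in>{1..n}. A = {j})) \<longrightarrow> cl_coeff v A = 0)" (is "_ \<longleftrightarrow> ?P v")
proof
  have sub: "subspace {v. ?P v}"
    by (simp add: subspace_def)
  show "?P v" if "v \<in> paravectors n"
  proof -
    have "insert 1 (gen ` {1..n}) \<subseteq> {v. ?P v}"
      by (auto simp: gen_def one_clifford_def cl_coeff_blade)
    from span_minimal[OF this sub] have "paravectors n \<subseteq> {v. ?P v}"
      unfolding paravectors_def .
    from subsetD[OF this that] show ?thesis by simp
  qed
  show "v \<in> paravectors n" if "?P v"
  proof (subst clifford_expand, intro subspace_sum[OF subspace_paravectors] para_scaleR)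
    fix A assume "A \<in> supp v"
    then have "A = {} \<or> (\<exists>j\<in>{1..n}. A = {j})" using that by (auto simp: supp_def)
    then show "blade A \<in> paravectors n"
      using para_gen para_one by (auto simp: gen_def one_clifford_def)
  qed
qed

lemma para_coeff_eq_0:
  "v \<in> paravectors n \<Longrightarrow> A \<noteq> {} \<Longrightarrow> (\<And>j. j \<in> {1..n} \<Longrightarrow> A \<noteq> {j}) \<Longrightarrow> cl_coeff v A = 0"
  unfolding paravectors_iff by blast

lemma paraI:
  "(\<And>A. A \<noteq> {} \<Longrightarrow> (\<And>j. j \<in> {1..n} \<Longrightarrow> A \<noteq> {j}) \<Longrightarrow> cl_coeff v A = 0) \<Longrightarrow> v \<in> paravectors n"
  unfolding paravectors_iff by blast

lemma para_subset_cl: "paravectors n \<subseteq> cl n"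
  unfolding paravectors_def
  by (rule span_minimal[OF _ subspace_cl]) (auto intro: gen_cl)

lemma para_cl: "v \<in> paravectors n \<Longrightarrow> v \<in> cl n"
  using para_subset_cl by blast

lemma para_mono: "v \<in> paravectors m \<Longrightarrow> m \<le> n \<Longrightarrow> v \<in> paravectors n"
  unfolding paravectors_def by (rule subsetD[OF span_mono]) auto

lemma para_Suc_cl:
  assumes "v \<in> paravectors (Suc n)" "v \<in> cl n"
  shows "v \<in> paravectors n"
proof (rule paraI)
  fix A :: "nat set" assume A: "A \<noteq> {}" "\<And>j. j \<in> {1..n} \<Longrightarrow> A \<noteq> {j}"
  show "cl_coeff v A = 0"
  proof (cases "A = {Suc n}")
    case True
    then show ?thesis using assms(2) by (simp add: cl_def)
  next
    case False
    then show ?thesis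
      using A by (intro para_coeff_eq_0[OF assms(1)]) (auto simp: le_Suc_eq)
  qed
qed

lemma para_star:
  assumes "v \<in> paravectors n"
  shows "star v = v"
proof (rule clifford_eqI)
  fix A
  show "cl_coeff (star v) A = cl_coeff v A"
  proof (cases "cl_coeff v A = 0")
    case False
    then have "A = {} \<or> (\<exists>j\<in>{1..n}. A = {j})" using para_coeff_eq_0[OF assms] by blast
    then show ?thesis by (auto simp: cl_coeff_star binomial_eq_0)
  qed (simp add: cl_coeff_star)
qed

lemma para_cl_conj: "v \<in> paravectors n \<Longrightarrow> cl_conj v \<in> paravectors n"
proof (rule paraI)
  fix A :: "nat set" assume "v \<in> paravectors n" "A \<noteq> {}" "\<And>j. j \<in> {1..n} \<Longrightarrow> A \<noteq> {j}"
  then have "cl_coeff v A = 0" by (rule para_coeff_eq_0)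
  then show "cl_coeff (cl_conj v) A = 0" by (simp add: cl_conj_def cl_coeff_star cl_coeff_grade)
qed

lemma para_grade_eq_conj: "v \<in> paravectors n \<Longrightarrow> grade v = cl_conj v"
  by (metis para_cl_conj para_star star_cl_conj(1))

lemma para_grade: "v \<in> paravectors n \<Longrightarrow> grade v \<in> paravectors n"
  by (simp add: para_grade_eq_conj para_cl_conj)

lemma inner_one_gen: "inner 1 (gen j) = 0" "inner (gen j) 1 = 0" "inner 1 (1 :: clifford) = 1"
   "inner (gen j) (gen k) = (if j = k then 1 else 0)"
  by (simp_all add: one_clifford_def gen_def inner_blade)

text \<open>Both sides are bilinear, so two passes of \<open>span_minimal\<close> reduce the claim
  to 1 and the generators, where it consists of \<open>gen_square\<close> and
  \<open>gen_anticommute\<close>.\<close>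

lemma para_polar:
  assumes "v \<in> paravectors n" "w \<in> paravectors n"
  shows "v * cl_conj w + w * cl_conj v = (2 * inner v w) *\<^sub>R 1"
proof -
  have sub2: "subspace {w. v * cl_conj w + w * cl_conj v = (2 * inner v w) *\<^sub>R 1}" for v
  proof (rule subspaceI; unfold mem_Collect_eq)
    fix x y assume x: "v * cl_conj x + x * cl_conj v = (2 * inner v x) *\<^sub>R 1"
      and y: "v * cl_conj y + y * cl_conj v = (2 * inner v y) *\<^sub>R 1"
    have "v * cl_conj (x + y) + (x + y) * cl_conj v =
        (v * cl_conj x + x * cl_conj v) + (v * cl_conj y + y * cl_conj v)"
      by (simp add: cl_conj_linear distrib_left distrib_right)
    also have "\<dots> = (2 * inner v (x + y)) *\<^sub>R 1"
      unfolding x y by (simp add: inner_add_right distrib_left scaleR_add_left)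
    finally show "v * cl_conj (x + y) + (x + y) * cl_conj v = (2 * inner v (x + y)) *\<^sub>R 1" .
  next
    fix c x assume x: "v * cl_conj x + x * cl_conj v = (2 * inner v x) *\<^sub>R 1"
    have "v * cl_conj (c *\<^sub>R x) + (c *\<^sub>R x) * cl_conj v = c *\<^sub>R (v * cl_conj x + x * cl_conj v)"
      by (simp add: cl_conj_linear scaleR_add_right)
    also have "\<dots> = (2 * inner v (c *\<^sub>R x)) *\<^sub>R 1"
      unfolding x by simp
    finally show "v * cl_conj (c *\<^sub>R x) + (c *\<^sub>R x) * cl_conj v = (2 * inner v (c *\<^sub>R x)) *\<^sub>R 1" .
  qed simp
  have sub1: "subspace {v. v * cl_conj w + w * cl_conj v = (2 * inner v w) *\<^sub>R 1}" for w
    using sub2[of w] by (simp add: add.commute inner_commute)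
  have base: "v * cl_conj w + w * cl_conj v = (2 * inner v w) *\<^sub>R 1"
    if "v \<in> insert 1 (range gen)" "w \<in> insert 1 (range gen)" for v w
  proof -
    have two: "1 + 1 = (2 :: real) *\<^sub>R (1 :: clifford)" by (simp add: scaleR_2)
    have gg: "gen j * - gen k + gen k * - gen j = (2 * inner (gen j) (gen k)) *\<^sub>R 1" for j k
      by (cases "j = k") (simp_all add: gen_square inner_one_gen gen_anticommute[of j k] scaleR_2)
    from that consider "v = 1" "w = 1" | k where "v = 1" "w = gen k" | k where "v = gen k" "w = 1"
      | j k where "v = gen j" "w = gen k" by blast
    then show ?thesis
      by cases (simp_all only: cl_conj_gen cl_conj_one gg, simp_all add: inner_one_gen two del: one_add_one)
  qed
  have "v * cl_conj w + w * cl_conj v = (2 * inner v w) *\<^sub>R 1" if "v \<in> insert 1 (gen ` {1..n})" for v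
  proof -
    have "insert 1 (gen ` {1..n}) \<subseteq> {w. v * cl_conj w + w * cl_conj v = (2 * inner v w) *\<^sub>R 1}"
      using base[of v] that by blast
    from span_minimal[OF this sub2] assms(2) show ?thesis
      unfolding paravectors_def by (simp add: subset_iff)
  qed
  then have "insert 1 (gen ` {1..n}) \<subseteq> {v. v * cl_conj w + w * cl_conj v = (2 * inner v w) *\<^sub>R 1}"
    by blast
  from span_minimal[OF this sub1] assms(1) show ?thesis
    unfolding paravectors_def by (simp add: subset_iff)
qed


lemma clifford_scalar_inject: "a *\<^sub>R (1 :: clifford) = b *\<^sub>R 1 \<longleftrightarrow> a = b"
  by simp

lemma para_mult_conj:
  assumes "v \<in> paravectors n"
  shows "v * cl_conj v = inner v v *\<^sub>R 1" "cl_conj v * v = inner v v *\<^sub>R 1"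
proof -
  have h: "x = c *\<^sub>R 1" if "x + x = (2 * c) *\<^sub>R 1" for x :: clifford and c :: real
  proof -
    have "2 *\<^sub>R x = 2 *\<^sub>R (c *\<^sub>R 1)" using that by (simp add: scaleR_2)
    then show ?thesis by (simp only: real_vector.scale_cancel_left) simp
  qed
  have *: "v * cl_conj v = inner v v *\<^sub>R 1" if "v \<in> paravectors n" for v
    by (rule h) (rule para_polar[OF that that])
  have "cl_conj v * v = inner (cl_conj v) (cl_conj v) *\<^sub>R 1"
    using *[OF para_cl_conj[OF assms]] by simp
  moreover have "inner (cl_conj v) (cl_conj v) = inner v v"
  proof -
    \<comment> \<open>Bracketing \<open>v * cl_conj v * v\<close> in the two possible ways compares
      the two norms.\<close>
    have "inner (cl_conj v) (cl_conj v) *\<^sub>R v = v * (cl_conj v * v)"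
      using calculation by simp
    also have "\<dots> = inner v v *\<^sub>R v" using *[OF assms] by (simp flip: mult.assoc)
    finally show ?thesis by auto
  qed
  ultimately show "cl_conj v * v = inner v v *\<^sub>R 1" by simp
  show "v * cl_conj v = inner v v *\<^sub>R 1" by (rule *[OF assms])
qed

text \<open>For a unit paravector this is conjugation followed by the half-turn that fixes
  \<open>v\<close> and negates its orthogonal complement. It is the source of all explicit formulas
  for rotations below.\<close>

lemma para_sigma:
  assumes "v \<in> paravectors n" "w \<in> paravectors n"
  shows "sigma v w = (2 * inner v (cl_conj w)) *\<^sub>R v - inner v v *\<^sub>R cl_conj w"
proof -
  have "v * w + cl_conj w * cl_conj v = (2 * inner v (cl_conj w)) *\<^sub>R 1"
    using para_polar[OF assms(1) para_cl_conj[OF assms(2)]] by simp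
  then have "v * w = (2 * inner v (cl_conj w)) *\<^sub>R 1 - cl_conj w * cl_conj v"
    by (simp add: algebra_simps)
  then show ?thesis
    using para_mult_conj(2)[OF assms(1)]
    by (simp add: sigma_def para_star[OF assms(1)] left_diff_distrib mult.assoc)
qed

lemma sigma_para: "v \<in> paravectors n \<Longrightarrow> w \<in> paravectors n \<Longrightarrow> sigma v w \<in> paravectors n"
  by (simp add: para_sigma para_diff para_scaleR para_cl_conj)

lemma sigma_mult: "sigma (x * y) v = sigma x (sigma y v)"
  by (simp add: sigma_def star_mult mult.assoc)

lemma sigma_scaleR_left: "sigma (c *\<^sub>R x) v = c\<^sup>2 *\<^sub>R sigma x v"
  by (simp add: sigma_def star_linear power2_eq_square)

lemma sigma_add: "sigma x (v + w) = sigma x v + sigma x w"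
  and sigma_scaleR: "sigma x (c *\<^sub>R v) = c *\<^sub>R sigma x v"
  by (simp_all add: sigma_def algebra_simps)

lemma sigma_one [simp]: "sigma 1 v = v"
  by (simp add: sigma_def)

lemma sigma_uminus_left [simp]: "sigma (- x) v = sigma x v"
  by (simp add: sigma_def star_uminus)

lemma sigma_grade: "sigma (grade x) v = grade (sigma x (grade v))"
  by (simp add: sigma_def grade_mult star_grade)

lemma sigma_cl_conj: "sigma (cl_conj x) v = grade (sigma (star x) (grade v))"
  using sigma_grade[of "star x"] by (simp add: cl_conj_def star_grade)

subsection \<open>The spin group\<close>

text \<open>The clause on \<open>star s\<close> makes the set stable under \<open>cl_conj\<close>,
  hence under inverses, since \<open>sigma (cl_conj s)\<close> is \<open>sigma (star s)\<close>
  conjugated by \<open>grade\<close>.\<close>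

definition para_unitary :: "nat \<Rightarrow> clifford set" where
  "para_unitary n = {s \<in> cl n. s * cl_conj s = 1 \<and> cl_conj s * s = 1 \<and>
     (\<forall>v\<in>paravectors n. sigma s v \<in> paravectors n \<and> sigma (star s) v \<in> paravectors n)}"

text \<open>The norm \<open>N\<close> stays free in the induction because the factors of an element
  of norm 1 need not have norm 1 themselves. It is multiplicative, and the inverse is the conjugate
  divided by \<open>N\<close>.\<close>

lemma clifford_group_similitude:
  assumes "x \<in> clifford_group n"
  shows "x \<in> cl n \<and> (\<exists>N>0. x * cl_conj x = N *\<^sub>R 1 \<and> cl_conj x * x = N *\<^sub>R 1) \<and>
     (\<forall>v\<in>paravectors n. sigma x v \<in> paravectors n \<and> sigma (star x) v \<in> paravectors n)"
  using assms
proof induction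
  case (paravector v)
  then show ?case
    using para_mult_conj[OF paravector(1)]
    by (auto intro!: para_cl exI[of _ "inner v v"] sigma_para simp: para_star)
next
  case (mult x y)
  from mult.IH obtain M N where M: "M > 0" "x * cl_conj x = M *\<^sub>R 1" "cl_conj x * x = M *\<^sub>R 1"
    and N: "N > 0" "y * cl_conj y = N *\<^sub>R 1" "cl_conj y * y = N *\<^sub>R 1" by blast
  have "x * y * cl_conj (x * y) = x * (y * cl_conj y) * cl_conj x"
    "cl_conj (x * y) * (x * y) = cl_conj y * (cl_conj x * x) * y"
    by (simp_all add: cl_conj_mult mult.assoc)
  then have "x * y * cl_conj (x * y) = (M * N) *\<^sub>R 1" "cl_conj (x * y) * (x * y) = (M * N) *\<^sub>R 1"
    using M N by simp_all
  moreover have "M * N > 0" using M N by simp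
  ultimately show ?case
    using mult.IH by (auto simp: cl_mult star_mult sigma_mult)
next
  case (inverse x)
  then obtain N where N: "N > 0" "x * cl_conj x = N *\<^sub>R 1" "cl_conj x * x = N *\<^sub>R 1" by blast
  then have inv: "inverse x = (1 / N) *\<^sub>R cl_conj x"
    by (intro clifford_inverse_unique) simp_all
  have "inverse x * cl_conj (inverse x) = (1 / N) *\<^sub>R 1" "cl_conj (inverse x) * inverse x = (1 / N) *\<^sub>R 1"
    unfolding inv using N by (simp_all add: cl_conj_linear)
  moreover have "1 / N > 0" using N by simp
  moreover have "inverse x \<in> cl n"
    using inverse.IH by (simp add: inv cl_scaleR cl_conj)
  ultimately show ?case
    using inverse.IH by (auto simp: inv star_linear sigma_scaleR_left sigma_cl_conj star_cl_conj sigma_grade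
        intro!: para_scaleR para_grade)
qed

lemma spin_group_subset_unitary: "s \<in> spin_group n \<Longrightarrow> s \<in> para_unitary n"
proof -
  assume s: "s \<in> spin_group n"
  then obtain N where N: "s * cl_conj s = N *\<^sub>R 1" "cl_conj s * s = N *\<^sub>R 1"
    using clifford_group_similitude[of s n] by (auto simp: spin_group_def)
  have "cl_coeff (s * cl_conj s) {} = 1" using s by (simp add: spin_group_def cl_norm_def)
  then have "N = 1" unfolding N by (simp add: one_clifford_def cl_coeff_blade)
  then show ?thesis
    using s N clifford_group_similitude[of s n] by (auto simp: spin_group_def para_unitary_def)
qed

lemma para_unitary_mult: "x \<in> para_unitary n \<Longrightarrow> y \<in> para_unitary n \<Longrightarrow> x * y \<in> para_unitary n"
proof -
  assume a: "x \<in> para_unitary n" "y \<in> para_unitary n"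
  have "x * y * cl_conj (x * y) = x * (y * cl_conj y) * cl_conj x"
    "cl_conj (x * y) * (x * y) = cl_conj y * (cl_conj x * x) * y"
    by (simp_all add: cl_conj_mult mult.assoc)
  then show ?thesis
    using a by (auto simp: para_unitary_def cl_mult star_mult sigma_mult)
qed

lemma para_unitary_conj: "x \<in> para_unitary n \<Longrightarrow> cl_conj x \<in> para_unitary n"
  by (auto simp: para_unitary_def cl_conj sigma_cl_conj star_cl_conj sigma_grade intro!: para_grade)

lemma para_unitary_star: "x \<in> para_unitary n \<Longrightarrow> star x \<in> para_unitary n"
proof -
  assume x: "x \<in> para_unitary n"
  then have "star (cl_conj x * x) = 1" "star (x * cl_conj x) = 1" by (simp_all add: para_unitary_def)
  then show ?thesis using x by (simp add: para_unitary_def star_mult star_cl_conj cl_star)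
qed

lemma para_unitary_uminus: "x \<in> para_unitary n \<Longrightarrow> - x \<in> para_unitary n"
  by (simp add: para_unitary_def cl_uminus cl_conj_uminus star_uminus)

lemma para_unitary_paravector:
  "v \<in> paravectors n \<Longrightarrow> inner v v = 1 \<Longrightarrow> v \<in> para_unitary n"
  using para_mult_conj[of v n] by (simp add: para_unitary_def para_cl para_star sigma_para)

lemma para_unitaryD:
  assumes "s \<in> para_unitary n"
  shows "s \<in> cl n" "s * cl_conj s = 1" "cl_conj s * s = 1" "star s * grade s = 1" "grade s * star s = 1"
    "v \<in> paravectors n \<Longrightarrow> sigma s v \<in> paravectors n"
    "s * (cl_conj s * x) = x" "cl_conj s * (s * x) = x"
proof -
  show 1: "s * cl_conj s = 1" "cl_conj s * s = 1" "s \<in> cl n"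
    "v \<in> paravectors n \<Longrightarrow> sigma s v \<in> paravectors n"
    using assms by (simp_all add: para_unitary_def)
  then have "grade (cl_conj s * s) = 1" "grade (s * cl_conj s) = 1" by simp_all
  then show "star s * grade s = 1" "grade s * star s = 1"
    by (simp_all add: grade_mult star_cl_conj)
  show "s * (cl_conj s * x) = x" "cl_conj s * (s * x) = x"
    using 1 by (simp_all flip: mult.assoc)
qed

lemma para_unitary_sigma_cancel:
  assumes "s \<in> para_unitary n"
  shows "sigma s (sigma (cl_conj s) v) = v" "sigma (cl_conj s) (sigma s v) = v"
  using para_unitaryD[OF assms] by (simp_all flip: sigma_mult)

lemma para_unitary_norm: "s \<in> para_unitary n \<Longrightarrow> norm s = 1"
  using scalar_part_mult_conj[of s s]
  by (simp add: para_unitaryD norm_eq_sqrt_inner one_clifford_def cl_coeff_blade)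

lemma para_unitary_sigma_inner:
  assumes s: "s \<in> para_unitary n" and v: "v \<in> paravectors n" and w: "w \<in> paravectors n"
  shows "inner (sigma s v) (sigma s w) = inner v w"
proof -
  have c: "sigma s v * cl_conj (sigma s w) = s * (v * cl_conj w) * cl_conj s" for v w
    using para_unitaryD(4)[OF s]
    by (simp add: sigma_def cl_conj_mult star_cl_conj mult.assoc)
      (metis mult.assoc mult.left_neutral)
  have "(2 * inner (sigma s v) (sigma s w)) *\<^sub>R 1 =
      sigma s v * cl_conj (sigma s w) + sigma s w * cl_conj (sigma s v)"
    using para_polar[OF para_unitaryD(6)[OF s v] para_unitaryD(6)[OF s w]] by simp
  also have "\<dots> = s * (v * cl_conj w + w * cl_conj v) * cl_conj s"
    unfolding c by (simp add: distrib_left distrib_right)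
  also have "\<dots> = (2 * inner v w) *\<^sub>R 1"
    unfolding para_polar[OF v w] by (simp add: para_unitaryD[OF s])
  finally show ?thesis by simp
qed

text \<open>As \<open>grade s\<close> inverts \<open>star s\<close>, fixing the last generator
  amounts to the commutation relation of \<open>cl_Suc_eliminate\<close>.\<close>

lemma para_unitary_fix_gen:
  assumes s: "s \<in> para_unitary (Suc n)" and fx: "sigma s (gen (Suc n)) = gen (Suc n)"
  shows "s \<in> para_unitary n"
proof -
  have "s * gen (Suc n) = s * gen (Suc n) * (star s * grade s)"
    by (simp add: para_unitaryD[OF s])
  also have "\<dots> = gen (Suc n) * grade s"
    using fx by (simp add: sigma_def flip: mult.assoc)
  finally have cl: "s \<in> cl n" by (rule cl_Suc_eliminate[OF para_unitaryD(1)[OF s]])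
  have "sigma s v \<in> paravectors n" "sigma (star s) v \<in> paravectors n" if "v \<in> paravectors n" for v
  proof -
    have "v \<in> paravectors (Suc n)" using that by (rule para_mono) simp
    then have "sigma s v \<in> paravectors (Suc n)" "sigma (star s) v \<in> paravectors (Suc n)"
      using s by (simp_all add: para_unitary_def)
    then show "sigma s v \<in> paravectors n" "sigma (star s) v \<in> paravectors n"
      using para_cl[OF that] cl by (simp_all add: para_Suc_cl cl_sigma cl_star)
  qed
  then show ?thesis
    using cl s by (simp add: para_unitary_def)
qed

text \<open>The kernel of the double cover. Each fixed generator is eliminated in turn until only
  scalars of square 1 remain.\<close>

lemma para_unitary_fix_gens:
  "s \<in> para_unitary n \<Longrightarrow> (\<And>j. j \<in> {1..n} \<Longrightarrow> sigma s (gen j) = gen j) \<Longrightarrow> s = 1 \<or> s = -1"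
proof (induction n)
  case 0
  then have s: "s = cl_coeff s {} *\<^sub>R 1" by (intro cl_0_scalar) (simp add: para_unitary_def)
  define c where "c = cl_coeff s {}"
  have s': "s = c *\<^sub>R 1" using s by (simp add: c_def)
  have "(c * c) *\<^sub>R (1 :: clifford) = 1 *\<^sub>R 1"
    using para_unitaryD(2)[OF 0(1)] by (simp add: s' cl_conj_linear)
  then have "c * c = 1" by (simp only: clifford_scalar_inject)
  then have "c = 1 \<or> c = -1" by (simp add: square_eq_1_iff)
  then show ?case unfolding s' by (elim disjE) simp_all
next
  case (Suc n)
  then show ?case using para_unitary_fix_gen[of s n] by simp
qed

lemma clifford_group_mono: "x \<in> clifford_group m \<Longrightarrow> m \<le> n \<Longrightarrow> x \<in> clifford_group n"
proof (induction rule: clifford_group.induct)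
  case (paravector v)
  then show ?case by (intro clifford_group.paravector para_mono[of v m n])
qed (auto intro: clifford_group.mult clifford_group.inverse)

text \<open>A reflection moves \<open>gen (Suc n)\<close> back to its place; what remains is free of that generator.\<close>

lemma para_unitary_clifford_group: "s \<in> para_unitary n \<Longrightarrow> s \<in> clifford_group n"
proof (induction n arbitrary: s)
  case 0
  then have "s = 1 \<or> s = -1" by (rule para_unitary_fix_gens) simp
  then show ?case by (auto intro!: clifford_group.paravector para_uminus)
next
  case (Suc n)
  let ?i = "gen (Suc n)"
  define w where "w = sigma s ?i"
  have i: "?i \<in> paravectors (Suc n)" by (simp add: para_gen)
  have w: "w \<in> paravectors (Suc n)" using para_unitaryD(6)[OF Suc.prems i] by (simp add: w_def)
  have ww: "inner w w = 1"
    using para_unitary_sigma_inner[OF Suc.prems i i] by (simp add: w_def inner_one_gen)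
  show ?case
  proof (cases "w = ?i")
    case True
    then have "s \<in> para_unitary n"
      using Suc.prems para_unitary_fix_gen[of s n] by (simp add: w_def)
    then show ?thesis using Suc.IH clifford_group_mono by force
  next
    case False
    define v where "v = (w - ?i) /\<^sub>R norm (w - ?i)"
    have v: "v \<in> paravectors (Suc n)" using w i by (simp add: v_def para_scaleR para_diff)
    have nz: "norm (w - ?i) \<noteq> 0" using False by simp
    have "norm v = 1" using nz by (simp add: v_def)
    then have vv: "inner v v = 1" by (simp add: norm_eq_sqrt_inner)
    have vU: "v \<in> para_unitary (Suc n)" by (rule para_unitary_paravector[OF v vv])
    \<comment> \<open>Both \<open>w\<close> and the generator are unit vectors and conjugation
      negates the generator, so the squared length of their difference is the coefficient produced
      by \<open>para_sigma\<close>. The sandwich by the difference then sends the generator to a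
      multiple of \<open>w\<close>.\<close>
    let ?q = "inner (w - ?i) (w - ?i)"
    have q: "?q = 2 * inner (w - ?i) (cl_conj ?i)"
      using ww by (simp add: cl_conj_gen inner_diff_left inner_diff_right inner_one_gen inner_commute)
    have "sigma (w - ?i) ?i = ?q *\<^sub>R (w - ?i) - ?q *\<^sub>R cl_conj ?i"
      unfolding para_sigma[OF para_diff[OF w i] i] q ..
    also have "\<dots> = ?q *\<^sub>R w"
      by (simp add: cl_conj_gen algebra_simps)
    finally have "sigma v ?i = ((inverse (norm (w - ?i)))\<^sup>2 * ?q) *\<^sub>R w"
      by (simp add: v_def sigma_scaleR_left)
    also have "(inverse (norm (w - ?i)))\<^sup>2 * ?q = 1"
      using nz by (simp add: power_inverse power2_norm_eq_inner)
    finally have vi: "sigma v ?i = w" by simp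
    let ?s = "cl_conj v * s"
    have sU: "?s \<in> para_unitary (Suc n)"
      by (intro para_unitary_mult para_unitary_conj vU Suc.prems)
    have "sigma ?s ?i = ?i"
      using para_unitary_sigma_cancel(2)[OF vU, of ?i] by (simp add: sigma_mult vi flip: w_def)
    then have "?s \<in> clifford_group n" by (intro Suc.IH para_unitary_fix_gen[OF sU])
    then have "?s \<in> clifford_group (Suc n)" by (rule clifford_group_mono) simp
    moreover have "v \<in> clifford_group (Suc n)" using vv by (intro clifford_group.paravector v) auto
    ultimately have "v * ?s \<in> clifford_group (Suc n)" by (rule clifford_group.mult[rotated])
    then show ?thesis by (simp only: para_unitaryD(7)[OF vU])
  qed
qed

lemma spin_group_eq: "spin_group n = para_unitary n"
proof (rule equalityI; rule subsetI)
  fix s assume s: "s \<in> para_unitary n"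
  have "cl_norm s = 1"
    by (simp add: cl_norm_def para_unitaryD(2)[OF s]) (simp add: one_clifford_def cl_coeff_blade)
  then show "s \<in> spin_group n"
    unfolding spin_group_def using para_unitary_clifford_group[OF s] by (intro CollectI conjI)
qed (rule spin_group_subset_unitary)


section \<open>Uniqueness of continuous lifts\<close>

lemma para_eqI:
  assumes "x \<in> paravectors m" "y \<in> paravectors m" "\<And>d. d \<in> paravectors m \<Longrightarrow> inner x d = inner y d"
  shows "x = y"
proof -
  have "inner (x - y) (x - y) = 0"
    using assms(3)[OF para_diff[OF assms(1,2)]] by (simp add: inner_diff_left)
  then show ?thesis by simp
qed

text \<open>\<open>Y\<close> is a reference lift. The quotient of \<open>w\<close> by
  \<open>Y\<close> covers a constant rotation, so \<open>w t\<close> is \<open>Y t * k\<close> up to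
  a sign. The sign is the value of the continuous function \<open>inner (w t) (Y t * k)\<close>,
  which takes only the values 1 and -1 and is 1 at \<open>t0\<close>. Continuity is needed only for
  right multiplication by the constant \<open>k\<close>.\<close>

lemma lift_unique:
  fixes w Y :: "'a :: topological_space \<Rightarrow> clifford"
  assumes I: "connected I" "t0 \<in> I"
    and cont: "continuous_on I w" "continuous_on I Y"
    and w: "\<And>t. t \<in> I \<Longrightarrow> w t \<in> para_unitary m" and Y: "\<And>t. t \<in> I \<Longrightarrow> Y t \<in> para_unitary m"
    and const: "\<And>t j. t \<in> I \<Longrightarrow> j \<in> {1..m} \<Longrightarrow>
      sigma (cl_conj (Y t) * w t) (gen j) = sigma (cl_conj (Y t0) * w t0) (gen j)"
    and t: "t \<in> I"
  shows "w t = Y t * (cl_conj (Y t0) * w t0)"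
proof -
  define k where "k = cl_conj (Y t0) * w t0"
  have k: "k \<in> para_unitary m"
    unfolding k_def by (intro para_unitary_mult para_unitary_conj Y w I)
  have pm: "w t = Y t * k \<or> w t = - (Y t * k)" if "t \<in> I" for t
  proof -
    define x where "x = cl_conj k * (cl_conj (Y t) * w t)"
    have x: "x \<in> para_unitary m"
      unfolding x_def by (intro para_unitary_mult para_unitary_conj Y w k that)
    have "sigma x (gen j) = gen j" if "j \<in> {1..m}" for j
    proof -
      have "sigma x (gen j) = sigma (cl_conj k) (sigma (cl_conj (Y t) * w t) (gen j))"
        unfolding x_def sigma_mult ..
      also have "\<dots> = sigma (cl_conj k) (sigma k (gen j))"
        using const[OF \<open>t \<in> I\<close> that] by (simp only: k_def)
      finally show ?thesis by (simp only: para_unitary_sigma_cancel[OF k])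
    qed
    then have "x = 1 \<or> x = -1" by (rule para_unitary_fix_gens[OF x])
    moreover have "Y t * (k * x) = w t"
      unfolding x_def by (simp only: para_unitaryD(7)[OF k] para_unitaryD(7)[OF Y[OF that]])
    ultimately show ?thesis by (elim disjE) simp_all
  qed
  let ?f = "\<lambda>t. inner (w t) (Y t * k)"
  have nrm: "inner (Y t * k) (Y t * k) = 1" if "t \<in> I" for t
    using para_unitary_norm[OF para_unitary_mult[OF Y[OF that] k]] by (simp add: norm_eq_sqrt_inner)
  have "continuous_on I ?f"
    by (intro continuous_intros cont bounded_linear.continuous_on[OF bounded_linear_mult_right_clifford])
  moreover have "finite (?f ` I)"
  proof (rule finite_subset)
    show "?f ` I \<subseteq> {1, -1}"
    proof
      fix y assume "y \<in> ?f ` I"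
      then obtain s where s: "s \<in> I" "y = ?f s" by blast
      from pm[OF s(1)] show "y \<in> {1, -1}"
        by (elim disjE) (simp_all add: s(2) nrm[OF s(1)])
    qed
  qed simp
  ultimately have "?f constant_on I"
    using continuous_finite_range_constant[OF I(1)] by blast
  then have "?f t = ?f t0" using t I(2) by (auto simp: constant_on_def)
  moreover have "w t0 = Y t0 * k"
    unfolding k_def by (simp only: para_unitaryD(7)[OF Y[OF I(2)]])
  ultimately have f: "?f t = 1" using nrm[OF I(2)] by simp
  from pm[OF t] have "w t = Y t * k"
  proof
    assume "w t = - (Y t * k)"
    then have "?f t = - 1" using nrm[OF t] by simp
    with f show ?thesis by simp
  qed
  then show ?thesis by (simp only: k_def)
qed

text \<open>The form in which the hypothesis arises: constancy of products between the vectors of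
  two frames, obtained by differentiating the metric. Such products against all \<open>d\<close>
  determine a paravector (\<open>para_eqI\<close>).\<close>

lemma lift_unique_inner:
  fixes w Y :: "'a :: topological_space \<Rightarrow> clifford"
  assumes I: "connected I" "t0 \<in> I"
    and cont: "continuous_on I w" "continuous_on I Y"
    and w: "\<And>t. t \<in> I \<Longrightarrow> w t \<in> para_unitary m" and Y: "\<And>t. t \<in> I \<Longrightarrow> Y t \<in> para_unitary m"
    and const: "\<And>t j d. t \<in> I \<Longrightarrow> j \<in> {1..m} \<Longrightarrow> d \<in> paravectors m \<Longrightarrow>
      inner (sigma (w t) (gen j)) (sigma (Y t) d) = inner (sigma (w t0) (gen j)) (sigma (Y t0) d)"
    and t: "t \<in> I"
  shows "w t = Y t * (cl_conj (Y t0) * w t0)"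
proof (rule lift_unique[where I = I, OF I cont w Y _ t])
  fix t j assume t: "t \<in> I" and j: "j \<in> {1..m}"
  have P: "sigma (cl_conj (Y t) * w t) (gen j) \<in> paravectors m" if "t \<in> I" for t
    by (intro para_unitaryD(6) para_unitary_mult para_unitary_conj Y w para_gen j that)
  have J: "inner (sigma (cl_conj (Y t) * w t) (gen j)) d = inner (sigma (w t) (gen j)) (sigma (Y t) d)"
    if "t \<in> I" "d \<in> paravectors m" for t d
  proof -
    have "inner (sigma (Y t) (sigma (cl_conj (Y t)) (sigma (w t) (gen j)))) (sigma (Y t) d) =
        inner (sigma (cl_conj (Y t)) (sigma (w t) (gen j))) d"
      using P[OF that(1)] unfolding sigma_mult by (intro para_unitary_sigma_inner[OF Y[OF that(1)]] that)
    then show ?thesis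
      by (simp only: sigma_mult para_unitary_sigma_cancel[OF Y[OF that(1)]])
  qed
  show "sigma (cl_conj (Y t) * w t) (gen j) = sigma (cl_conj (Y t0) * w t0) (gen j)"
    by (rule para_eqI[OF P[OF t] P[OF I(2)]]) (simp only: J[OF t] J[OF I(2)] const[OF t j])
qed

section \<open>Tangent vectors as paravectors\<close>

lemma coeff_gen: "cl_coeff (gen j) A = (if A = {j} then 1 else 0)"
  by (simp add: gen_def cl_coeff_blade)

lemma tangent_iff: "v \<in> tangent n \<longleftrightarrow> snd v \<in> paravectors n"
  by (cases v) (simp add: tangent_def)

lemma subspace_tangent: "subspace (tangent n)"
proof (rule subspaceI; unfold tangent_iff)
  show "snd (0 :: hvec) \<in> paravectors n" by simp
  show "snd (x + y) \<in> paravectors n" if "snd x \<in> paravectors n" "snd y \<in> paravectors n" for x y :: hvec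
    unfolding snd_add using that by (rule para_add)
  show "snd (c *\<^sub>R x) \<in> paravectors n" if "snd x \<in> paravectors n" for c and x :: hvec
    unfolding snd_scaleR using that by (rule para_scaleR)
qed

lemma to_para_in: "v \<in> tangent n \<Longrightarrow> to_para n v \<in> paravectors (n + 1)"
proof -
  assume "v \<in> tangent n"
  then have "snd v \<in> paravectors (n + 1)" by (intro para_mono[of "snd v" n "n + 1"]) (simp_all add: tangent_iff)
  then show ?thesis unfolding to_para_def by (intro para_add para_scaleR para_gen) simp_all
qed

lemma of_para_in: "x \<in> paravectors (n + 1) \<Longrightarrow> of_para n x \<in> tangent n"
proof -
  assume x: "x \<in> paravectors (n + 1)"
  let ?y = "x - cl_coeff x {n + 1} *\<^sub>R gen (n + 1)"
  have "?y \<in> paravectors n"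
  proof (rule paraI)
    fix A :: "nat set" assume A: "A \<noteq> {}" "\<And>j. j \<in> {1..n} \<Longrightarrow> A \<noteq> {j}"
    show "cl_coeff ?y A = 0"
    proof (cases "A = {n + 1}")
      case False
      then have "cl_coeff x A = 0"
        by (intro para_coeff_eq_0[OF x]) (use A in \<open>auto simp: le_Suc_eq\<close>)
      then show ?thesis using False by (simp add: coeff_gen)
    qed (simp add: coeff_gen)
  qed
  then show ?thesis by (simp add: of_para_def tangent_iff)
qed

lemma to_of_para [simp]: "to_para n (of_para n x) = x"
  by (simp add: to_para_def of_para_def)

lemma para_coeff_new: "x \<in> paravectors n \<Longrightarrow> cl_coeff x {n + 1} = 0"
  by (rule para_coeff_eq_0) auto

lemma of_to_para: "v \<in> tangent n \<Longrightarrow> of_para n (to_para n v) = v"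
  by (cases v) (simp add: to_para_def of_para_def tangent_iff para_coeff_new[simplified] coeff_gen)

lemma to_para_linear: "to_para n (v + w) = to_para n v + to_para n w"
  "to_para n (c *\<^sub>R v) = c *\<^sub>R to_para n v" "to_para n (v - w) = to_para n v - to_para n w"
  by (simp_all add: to_para_def algebra_simps)

lemma of_para_linear: "of_para n (x + y) = of_para n x + of_para n y"
  "of_para n (c *\<^sub>R x) = c *\<^sub>R of_para n x" "of_para n (x - y) = of_para n x - of_para n y"
  by (simp_all add: of_para_def algebra_simps)

lemma inner_gen_coeff: "inner x (gen j) = cl_coeff x {j}" "inner (gen j) x = cl_coeff x {j}"
proof -
  show "inner (gen j) x = cl_coeff x {j}"
    by (simp add: inner_clifford_def gen_def supp_blade cl_coeff_blade)
  then show "inner x (gen j) = cl_coeff x {j}" by (simp add: inner_commute)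
qed

lemma inner_to_para: "v \<in> tangent n \<Longrightarrow> w \<in> tangent n \<Longrightarrow> inner (to_para n v) (to_para n w) = inner v w"
  by (cases v; cases w)
    (simp add: to_para_def tangent_iff inner_add_left inner_add_right inner_gen_coeff para_coeff_new[simplified] coeff_gen)

lemma inner_of_para:
  "x \<in> paravectors (n + 1) \<Longrightarrow> y \<in> paravectors (n + 1) \<Longrightarrow> inner (of_para n x) (of_para n y) = inner x y"
  using inner_to_para[OF of_para_in of_para_in, of x n y] by simp

lemma to_para_std_vec:
  "to_para n (std_vec n 0) = gen (n + 1)"
  "j \<in> {1..n} \<Longrightarrow> to_para n (std_vec n j) = gen j"
  "to_para n (std_vec n (n + 1)) = 1"
  by (simp_all add: to_para_def std_vec_def)

lemma to_para_std_vec_in: "to_para n (std_vec n k) \<in> paravectors (n + 1)"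
  by (rule to_para_in) (auto simp: std_vec_def tangent_iff para_gen)

section \<open>Fields parallel with respect to an ideal point\<close>

text \<open>The inversion in the ideal point \<open>e\<close> carries the constant fields \<open>z d\<close>, which are parallel
  along horospheres and geodesics ending at \<open>Infinity\<close>, to fields with the same property
  at \<open>e\<close>. Composed with a reflection, its differential is the rotation by the unit paravector \<open>nav\<close>.\<close>

definition nav :: "nat \<Rightarrow> ideal_point \<Rightarrow> hvec \<Rightarrow> clifford" where
  "nav n e p = (case e of Infinity \<Rightarrow> 1
     | Boundary a \<Rightarrow> to_para n (p - (0, a)) /\<^sub>R norm (p - (0, a)))"

definition nav_field :: "nat \<Rightarrow> ideal_point \<Rightarrow> clifford \<Rightarrow> hvec \<Rightarrow> hvec" where
  "nav_field n e d p = fst p *\<^sub>R of_para n (sigma (nav n e p) d)"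

definition ideal :: "nat \<Rightarrow> ideal_point \<Rightarrow> bool" where
  "ideal n e \<longleftrightarrow> (\<forall>a. e = Boundary a \<longrightarrow> a \<in> paravectors n)"

lemma upper_halfD: "p \<in> upper_half n \<Longrightarrow> p \<in> tangent n" "p \<in> upper_half n \<Longrightarrow> fst p > 0"
  by (simp_all add: upper_half_def)

lemma nav_vector:
  assumes "p \<in> upper_half n" "a \<in> paravectors n"
  shows "p - (0, a) \<in> tangent n" "norm (p - (0, a)) > 0"
proof -
  show "p - (0, a) \<in> tangent n"
    using upper_halfD(1)[OF assms(1)] assms(2) by (simp add: tangent_iff para_diff)
  have "fst (p - (0, a)) \<noteq> 0" using upper_halfD(2)[OF assms(1)] by simp
  then have "p - (0, a) \<noteq> 0" by (metis fst_zero)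
  then show "norm (p - (0, a)) > 0" by simp
qed

lemma nav_para:
  assumes "p \<in> upper_half n" "ideal n e"
  shows "nav n e p \<in> paravectors (n + 1)" "inner (nav n e p) (nav n e p) = 1"
proof -
  have "nav n e p \<in> paravectors (n + 1) \<and> inner (nav n e p) (nav n e p) = 1"
  proof (cases e)
    case Infinity
    then show ?thesis by (simp add: nav_def inner_one_gen)
  next
    case (Boundary a)
    then have a: "a \<in> paravectors n" using assms by (simp add: ideal_def)
    let ?y = "p - (0, a)"
    have y: "?y \<in> tangent n" "norm ?y > 0" using nav_vector[OF assms(1) a] by simp_all
    have "inner (to_para n ?y /\<^sub>R norm ?y) (to_para n ?y /\<^sub>R norm ?y) = inner ?y ?y / (norm ?y)\<^sup>2"
      by (simp only: inner_scaleR_left inner_scaleR_right inner_to_para[OF y(1) y(1)])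
        (simp add: power2_eq_square divide_simps)
    then show ?thesis
      using y by (simp add: Boundary nav_def para_scaleR to_para_in[simplified] power2_norm_eq_inner[symmetric])
  qed
  then show "nav n e p \<in> paravectors (n + 1)" "inner (nav n e p) (nav n e p) = 1" by simp_all
qed

lemma nav_unitary: "p \<in> upper_half n \<Longrightarrow> ideal n e \<Longrightarrow> nav n e p \<in> para_unitary (n + 1)"
  using nav_para by (rule para_unitary_paravector)

lemma frame_of_nav: "frame_of n p (nav n e p * k) j = nav_field n e (sigma k (to_para n (std_vec n j))) p"
  by (simp add: frame_of_def nav_field_def sigma_mult)

lemma nav_field_Infinity: "nav_field n Infinity d p = fst p *\<^sub>R of_para n d"
  by (simp add: nav_field_def nav_def)

text \<open>This is \<open>para_sigma\<close> for the unit vector along \<open>y\<close>. Up to a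
  negative factor, the map applied to \<open>f\<close> is the differential of the inversion y /
  |y|^2, and \<open>cl_conj\<close> is the reflection composed with it.\<close>

lemma nav_field_Boundary:
  assumes p: "p \<in> upper_half n" and a: "a \<in> paravectors n" and d: "d \<in> paravectors (n + 1)"
  defines "y \<equiv> p - (0, a)" and "f \<equiv> of_para n (cl_conj d)"
  shows "nav_field n (Boundary a) d p = fst p *\<^sub>R ((2 * inner y f / inner y y) *\<^sub>R y - f)"
proof -
  have y: "y \<in> tangent n" "norm y > 0" using nav_vector[OF p a] by (simp_all add: y_def)
  have Y: "to_para n y \<in> paravectors (n + 1)" using y by (intro to_para_in)
  have cd: "cl_conj d \<in> paravectors (n + 1)" using d by (rule para_cl_conj)
  have "inner (to_para n y) (cl_conj d) = inner y f"
    using inner_to_para[OF y(1) of_para_in[OF cd]] by (simp add: f_def)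
  moreover have "inner (to_para n y) (to_para n y) = inner y y"
    using inner_to_para[OF y(1) y(1)] .
  ultimately have "sigma (to_para n y /\<^sub>R norm y) d =
      (inverse (norm y))\<^sup>2 *\<^sub>R ((2 * inner y f) *\<^sub>R to_para n y - inner y y *\<^sub>R cl_conj d)"
    by (simp only: sigma_scaleR_left para_sigma[OF Y d])
  also have "(inverse (norm y))\<^sup>2 = 1 / inner y y"
    by (simp add: power_one_over power2_norm_eq_inner inverse_eq_divide)
  finally have "sigma (nav n (Boundary a) p) d =
      (2 * inner y f / inner y y) *\<^sub>R to_para n y - cl_conj d"
    using y(2) by (simp add: nav_def y_def scaleR_diff_right)
  then show ?thesis
    by (simp add: nav_field_def of_para_linear of_to_para[OF y(1)] f_def)
qed

lemma hmetric_of_para: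
  assumes "p \<in> upper_half n" "x \<in> paravectors (n + 1)" "y \<in> paravectors (n + 1)"
  shows "hmetric p (fst p *\<^sub>R of_para n x) (fst p *\<^sub>R of_para n y) = inner x y"
  using upper_halfD(2)[OF assms(1)] inner_of_para[OF assms(2,3)]
  by (simp add: hmetric_def power2_eq_square)

text \<open>The factors z of the two fields cancel the denominator of the metric, so constancy of
  this metric product along a curve is the hypothesis of \<open>lift_unique_inner\<close>.\<close>

lemma hmetric_frame_nav:
  assumes "p \<in> upper_half n" "ideal n e" "w \<in> para_unitary (n + 1)" "d \<in> paravectors (n + 1)"
  shows "hmetric p (frame_of n p w j) (nav_field n e d p) =
     inner (sigma w (to_para n (std_vec n j))) (sigma (nav n e p) d)"
  unfolding frame_of_def nav_field_def
  by (intro hmetric_of_para assms para_unitaryD(6) nav_unitary to_para_std_vec_in)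

section \<open>Covariant derivatives along curves\<close>

lemma has_real_derivative_inner:
  fixes f g :: "real \<Rightarrow> 'a :: real_inner"
  assumes "(f has_vector_derivative f') (at t)" "(g has_vector_derivative g') (at t)"
  shows "((\<lambda>s. inner (f s) (g s)) has_real_derivative inner (f t) g' + inner f' (g t)) (at t)"
  using bounded_bilinear.has_vector_derivative[OF bounded_bilinear_inner assms]
  by (simp add: has_real_derivative_iff_has_vector_derivative)

lemma has_real_derivative_fst:
  "(c has_vector_derivative c') (at t) \<Longrightarrow> ((\<lambda>s. fst (c s :: hvec)) has_real_derivative fst c') (at t)"
  using bounded_linear.has_vector_derivative[OF bounded_linear_fst]
  by (simp add: has_real_derivative_iff_has_vector_derivative)

lemma inner_k: "inner u (1, 0 :: clifford) = fst u" "inner (1, 0 :: clifford) u = fst u"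
  by (cases u; simp)+

text \<open>Compatibility with the metric along a curve: the Christoffel terms involving the
  vertical components of \<open>V\<close> and \<open>W\<close> cancel between the two summands, and
  those with \<open>fst c'\<close> account for the derivative of 1 / z^2.\<close>

lemma has_real_derivative_hmetric:
  assumes z: "fst (c t) > 0" and c: "(c has_vector_derivative c') (at t)"
    and V: "(V has_vector_derivative V') (at t)" and W: "(W has_vector_derivative W') (at t)"
  shows "((\<lambda>s. hmetric (c s) (V s) (W s)) has_real_derivative
     hmetric (c t) (V' + christoffel (c t) c' (V t)) (W t) +
     hmetric (c t) (V t) (W' + christoffel (c t) c' (W t))) (at t)"
proof -
  let ?z = "fst (c t)"
  have eq: "hmetric (c t) (V' + christoffel (c t) c' (V t)) (W t) +
     hmetric (c t) (V t) (W' + christoffel (c t) c' (W t)) =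
     ((inner (V t) W' + inner V' (W t)) * ?z\<^sup>2 - inner (V t) (W t) * (2 * ?z * fst c')) / (?z\<^sup>2 * ?z\<^sup>2)"
    using z
    by (simp only: hmetric_def christoffel_def inner_scaleR_left inner_scaleR_right inner_k
        inner_diff_left inner_diff_right inner_add_left inner_add_right inner_commute[of c'])
      (simp add: field_simps power2_eq_square inner_commute)
  show ?thesis
    unfolding eq unfolding hmetric_def
    using z by (auto intro!: derivative_eq_intros has_real_derivative_inner V W has_real_derivative_fst c)
qed


text \<open>The transport equation for the field \<open>P\<close> of
  \<open>nav_field_Boundary\<close>, reduced to algebra: \<open>k\<close> is the vertical unit
  vector, \<open>y'\<close> the velocity of the ray, and the left side is the product rule. Pairing
  with an arbitrary \<open>u\<close> leaves a rational identity between real numbers.\<close>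

lemma nav_field_along_geodesic_Boundary:
  assumes z: "z > 0" and m: "inner y y = m" "m > 0" and yz: "inner y k = z" and kk: "inner k k = 1"
    and y': "y' = (2 * z\<^sup>2 / m) *\<^sub>R y - z *\<^sub>R k"
    and P: "P = z *\<^sub>R ((2 * inner y f / m) *\<^sub>R y - f)"
  shows "(inner y' k * (2 * inner y f / m) + z * (2 * inner y' f / m - 2 * inner y f * (2 * inner y y') / m\<^sup>2)) *\<^sub>R y
      + (z * (2 * inner y f / m)) *\<^sub>R y' - inner y' k *\<^sub>R f
    = - ((1 / z) *\<^sub>R (inner y' P *\<^sub>R k - inner y' k *\<^sub>R P - inner P k *\<^sub>R y'))"
proof -
  have ip: "inner y' k = 2 * z ^ 3 / m - z" "inner y' f = 2 * z\<^sup>2 / m * inner y f - z * inner k f"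
    "inner y y' = z\<^sup>2" "inner y' y = z\<^sup>2"
    using m(2) by (simp_all add: y' inner_diff_left inner_diff_right m(1) kk yz inner_commute[of k y]
        power2_eq_square power3_eq_cube)
  have iP: "inner y' P = z * (2 * inner y f / m * z\<^sup>2 - inner y' f)"
    "inner P k = z * (2 * inner y f / m * z - inner k f)"
    by (simp_all add: P inner_diff_left inner_diff_right ip yz inner_commute[of f k])
  show ?thesis
  proof (subst vector_eq_ldot[symmetric], rule allI)
    fix u
    define a b c where "a = inner u y" "b = inner u k" "c = inner u f"
    define \<phi> \<psi> where "\<phi> = inner y f" "\<psi> = inner k f"
    show "inner u ((inner y' k * (2 * inner y f / m) + z * (2 * inner y' f / m - 2 * inner y f * (2 * inner y y') / m\<^sup>2)) *\<^sub>R y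
      + (z * (2 * inner y f / m)) *\<^sub>R y' - inner y' k *\<^sub>R f)
    = inner u (- ((1 / z) *\<^sub>R (inner y' P *\<^sub>R k - inner y' k *\<^sub>R P - inner P k *\<^sub>R y')))"
      unfolding iP ip unfolding P y'
      using z m(2)
      by (simp only: inner_add_right inner_diff_right inner_minus_right inner_scaleR_right
        a_b_c_def[symmetric] \<phi>_\<psi>_def[symmetric])
        (simp add: field_simps power2_eq_square power3_eq_cube)
  qed
qed


text \<open>Unit-speed geodesics issuing from the ideal point \<open>e\<close> are the integral curves of a vector field.\<close>

definition geodesic_ray :: "nat \<Rightarrow> ideal_point \<Rightarrow> (real \<Rightarrow> hvec) \<Rightarrow> bool" where
  "geodesic_ray n e c \<longleftrightarrow> (\<forall>t. c t \<in> upper_half n \<and>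
     (c has_vector_derivative (case e of Infinity \<Rightarrow> - fst (c t) *\<^sub>R (1, 0)
        | Boundary a \<Rightarrow> (2 * (fst (c t))\<^sup>2 / inner (c t - (0, a)) (c t - (0, a))) *\<^sub>R (c t - (0, a))
            - fst (c t) *\<^sub>R (1, 0))) (at t))"

lemma nav_field_parallel_along:
  assumes c: "geodesic_ray n e c" and e: "ideal n e" and d: "d \<in> paravectors (n + 1)"
  shows "parallel_along c (\<lambda>t. nav_field n e d (c t))"
  unfolding parallel_along_def
proof
  fix t
  have up: "c s \<in> upper_half n" for s using c by (simp add: geodesic_ray_def)
  have z: "fst (c s) > 0" for s using upper_halfD(2)[OF up] .
  define k :: hvec where "k = (1, 0)"
  show "((\<lambda>t. nav_field n e d (c t)) has_vector_derivative
      - christoffel (c t) (vector_derivative c (at t)) (nav_field n e d (c t))) (at t)"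
  proof (cases e)
    case Infinity
    then have c': "(c has_vector_derivative - fst (c s) *\<^sub>R (1, 0)) (at s)" for s
      using c by (simp add: geodesic_ray_def)
    have "((\<lambda>s. fst (c s)) has_real_derivative - fst (c t)) (at t)"
      using has_real_derivative_fst[OF c'] by simp
    from has_vector_derivative_scaleR[OF this has_vector_derivative_const[of "of_para n d"]]
    have "((\<lambda>t. nav_field n e d (c t)) has_vector_derivative - fst (c t) *\<^sub>R of_para n d) (at t)"
      by (simp add: Infinity nav_field_Infinity)
    moreover have "- christoffel (c t) (vector_derivative c (at t)) (nav_field n e d (c t)) =
      - fst (c t) *\<^sub>R of_para n d"
      unfolding vector_derivative_at[OF c'] Infinity nav_field_Infinity christoffel_def k_def[symmetric]
      using z[of t] by (simp add: k_def inner_k scaleR_diff_right mult_ac del: scaleR_Pair)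
    ultimately show ?thesis by simp
  next
    case (Boundary a)
    then have a: "a \<in> paravectors n" using e by (simp add: ideal_def)
    define y where "y s = c s - (0, a)" for s
    define f where "f = of_para n (cl_conj d)"
    define y' where "y' = (2 * (fst (c t))\<^sup>2 / inner (y t) (y t)) *\<^sub>R y t - fst (c t) *\<^sub>R k"
    have c': "(c has_vector_derivative y') (at t)"
      using c Boundary by (simp add: geodesic_ray_def y'_def y_def k_def)
    have dy: "(y has_vector_derivative y') (at t)"
      unfolding y_def using has_vector_derivative_diff[OF c' has_vector_derivative_const[of "(0, a)"]] by simp
    have "norm (y s) > 0" for s using nav_vector[OF up a] by (simp add: y_def)
    then have m: "inner (y s) (y s) > 0" for s using inner_gt_zero_iff zero_less_norm_iff by blast
    have yk: "inner (y s) k = fst (c s)" for s by (simp add: k_def inner_k y_def)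
    define P where "P s = (fst (c s) * (2 * inner (y s) f / inner (y s) (y s))) *\<^sub>R y s - fst (c s) *\<^sub>R f" for s
    have P: "nav_field n e d (c s) = P s" for s
      unfolding Boundary nav_field_Boundary[OF up a d] P_def y_def f_def
      by (simp add: scaleR_diff_right)
    have dz: "((\<lambda>s. fst (c s)) has_real_derivative inner y' k) (at t)"
      using has_real_derivative_fst[OF c'] by (simp add: k_def inner_k)
    have "(P has_vector_derivative
       (inner y' k * (2 * inner (y t) f / inner (y t) (y t)) + fst (c t) *
         (2 * inner y' f / inner (y t) (y t) - 2 * inner (y t) f * (2 * inner (y t) y') / (inner (y t) (y t))\<^sup>2)) *\<^sub>R y t
      + (fst (c t) * (2 * inner (y t) f / inner (y t) (y t))) *\<^sub>R y' - inner y' k *\<^sub>R f) (at t)"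
      unfolding P_def
      using m[of t]
      by (auto intro!: derivative_eq_intros has_vector_derivative_diff has_vector_derivative_scaleR dy dz
          has_real_derivative_inner simp: inner_commute[of y'] field_simps power2_eq_square)
    also note nav_field_along_geodesic_Boundary[where P = "P t", OF z refl m yk _ y'_def, of f]
    finally show ?thesis
      unfolding P vector_derivative_at[OF c'] christoffel_def
      by (simp add: k_def inner_k P_def scaleR_diff_right del: scaleR_Pair)
  qed
qed

text \<open>The equation |y|^2 = 2 r z of the horosphere has already removed the denominator from
  the field \<open>P\<close>, and \<open>yy\<close> is the derivative of that equation along a
  curve. The vector on the right is the normal of the horosphere, so the tangential derivative
  vanishes.\<close>

lemma nav_field_along_horosphere_Boundary:
  fixes y y' f k P :: "'a :: real_inner" and r z :: real
  assumes z: "z > 0" "r > 0" and kk: "inner k k = 1" "inner y k = z" and fk: "inner f k = 0"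
    and yy: "inner y y' = r * inner y' k"
    and P: "P = (inner y f / r) *\<^sub>R y - z *\<^sub>R f"
  shows "((inner y' f / r) *\<^sub>R y + (inner y f / r) *\<^sub>R y' - inner y' k *\<^sub>R f) +
     ((1 / z) *\<^sub>R (inner y' P *\<^sub>R k - inner y' k *\<^sub>R P - inner P k *\<^sub>R y'))
    = (- (inner y' f - inner y f * inner y' k / z) / z) *\<^sub>R ((z / r) *\<^sub>R (r *\<^sub>R k - y))"
proof -
  have iP: "inner y' P = inner y f / r * (r * inner y' k) - z * inner y' f"
    "inner P k = inner y f / r * z"
    using yy by (simp_all add: P inner_diff_left inner_diff_right kk fk inner_commute[of y' y])
  show ?thesis
  proof (subst vector_eq_ldot[symmetric], rule allI)
    fix u
    show "inner u (((inner y' f / r) *\<^sub>R y + (inner y f / r) *\<^sub>R y' - inner y' k *\<^sub>R f) +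
     ((1 / z) *\<^sub>R (inner y' P *\<^sub>R k - inner y' k *\<^sub>R P - inner P k *\<^sub>R y')))
    = inner u ((- (inner y' f - inner y f * inner y' k / z) / z) *\<^sub>R ((z / r) *\<^sub>R (r *\<^sub>R k - y)))"
      unfolding iP unfolding P using z
      by (simp only: inner_add_right inner_diff_right inner_minus_right inner_scaleR_right)
        (simp add: field_simps power2_eq_square power3_eq_cube)
  qed
qed

text \<open>The sphere touches the boundary at \<open>a\<close>, so squaring its equation in terms
  of \<open>p - (0, a)\<close> leaves no constant term.\<close>

lemma horo_Boundary_iff:
  assumes "centre S = Boundary a" "p \<in> upper_half n" "hsize S > 0"
  shows "p \<in> horo n S \<longleftrightarrow> inner (p - (0, a)) (p - (0, a)) = 2 * hsize S * fst p"
proof -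
  define y where "y = p - (0, a)"
  define k :: hvec where "k = (1, 0)"
  have "p - (hsize S, a) = y - hsize S *\<^sub>R k" by (cases p) (simp add: y_def k_def)
  then have "dist p (hsize S, a) = hsize S \<longleftrightarrow> norm (y - hsize S *\<^sub>R k) = hsize S"
    by (simp add: dist_norm)
  also have "\<dots> \<longleftrightarrow> (norm (y - hsize S *\<^sub>R k))\<^sup>2 = (hsize S)\<^sup>2"
    using assms(3) by (simp add: power2_eq_iff_nonneg)
  also have "(norm (y - hsize S *\<^sub>R k))\<^sup>2 = inner y y - 2 * hsize S * fst p + (hsize S)\<^sup>2"
    unfolding power2_norm_eq_inner
    by (simp add: inner_diff_left inner_diff_right k_def inner_k y_def power2_eq_square algebra_simps del: scaleR_Pair)
  finally show ?thesis
    using assms by (simp add: horo_def y_def)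
qed

lemma horo_upper: "p \<in> horo n S \<Longrightarrow> p \<in> upper_half n"
  by (simp add: horo_def split: ideal_point.splits)

text \<open>For \<open>d\<close> in \<open>paravectors n\<close> the field is tangent to the
  horosphere; the remaining direction \<open>gen (n + 1)\<close> gives the normal
  (\<open>normal_out_nav_field\<close>).\<close>

lemma nav_field_parallel_on_horo:
  assumes c: "\<And>s. c s \<in> horo n S" and c': "(c has_vector_derivative c') (at t)"
    and e: "ideal n (centre S)" and r: "hsize S > 0" and d: "d \<in> paravectors n"
  obtains P' where "((\<lambda>s. nav_field n (centre S) d (c s)) has_vector_derivative P') (at t)"
    "P' + christoffel (c t) c' (nav_field n (centre S) d (c t)) \<in> span {normal_out S (c t)}"
proof -
  have up: "c s \<in> upper_half n" for s using horo_upper[OF c] .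
  have z: "fst (c s) > 0" for s using upper_halfD(2)[OF up] .
  have d1: "d \<in> paravectors (n + 1)" using d by (rule para_mono) simp
  define k :: hvec where "k = (1, 0)"
  have dz: "((\<lambda>s. fst (c s)) has_real_derivative inner c' k) (at t)"
    using has_real_derivative_fst[OF c'] by (simp add: k_def inner_k)
  have fk: "inner (of_para n d) k = 0" if "d \<in> paravectors n" for d
    using para_coeff_new[OF that] by (simp add: k_def inner_k of_para_def)
  show ?thesis
  proof (cases "centre S")
    case Infinity
    have h: "fst (c s) = hsize S" for s using c[of s] Infinity by (simp add: horo_def)
    have "inner c' k = 0" using dz unfolding h by (rule DERIV_unique) simp
    then have "0 + christoffel (c t) c' (nav_field n (centre S) d (c t)) =
       (inner c' (nav_field n (centre S) d (c t)) / (fst (c t))\<^sup>2) *\<^sub>R normal_out S (c t)"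
      using fk[OF d] z[of t]
      by (simp add: Infinity nav_field_Infinity christoffel_def normal_out_def k_def inner_k power2_eq_square)
    moreover have "((\<lambda>s. nav_field n (centre S) d (c s)) has_vector_derivative 0) (at t)"
      by (simp add: Infinity nav_field_Infinity h)
    ultimately show ?thesis by (intro that[of 0]) (simp_all add: span_base span_scale)
  next
    case (Boundary a)
    then have a: "a \<in> paravectors n" using e by (simp add: ideal_def)
    let ?r = "hsize S"
    define y where "y s = c s - (0, a)" for s
    define f where "f = of_para n (cl_conj d)"
    have m: "inner (y s) (y s) = 2 * ?r * fst (c s)" for s
      using c[of s] horo_Boundary_iff[OF Boundary up r] by (simp add: y_def)
    have dy: "(y has_vector_derivative c') (at t)"
      unfolding y_def using has_vector_derivative_diff[OF c' has_vector_derivative_const[of "(0, a)"]] by simp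
    have "((\<lambda>s. inner (y s) (y s)) has_real_derivative 2 * inner (y t) c') (at t)"
      using has_real_derivative_inner[OF dy dy] by (simp add: inner_commute)
    moreover have "((\<lambda>s. inner (y s) (y s)) has_real_derivative 2 * ?r * inner c' k) (at t)"
      unfolding m using dz by (auto intro!: derivative_eq_intros)
    ultimately have yy: "inner (y t) c' = ?r * inner c' k"
      using DERIV_unique by fastforce
    define P where "P s = (inner (y s) f / ?r) *\<^sub>R y s - fst (c s) *\<^sub>R f" for s
    have P: "nav_field n (centre S) d (c s) = P s" for s
    proof -
      have "nav_field n (centre S) d (c s) = fst (c s) *\<^sub>R ((2 * inner (y s) f / inner (y s) (y s)) *\<^sub>R y s - f)"
        unfolding Boundary nav_field_Boundary[OF up a d1] y_def f_def ..
      also have "\<dots> = P s" unfolding m P_def using z[of s] r by (simp add: scaleR_diff_right)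
      finally show ?thesis .
    qed
    have "(P has_vector_derivative
       (inner c' f / ?r) *\<^sub>R y t + (inner (y t) f / ?r) *\<^sub>R c' - inner c' k *\<^sub>R f) (at t)"
      unfolding P_def using r
      by (auto intro!: derivative_eq_intros has_vector_derivative_diff has_vector_derivative_scaleR dy dz
          has_real_derivative_inner)
    moreover have "((inner c' f / ?r) *\<^sub>R y t + (inner (y t) f / ?r) *\<^sub>R c' - inner c' k *\<^sub>R f)
       + christoffel (c t) c' (P t) \<in> span {normal_out S (c t)}"
    proof -
      have N: "normal_out S (c t) = (fst (c t) / ?r) *\<^sub>R (?r *\<^sub>R k - y t)"
        by (cases "c t") (simp add: normal_out_def Boundary y_def k_def)
      have kk: "inner k k = 1" "inner (y t) k = fst (c t)" by (simp_all add: k_def inner_k y_def)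
      have G: "christoffel (c t) c' (P t) =
        (1 / fst (c t)) *\<^sub>R (inner c' (P t) *\<^sub>R k - inner c' k *\<^sub>R P t - inner (P t) k *\<^sub>R c')"
        by (simp add: christoffel_def k_def inner_k del: scaleR_Pair)
      show ?thesis
        unfolding N G nav_field_along_horosphere_Boundary[OF z r kk fk[OF para_cl_conj[OF d], folded f_def] yy P_def]
        by (intro span_scale span_base) simp
    qed
    ultimately show ?thesis unfolding P[symmetric] by (rule that)
  qed
qed


section \<open>Spin frames on horospheres\<close>

lemma spin_decorated_horosphereD:
  assumes "spin_decorated_horosphere n S"
  shows "hsize S > 0" "ideal n (centre S)"
  using assms by (simp_all add: spin_decorated_horosphere_def decorated_horosphere_def ideal_def)

lemma continuous_on_to_para:
  assumes "continuous_on I c" shows "continuous_on I (\<lambda>t. to_para n (c t))"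
  unfolding to_para_def by (intro continuous_intros assms)

lemma continuous_on_nav:
  assumes c: "continuous_on I c" and up: "\<And>t. t \<in> I \<Longrightarrow> c t \<in> upper_half n" and e: "ideal n e"
  shows "continuous_on I (\<lambda>t. nav n e (c t))"
proof (cases e)
  case (Boundary a)
  then have a: "a \<in> paravectors n" using e by (simp add: ideal_def)
  have "continuous_on I (\<lambda>t. c t - (0, a))" by (intro continuous_intros c)
  moreover have "\<forall>t\<in>I. norm (c t - (0, a)) \<noteq> 0"
    using nav_vector(2)[OF up a] by fastforce
  ultimately show ?thesis
    unfolding Boundary nav_def ideal_point.case
    by (intro continuous_on_scaleR continuous_on_inverse continuous_on_norm continuous_on_to_para)
qed (simp add: nav_def)

text \<open>\<open>parallel_on_horo\<close> speaks of curves defined for all parameters, so two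
  points have to be joined by one. The inversion \<open>I\<close> carries a horosphere at
  \<open>a\<close> to the horizontal plane of height 1 / (2 r); a straight line there is inverted
  back.\<close>

lemma horo_curve:
  assumes S: "hsize S > 0" "ideal n (centre S)" and p: "p0 \<in> horo n S" "p1 \<in> horo n S"
  obtains c :: "real \<Rightarrow> hvec" and c' where "\<And>s. c s \<in> horo n S"
    "\<And>s. (c has_vector_derivative c' s) (at s)" "c 0 = p0" "c 1 = p1"
proof (cases "centre S")
  case Infinity
  define c where "c s = p0 + s *\<^sub>R (p1 - p0)" for s
  have t: "p0 \<in> tangent n" "p1 \<in> tangent n" "fst p0 = hsize S" "fst p1 = hsize S"
    using p by (simp_all add: horo_def Infinity upper_half_def)
  then have "c s \<in> horo n S" for s
    unfolding horo_def Infinity upper_half_def c_def using S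
    by (auto intro!: subspace_add[OF subspace_tangent] subspace_scale[OF subspace_tangent] subspace_diff[OF subspace_tangent])
  moreover have "(c has_vector_derivative (p1 - p0)) (at s)" for s
    unfolding c_def by (auto intro!: derivative_eq_intros)
  ultimately show ?thesis by (intro that[of c "\<lambda>_. p1 - p0"]) (auto simp: c_def)
next
  case (Boundary a)
  then have a: "a \<in> paravectors n" using S by (simp add: ideal_def)
  let ?r = "hsize S"
  define y where "y p = p - (0, a)" for p :: hvec
  define I where "I v = v /\<^sub>R inner v v" for v :: hvec
  have up: "p \<in> upper_half n" if "p \<in> horo n S" for p using that by (rule horo_upper)
  have m: "inner (y p) (y p) = 2 * ?r * fst p" if "p \<in> horo n S" for p
    using horo_Boundary_iff[OF Boundary up[OF that] S(1)] that by (simp add: y_def)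
  have I: "I (I v) = v" if "v \<noteq> 0" for v
    using that by (simp add: I_def)
  have q: "I (y p) \<in> tangent n" "fst (I (y p)) = 1 / (2 * ?r)" "y p \<noteq> 0" if "p \<in> horo n S" for p
  proof -
    show "I (y p) \<in> tangent n"
      unfolding I_def y_def by (intro subspace_scale[OF subspace_tangent] nav_vector(1)[OF up[OF that] a])
    show "y p \<noteq> 0" using nav_vector(2)[OF up[OF that] a] by (auto simp: y_def)
    have "fst (I (y p)) = fst p / inner (y p) (y p)"
      by (simp add: I_def y_def divide_inverse)
    then show "fst (I (y p)) = 1 / (2 * ?r)"
      unfolding m[OF that] using upper_halfD(2)[OF up[OF that]] by simp
  qed
  define g where "g s = I (y p0) + s *\<^sub>R (I (y p1) - I (y p0))" for s
  define c where "c s = (0, a) + I (g s)" for s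
  have g: "g s \<in> tangent n" "fst (g s) = 1 / (2 * ?r)" for s
    unfolding g_def using q[OF p(1)] q[OF p(2)]
    by (auto intro!: subspace_add[OF subspace_tangent] subspace_scale[OF subspace_tangent] subspace_diff[OF subspace_tangent])
  have g0: "g s \<noteq> 0" for s using g(2)[of s] S(1) by auto
  have gg: "inner (g s) (g s) > 0" for s unfolding inner_gt_zero_iff by (rule g0)
  have "c s \<in> horo n S" for s
  proof -
    have fc: "fst (c s) = (1 / (2 * ?r)) / inner (g s) (g s)"
    proof -
      have "fst (c s) = inverse (inner (g s) (g s)) * fst (g s)"
        unfolding c_def I_def by (simp only: fst_add fst_scaleR fst_conv real_scaleR_def add_0)
      then show ?thesis by (simp only: g(2) divide_inverse mult.commute)
    qed
    have up: "c s \<in> upper_half n"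
    proof -
      have "I (g s) \<in> tangent n" unfolding I_def by (intro subspace_scale[OF subspace_tangent] g)
      then have "c s \<in> tangent n"
        using a by (auto simp: c_def tangent_iff intro!: para_add)
      moreover have "fst (c s) > 0" unfolding fc using S(1) gg[of s] by simp
      ultimately show ?thesis by (simp add: upper_half_def)
    qed
    have inv: "inverse m * (inverse m * m) = 1 / m" if "m > 0" for m :: real
      using that by (simp add: field_simps)
    have "inner (I (g s)) (I (g s)) = 1 / inner (g s) (g s)"
      unfolding I_def inner_scaleR_left inner_scaleR_right by (rule inv[OF gg])
    then show ?thesis
      using horo_Boundary_iff[OF Boundary up S(1)] fc S(1) by (simp add: c_def)
  qed
  moreover have "\<exists>c'. (c has_vector_derivative c') (at s)" for s
  proof -
    have dg: "(g has_vector_derivative (I (y p1) - I (y p0))) (at s)"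
      unfolding g_def by (auto intro!: derivative_eq_intros)
    have "((\<lambda>s. inverse (inner (g s) (g s))) has_real_derivative
        - (inverse (inner (g s) (g s)) * (inner (g s) (I (y p1) - I (y p0)) + inner (I (y p1) - I (y p0)) (g s))
          * inverse (inner (g s) (g s)))) (at s)"
      using g0[of s] by (intro DERIV_inverse' has_real_derivative_inner dg) simp
    from has_vector_derivative_add[OF has_vector_derivative_const[of "(0, a)"] has_vector_derivative_scaleR[OF this dg]]
    show ?thesis unfolding c_def I_def by (rule exI)
  qed
  then have "\<forall>s. \<exists>c'. (c has_vector_derivative c') (at s)" by (rule allI)
  from choice[OF this] obtain c' where "\<forall>s. (c has_vector_derivative c' s) (at s)" by (rule exE)
  then have "(c has_vector_derivative c' s) (at s)" for s by (rule spec)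
  moreover have "c 0 = p0" "c 1 = p1"
    using I[OF q(3)[OF p(1)]] I[OF q(3)[OF p(2)]] by (simp_all add: c_def g_def y_def)
  ultimately show ?thesis by (rule that)
qed

text \<open>\<open>gen (n + 1)\<close> stands for the vertical direction, the normal towards
  \<open>Infinity\<close>, and \<open>nav\<close> carries it to the normal towards the centre. This
  identifies the first vector of the outward frame.\<close>

lemma normal_out_nav_field:
  assumes S: "hsize S > 0" "ideal n (centre S)" and p: "p \<in> horo n S"
  shows "normal_out S p = nav_field n (centre S) (gen (n + 1)) p"
proof (cases "centre S")
  case Infinity
  then show ?thesis by (simp add: normal_out_def nav_field_Infinity of_para_def coeff_gen)
next
  case (Boundary a)
  then have a: "a \<in> paravectors n" using S by (simp add: ideal_def)
  let ?r = "hsize S"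
  define y where "y = p - (0, a)"
  define k :: hvec where "k = (1, 0)"
  have up: "p \<in> upper_half n" using p by (rule horo_upper)
  have g: "gen (n + 1) \<in> paravectors (n + 1)" by (simp add: para_gen)
  have f: "of_para n (cl_conj (gen (n + 1))) = - k"
    by (simp add: cl_conj_gen of_para_def coeff_gen k_def)
  have m: "inner y y = 2 * ?r * fst p"
    using horo_Boundary_iff[OF Boundary up S(1)] p by (simp add: y_def)
  have "nav_field n (centre S) (gen (n + 1)) p = fst p *\<^sub>R ((2 * inner y (- k) / inner y y) *\<^sub>R y - (- k))"
    unfolding Boundary nav_field_Boundary[OF up a g] f y_def ..
  also have "\<dots> = (fst p / ?r) *\<^sub>R (?r *\<^sub>R k - y)"
  proof -
    have "inner y k = fst p" by (simp add: k_def inner_k y_def)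
    then show ?thesis
      unfolding m using S(1) upper_halfD(2)[OF up]
      by (simp add: scaleR_diff_right scaleR_add_right del: scaleR_Pair)
  qed
  also have "\<dots> = normal_out S p"
    by (cases p) (simp add: normal_out_def Boundary y_def k_def)
  finally show ?thesis ..
qed

lemma of_para_inject: "of_para n x = of_para n y \<Longrightarrow> x = y"
  using to_of_para by metis

lemma hmetric_linear:
  "hmetric p (c *\<^sub>R v) w = c * hmetric p v w" "hmetric p v (c *\<^sub>R w) = c * hmetric p v w"
  "hmetric p v w = hmetric p w v"
  by (simp_all add: hmetric_def inner_commute)

text \<open>The derivative vanishes because both covariant derivatives are normal to the horosphere.\<close>

lemma hmetric_line_field_constant:
  assumes S: "spin_decorated_horosphere n S" and j: "j \<in> {1..n}" and d: "d \<in> paravectors n"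
    and c: "\<And>s. c s \<in> horo n S" "\<And>s. (c has_vector_derivative c' s) (at s)"
  shows "hmetric (c t) (line_field S j (c t)) (nav_field n (centre S) d (c t)) =
    hmetric (c t0) (line_field S j (c t0)) (nav_field n (centre S) d (c t0))"
proof -
  let ?V = "line_field S j" and ?P = "nav_field n (centre S) d" and ?N = "normal_out S"
  note S' = spin_decorated_horosphereD[OF S]
  have up: "c s \<in> upper_half n" for s using horo_upper[OF c(1)] .
  have dec: "hmetric p (?V p) (?N p) = 0" if "p \<in> horo n S" for p
    using S j that by (simp add: spin_decorated_horosphere_def decorated_horosphere_def)
  have par: "parallel_on_horo n S ?V"
    using S j by (simp add: spin_decorated_horosphere_def decorated_horosphere_def)
  have d1: "d \<in> paravectors (n + 1)" using d by (rule para_mono) simp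
  have g: "gen (n + 1) \<in> paravectors (n + 1)" by (simp add: para_gen)
  have NP: "hmetric p (?N p) (?P p) = 0" if p: "p \<in> horo n S" for p
  proof -
    note pu = horo_upper[OF p] and U = nav_unitary[OF horo_upper[OF p] S'(2)]
    have "hmetric p (?N p) (?P p) = inner (gen (n + 1)) d"
      unfolding normal_out_nav_field[OF S' p] nav_field_def
      by (subst hmetric_of_para[OF pu para_unitaryD(6)[OF U g] para_unitaryD(6)[OF U d1]])
        (rule para_unitary_sigma_inner[OF U g d1])
    then show ?thesis by (simp only: inner_gen_coeff para_coeff_new[OF d])
  qed
  have "((\<lambda>s. hmetric (c s) (?V (c s)) (?P (c s))) has_real_derivative 0) (at s)" for s
  proof -
    obtain V' where V': "((\<lambda>s. ?V (c s)) has_vector_derivative V') (at s)"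
      "V' + christoffel (c s) (c' s) (?V (c s)) \<in> span {?N (c s)}"
      using par c unfolding parallel_on_horo_def by meson
    obtain P' where P': "((\<lambda>s. ?P (c s)) has_vector_derivative P') (at s)"
      "P' + christoffel (c s) (c' s) (?P (c s)) \<in> span {?N (c s)}"
      using nav_field_parallel_on_horo[OF c S'(2,1) d] by metis
    obtain x y where x: "V' + christoffel (c s) (c' s) (?V (c s)) = x *\<^sub>R ?N (c s)"
      and y: "P' + christoffel (c s) (c' s) (?P (c s)) = y *\<^sub>R ?N (c s)"
      using V'(2) P'(2) by (auto simp: span_singleton)
    have "hmetric (c s) (V' + christoffel (c s) (c' s) (?V (c s))) (?P (c s)) +
      hmetric (c s) (?V (c s)) (P' + christoffel (c s) (c' s) (?P (c s))) = 0"
      unfolding x y by (simp add: hmetric_linear(1,2) NP[OF c(1)] dec[OF c(1)])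
    then show ?thesis
      using has_real_derivative_hmetric[OF upper_halfD(2)[OF up] c(2) V'(1) P'(1)] by simp
  qed
  then show ?thesis by (intro DERIV_isconst_all) simp
qed

lemma spin_lift_F_out:
  assumes S: "spin_decorated_horosphere n S" and p: "p \<in> horo n S"
  shows "W_out S p \<in> para_unitary (n + 1)"
    "sigma (W_out S p) (gen (n + 1)) = sigma (nav n (centre S) p) (gen (n + 1))"
    "j \<in> {1..n} \<Longrightarrow> frame_of n p (W_out S p) j = line_field S j p"
    "k \<le> n + 1 \<Longrightarrow> frame_of n p (W_out S p) k = F_out n S p k"
proof -
  note S' = spin_decorated_horosphereD[OF S]
  have "spin_lift n p (F_out n S p) (W_out S p)"
    using S p by (simp add: spin_decorated_horosphere_def spin_frame_field_def)
  then have *: "W_out S p \<in> spin_group (n + 1)"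
    "\<And>k. k \<le> n + 1 \<Longrightarrow> frame_of n p (W_out S p) k = F_out n S p k"
    by (simp_all add: spin_lift_def)
  show "W_out S p \<in> para_unitary (n + 1)" using *(1) by (simp only: spin_group_eq)
  show "k \<le> n + 1 \<Longrightarrow> frame_of n p (W_out S p) k = F_out n S p k" by (rule *)
  show "j \<in> {1..n} \<Longrightarrow> frame_of n p (W_out S p) j = line_field S j p"
    using *(2)[of j] by (simp add: F_out_def complete_frame_def)
  have "frame_of n p (W_out S p) 0 = nav_field n (centre S) (gen (n + 1)) p"
    using *(2)[of 0] by (simp add: F_out_def complete_frame_def normal_out_nav_field[OF S' p])
  then show "sigma (W_out S p) (gen (n + 1)) = sigma (nav n (centre S) p) (gen (n + 1))"
    using upper_halfD(2)[OF horo_upper[OF p]] unfolding frame_of_def nav_field_def to_para_std_vec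
    by (intro of_para_inject[of n]) simp
qed

text \<open>Along a curve in the horosphere, \<open>W_out\<close> and \<open>nav\<close> are
  compared as two lifts. They share the normal, and the line fields have constant products with the
  parallel fields of \<open>nav\<close>, so \<open>lift_unique_inner\<close> applies.\<close>

lemma W_out_nav:
  assumes S: "spin_decorated_horosphere n S" and p0: "p0 \<in> horo n S" and p: "p \<in> horo n S"
  shows "W_out S p = nav n (centre S) p * (cl_conj (nav n (centre S) p0) * W_out S p0)"
proof -
  let ?e = "centre S"
  note S' = spin_decorated_horosphereD[OF S]
  obtain c c' where c: "\<And>s. c s \<in> horo n S" "\<And>s. (c has_vector_derivative c' s) (at s)"
    and c01: "c 0 = p0" "c 1 = p"
    by (rule horo_curve[OF S' p0 p]) (rule that)
  have up: "c s \<in> upper_half n" for s using horo_upper[OF c(1)] .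
  have cont: "continuous_on UNIV c"
    using c(2) by (meson continuous_at_imp_continuous_on has_vector_derivative_continuous)
  note L = spin_lift_F_out[OF S c(1)]
  have U: "nav n ?e (c s) \<in> para_unitary (n + 1)" for s by (rule nav_unitary[OF up S'(2)])
  have g: "gen (n + 1) \<in> paravectors (n + 1)" by (simp add: para_gen)
  have "W_out S (c 1) = nav n ?e (c 1) * (cl_conj (nav n ?e (c 0)) * W_out S (c 0))"
  proof (rule lift_unique_inner[where I = UNIV and w = "\<lambda>s. W_out S (c s)" and Y = "\<lambda>s. nav n ?e (c s)"
        and t = 1 and ?t0.0 = 0 and m = "n + 1"])
    show "continuous_on UNIV (\<lambda>s. W_out S (c s))"
    proof (rule continuous_on_compose2[OF _ cont])
      show "continuous_on (horo n S) (W_out S)"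
        using S by (simp add: spin_decorated_horosphere_def spin_frame_field_def)
      show "range c \<subseteq> horo n S" using c(1) by blast
    qed
    show "continuous_on UNIV (\<lambda>s. nav n ?e (c s))"
      by (rule continuous_on_nav[OF cont up S'(2)])
    fix t j d assume j: "j \<in> {1..n + 1}" and d: "d \<in> paravectors (n + 1)"
    have c1: "inner (sigma (W_out S (c t)) (gen (n + 1))) (sigma (nav n ?e (c t)) d) = inner (gen (n + 1)) d"
      if d: "d \<in> paravectors (n + 1)" for t d
      unfolding L(2) by (rule para_unitary_sigma_inner[OF U g d])
    show "inner (sigma (W_out S (c t)) (gen j)) (sigma (nav n ?e (c t)) d) =
      inner (sigma (W_out S (c 0)) (gen j)) (sigma (nav n ?e (c 0)) d)"
    proof (cases "j = n + 1")
      case True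
      then show ?thesis by (simp only: c1[OF d])
    next
      case False
      then have j: "j \<in> {1..n}" using j by auto
      have gj: "gen j \<in> paravectors (n + 1)" using j by (intro para_gen) simp
      \<comment> \<open>The tangential part of \<open>d\<close>. Its normal part contributes
        nothing, since the line field is orthogonal to the normal.\<close>
      define d0 where "d0 = snd (of_para n d)"
      have d0: "d0 \<in> paravectors n" using of_para_in[OF d] by (simp add: d0_def tangent_iff)
      have d0': "d0 \<in> paravectors (n + 1)" using d0 by (rule para_mono) simp
      have dd: "d = d0 + cl_coeff d {n + 1} *\<^sub>R gen (n + 1)"
        by (simp add: d0_def of_para_def)
      have split: "inner (sigma (W_out S (c t)) (gen j)) (sigma (nav n ?e (c t)) d) =
        hmetric (c t) (line_field S j (c t)) (nav_field n ?e d0 (c t))" for t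
      proof -
        have "inner (sigma (W_out S (c t)) (gen j)) (sigma (nav n ?e (c t)) (gen (n + 1))) = inner (gen j) (gen (n + 1))"
          unfolding L(2)[symmetric] by (rule para_unitary_sigma_inner[OF L(1) gj g])
        also have "\<dots> = 0" using j by (simp add: inner_one_gen)
        finally have z: "inner (sigma (W_out S (c t)) (gen j)) (sigma (nav n ?e (c t)) (gen (n + 1))) = 0" .
        have "inner (sigma (W_out S (c t)) (gen j)) (sigma (nav n ?e (c t)) d) =
          inner (sigma (W_out S (c t)) (gen j)) (sigma (nav n ?e (c t)) d0)"
          by (subst dd) (simp only: sigma_add sigma_scaleR inner_add_right inner_scaleR_right z mult_zero_right add_0_right)
        also have "\<dots> = hmetric (c t) (line_field S j (c t)) (nav_field n ?e d0 (c t))"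
          unfolding L(3)[OF j, symmetric] hmetric_frame_nav[OF up S'(2) L(1) d0'] to_para_std_vec(2)[OF j] ..
        finally show ?thesis .
      qed
      show ?thesis unfolding split by (rule hmetric_line_field_constant[OF S j d0 c])
    qed
  qed (simp_all only: U L(1) UNIV_I connected_UNIV)
  then show ?thesis by (simp only: c01)
qed

text \<open>A lift of the rotation by \<theta> in the plane of \<open>gen (n + 1)\<close> and 1,
  hence the half angle. The minus sign makes it turn from \<open>gen (n + 1)\<close>, the normal,
  towards 1.\<close>

definition normal_turn :: "nat \<Rightarrow> real \<Rightarrow> clifford" where
  "normal_turn n \<theta> = cos (\<theta> / 2) *\<^sub>R 1 - sin (\<theta> / 2) *\<^sub>R gen (n + 1)"

lemma normal_turn_para:
  "normal_turn n \<theta> \<in> paravectors (n + 1)" "inner (normal_turn n \<theta>) (normal_turn n \<theta>) = 1"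
proof -
  show "normal_turn n \<theta> \<in> paravectors (n + 1)"
    unfolding normal_turn_def by (intro para_diff para_scaleR para_gen para_one) simp
  show "inner (normal_turn n \<theta>) (normal_turn n \<theta>) = 1"
    using sin_cos_squared_add[of "\<theta> / 2"]
    by (simp add: normal_turn_def inner_diff_left inner_diff_right inner_one_gen power2_eq_square)
qed

lemma normal_turn_unitary: "normal_turn n \<theta> \<in> para_unitary (n + 1)"
  using normal_turn_para by (rule para_unitary_paravector)

lemma sigma_normal_turn:
  "sigma (normal_turn n \<theta>) (gen (n + 1)) = cos \<theta> *\<^sub>R gen (n + 1) + sin \<theta> *\<^sub>R 1"
  "j \<in> {1..n} \<Longrightarrow> sigma (normal_turn n \<theta>) (gen j) = gen j"
proof -
  have g: "gen (n + 1) \<in> paravectors (n + 1)" by (simp add: para_gen)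
  have i: "inner (normal_turn n \<theta>) (cl_conj (gen (n + 1))) = sin (\<theta> / 2)"
    by (simp add: normal_turn_def cl_conj_gen inner_diff_left inner_one_gen)
  have "sigma (normal_turn n \<theta>) (gen (n + 1)) =
     (2 * sin (\<theta> / 2)) *\<^sub>R (cos (\<theta> / 2) *\<^sub>R 1 - sin (\<theta> / 2) *\<^sub>R gen (n + 1)) + gen (n + 1)"
    unfolding para_sigma[OF normal_turn_para(1) g] i normal_turn_para(2) by (simp add: cl_conj_gen normal_turn_def)
  also have "\<dots> = (1 - 2 * (sin (\<theta> / 2))\<^sup>2) *\<^sub>R gen (n + 1) + (2 * sin (\<theta> / 2) * cos (\<theta> / 2)) *\<^sub>R 1"
    by (simp add: scaleR_diff_right scaleR_diff_left power2_eq_square mult.assoc)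
  also have "1 - 2 * (sin (\<theta> / 2))\<^sup>2 = cos \<theta>"
    using cos_double_sin[of "\<theta> / 2"] by simp
  also have "2 * sin (\<theta> / 2) * cos (\<theta> / 2) = sin \<theta>"
    using sin_double[of "\<theta> / 2"] by simp
  finally show "sigma (normal_turn n \<theta>) (gen (n + 1)) = cos \<theta> *\<^sub>R gen (n + 1) + sin \<theta> *\<^sub>R 1" .
  assume j: "j \<in> {1..n}"
  then have gj: "gen j \<in> paravectors (n + 1)" by (intro para_gen) simp
  have "inner (normal_turn n \<theta>) (cl_conj (gen j)) = 0"
    using j by (simp add: normal_turn_def cl_conj_gen inner_diff_left inner_one_gen)
  then show "sigma (normal_turn n \<theta>) (gen j) = gen j"
    unfolding para_sigma[OF normal_turn_para(1) gj] normal_turn_para(2) by (simp add: cl_conj_gen)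
qed

text \<open>A rotation expressed in the frame itself acts on the right, so by uniqueness of lifts
  the path starting at \<open>W_out\<close> is \<open>W_out * normal_turn\<close>, whose last factor
  at \<pi> is \<open>- gen (n + 1)\<close>. Both signs cover the same frame; the path selects this
  one.\<close>

lemma W_in_W_out:
  assumes S: "spin_decorated_horosphere n S" and p: "p \<in> horo n S"
  shows "W_in S p = - (W_out S p * gen (n + 1))"
proof -
  note L = spin_lift_F_out[OF S p]
  let ?W = "W_out S p" and ?R = "normal_turn n"
  have z: "fst p > 0" using upper_halfD(2)[OF horo_upper[OF p]] .
  have "rotated_spin_frame n p pi (F_out n S p) ?W (W_in S p)"
    using S p by (simp add: spin_decorated_horosphere_def)
  then obtain r where r: "continuous_on {0..pi} r" "r 0 = ?W" "r pi = W_in S p"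
    and rl: "\<And>\<theta>. \<theta> \<in> {0..pi} \<Longrightarrow> spin_lift n p (rotate_frame n \<theta> (F_out n S p)) (r \<theta>)"
    unfolding rotated_spin_frame_def by blast
  have rU: "r \<theta> \<in> para_unitary (n + 1)" if "\<theta> \<in> {0..pi}" for \<theta>
    using rl[OF that] by (simp add: spin_lift_def spin_group_eq)
  have YU: "?W * ?R \<theta> \<in> para_unitary (n + 1)" for \<theta>
    by (intro para_unitary_mult L normal_turn_unitary)
  have F: "F_out n S p k = fst p *\<^sub>R of_para n (sigma ?W (to_para n (std_vec n k)))" if "k \<le> n + 1" for k
    using L(4)[OF that] by (simp add: frame_of_def)
  have same: "sigma (r \<theta>) (gen j) = sigma (?W * ?R \<theta>) (gen j)" if \<theta>: "\<theta> \<in> {0..pi}" and j: "j \<in> {1..n + 1}" for \<theta> j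
  proof -
    have fr: "frame_of n p (r \<theta>) k = rotate_frame n \<theta> (F_out n S p) k" if "k \<le> n + 1" for k
      using rl[OF \<theta>] that by (simp add: spin_lift_def)
    show ?thesis
    \<comment> \<open>The generator with number \<open>n + 1\<close> sits at frame index 0, and
      frame index \<open>n + 1\<close> belongs to the paravector 1; these are the two indices that
      \<open>rotate_frame\<close> mixes.\<close>
    proof (cases "j = n + 1")
      case True
      have "fst p *\<^sub>R of_para n (sigma (r \<theta>) (gen (n + 1))) = frame_of n p (r \<theta>) 0"
        by (simp only: frame_of_def to_para_std_vec)
      also have "\<dots> = cos \<theta> *\<^sub>R F_out n S p 0 + sin \<theta> *\<^sub>R F_out n S p (n + 1)"
        by (subst fr) (simp_all add: rotate_frame_def)
      also have "\<dots> = fst p *\<^sub>R of_para n (sigma ?W (cos \<theta> *\<^sub>R gen (n + 1) + sin \<theta> *\<^sub>R 1))"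
        unfolding F[OF le0] F[OF order_refl] to_para_std_vec sigma_add sigma_scaleR of_para_linear
        by (simp add: scaleR_add_right mult.commute)
      also have "\<dots> = fst p *\<^sub>R of_para n (sigma (?W * ?R \<theta>) (gen (n + 1)))"
        unfolding sigma_mult sigma_normal_turn(1) ..
      finally show ?thesis using z unfolding True by (intro of_para_inject[of n]) simp
    next
      case False
      then have j: "j \<in> {1..n}" "j \<le> n + 1" using j by auto
      have "fst p *\<^sub>R of_para n (sigma (r \<theta>) (gen j)) = frame_of n p (r \<theta>) j"
        by (simp only: frame_of_def to_para_std_vec(2)[OF j(1)])
      also have "\<dots> = F_out n S p j"
        using j by (subst fr) (simp_all add: rotate_frame_def)
      also have "\<dots> = fst p *\<^sub>R of_para n (sigma (?W * ?R \<theta>) (gen j))"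
        unfolding F[OF j(2)] to_para_std_vec(2)[OF j(1)] sigma_mult sigma_normal_turn(2)[OF j(1)] ..
      finally show ?thesis using z by (intro of_para_inject[of n]) simp
    qed
  qed
  have R0: "?R 0 = 1" and Rpi: "?R pi = - gen (n + 1)" by (simp_all add: normal_turn_def)
  have "r pi = ?W * ?R pi * (cl_conj (?W * ?R 0) * r 0)"
  proof (rule lift_unique[where I = "{0..pi}" and w = r and Y = "\<lambda>\<theta>. ?W * ?R \<theta>" and m = "n + 1" and t = pi and ?t0.0 = 0])
    show "continuous_on {0..pi} (\<lambda>\<theta>. ?W * ?R \<theta>)"
      unfolding normal_turn_def right_diff_distrib mult_scaleR_right
      by (intro continuous_intros) simp_all
    fix t j assume t: "t \<in> {0..pi}" and j: "j \<in> {1..n + 1}"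
    have id: "sigma (cl_conj (?W * ?R t) * r t) (gen j) = gen j" if "t \<in> {0..pi}" for t
      unfolding sigma_mult[of "cl_conj (?W * ?R t)"] same[OF that j]
      by (rule para_unitary_sigma_cancel[OF YU])
    show "sigma (cl_conj (?W * ?R t) * r t) (gen j) = sigma (cl_conj (?W * ?R 0) * r 0) (gen j)"
      using id[OF t] id[of 0] by simp
  qed (use r rU YU in auto)
  then show ?thesis
    by (simp add: R0 Rpi r para_unitaryD(3)[OF L(1)])
qed

lemma horo_nonempty:
  assumes "hsize S > 0" "ideal n (centre S)"
  obtains p where "p \<in> horo n S"
proof (cases "centre S")
  case Infinity
  then have "(hsize S, 0) \<in> horo n S" using assms by (simp add: horo_def upper_half_def tangent_iff)
  then show ?thesis by (rule that)
next
  case (Boundary a)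
  then have "(2 * hsize S, a) \<in> horo n S"
    using assms by (simp add: horo_def upper_half_def tangent_iff ideal_def dist_prod_def dist_real_def)
  then show ?thesis by (rule that)
qed

text \<open>The constant lies in the group for \<open>n\<close>, not only for \<open>n + 1\<close>,
  because \<open>W_out\<close> and \<open>nav\<close> send \<open>gen (n + 1)\<close> to the same
  normal.\<close>

lemma spin_frames_nav:
  assumes S: "spin_decorated_horosphere n S"
  obtains \<kappa> where "\<kappa> \<in> para_unitary n"
    "\<And>p. p \<in> horo n S \<Longrightarrow> W_out S p = nav n (centre S) p * \<kappa>"
    "\<And>p. p \<in> horo n S \<Longrightarrow> W_in S p = - (nav n (centre S) p * \<kappa> * gen (n + 1))"
proof -
  note S' = spin_decorated_horosphereD[OF S]
  obtain p0 where p0: "p0 \<in> horo n S" using horo_nonempty[OF S'] .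
  note L = spin_lift_F_out[OF S p0]
  have U: "nav n (centre S) p0 \<in> para_unitary (n + 1)" by (rule nav_unitary[OF horo_upper[OF p0] S'(2)])
  let ?k = "cl_conj (nav n (centre S) p0) * W_out S p0"
  have k1: "?k \<in> para_unitary (n + 1)" by (intro para_unitary_mult para_unitary_conj U L)
  have "sigma ?k (gen (n + 1)) = gen (n + 1)"
    unfolding sigma_mult L(2) by (rule para_unitary_sigma_cancel[OF U])
  then have "?k \<in> para_unitary n" using k1 para_unitary_fix_gen[of ?k n] by simp
  moreover have "W_out S p = nav n (centre S) p * ?k" if "p \<in> horo n S" for p
    by (rule W_out_nav[OF S p0 that])
  moreover have "W_in S p = - (nav n (centre S) p * ?k * gen (n + 1))" if "p \<in> horo n S" for p
    unfolding W_in_W_out[OF S that] W_out_nav[OF S p0 that] ..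
  ultimately show ?thesis by (rule that)
qed


section \<open>Geodesics\<close>

text \<open>\<open>geo_from\<close> starts at the boundary point \<open>a\<close> and is vertical for \<open>v = 0\<close>; \<open>geo_down\<close> starts at
  \<open>Infinity\<close>. The parameters \<open>B\<close> and \<open>A\<close> are time shifts.\<close>

definition geo_height :: "clifford \<Rightarrow> real \<Rightarrow> real \<Rightarrow> real" where
  "geo_height v B t = 1 / (B * (inner v v * exp t + exp (- t)))"

definition geo_from :: "clifford \<Rightarrow> clifford \<Rightarrow> real \<Rightarrow> real \<Rightarrow> hvec" where
  "geo_from a v B t = (geo_height v B t, a + (geo_height v B t * exp t) *\<^sub>R v)"

definition geo_down :: "clifford \<Rightarrow> real \<Rightarrow> real \<Rightarrow> hvec" where
  "geo_down a A t = (exp (- t) / A, a)"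

lemma geo_height_denominator: "B > 0 \<Longrightarrow> B * (inner v v * exp t + exp (- t)) > 0"
  by (intro mult_pos_pos add_nonneg_pos) simp_all

lemma geo_height_mult_denominator:
  assumes "B > 0"
  shows "geo_height v B t * (B * (inner v v * exp t + exp (- t))) = 1"
proof -
  have "1 / x * x = 1" if "x > 0" for x :: real using that by simp
  then show ?thesis unfolding geo_height_def using geo_height_denominator[OF assms] .
qed

lemma geo_height_pos: "B > 0 \<Longrightarrow> geo_height v B t > 0"
  using geo_height_denominator by (simp add: geo_height_def)

lemma geodesic_acceleration:
  fixes k V :: "'a :: real_inner"
  assumes "z > 0"
  shows "- ((1 / z) *\<^sub>R (z\<^sup>2 *\<^sub>R k - a *\<^sub>R V - a *\<^sub>R V)) = (2 * a / z) *\<^sub>R V - z *\<^sub>R k"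
  using assms by (subst vector_eq_ldot[symmetric])
    (simp only: inner_diff_right inner_minus_right inner_scaleR_right, simp add: field_simps power2_eq_square)

text \<open>In terms of \<open>u = 1/z\<close> the geodesic equation is the linear equation \<open>u'' = u\<close>, and \<open>x' / z\<^sup>2\<close> is
  conserved.\<close>

lemma geodesic_first_integrals:
  assumes "unit_speed_geodesic n c"
  obtains A B q where "A \<ge> 0" "B \<ge> 0" "q \<in> paravectors n" "4 * A * B = inner q q"
    "\<And>t. 1 / fst (c t) = A * exp t + B * exp (- t)"
    "\<And>t. ((\<lambda>t. snd (c t)) has_vector_derivative (fst (c t))\<^sup>2 *\<^sub>R q) (at t)"
    "\<And>t. fst (c t) > 0"
proof -
  define V where "V t = vector_derivative c (at t)" for t
  define z where "z t = fst (c t)" for t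
  have up: "c t \<in> upper_half n" for t using assms by (simp add: unit_speed_geodesic_def)
  have z: "z t > 0" for t using upper_halfD(2)[OF up] by (simp add: z_def)
  have c: "(c has_vector_derivative V t) (at t)" for t
    using assms by (simp add: unit_speed_geodesic_def V_def vector_derivative_works)
  have "hmetric (c t) (V t) (V t) = 1" for t
    using assms by (simp add: unit_speed_geodesic_def V_def)
  then have VV: "inner (V t) (V t) = (z t)\<^sup>2" for t
    using z[of t] by (simp add: hmetric_def z_def)
  have V': "(V has_vector_derivative (2 * fst (V t) / z t) *\<^sub>R V t - z t *\<^sub>R (1, 0)) (at t)" for t
  proof -
    have "(V has_vector_derivative - christoffel (c t) (V t) (V t)) (at t)"
      using assms unfolding unit_speed_geodesic_def parallel_along_def V_def by blast
    moreover have "- christoffel (c t) (V t) (V t) = (2 * fst (V t) / z t) *\<^sub>R V t - z t *\<^sub>R (1, 0)"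
      unfolding christoffel_def VV z_def[symmetric] by (rule geodesic_acceleration[OF z])
    ultimately show ?thesis by simp
  qed
  have dz: "(z has_real_derivative fst (V t)) (at t)" for t
    unfolding z_def by (rule has_real_derivative_fst[OF c])
  have dVz: "((\<lambda>t. fst (V t)) has_real_derivative 2 * fst (V t) / z t * fst (V t) - z t) (at t)" for t
    using has_real_derivative_fst[OF V'] by simp
  define g where "g t = - fst (V t) / (z t)\<^sup>2" for t
  have du: "((\<lambda>t. 1 / z t) has_real_derivative g t) (at t)" for t
    unfolding g_def using z[of t]
    by (auto intro!: derivative_eq_intros dz simp: power2_eq_square)
  have dg: "(g has_real_derivative 1 / z t) (at t)" for t
    unfolding g_def using z[of t]
    by (auto intro!: derivative_eq_intros dz dVz simp: power2_eq_square field_simps)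
  \<comment> \<open>\<open>g\<close> is the derivative of 1 / z, so these are the coefficients of
    the exponentials with the given initial values.\<close>
  define A where "A = (1 / z 0 + g 0) / 2"
  define B where "B = (1 / z 0 - g 0) / 2"
  define u where "u t = 1 / z t" for t
  note du = du[folded u_def] and dg = dg[folded u_def]
  \<comment> \<open>The second-order equation splits into first-order equations for
    \<open>u + g\<close> and \<open>u - g\<close>, each solved by an integrating factor.\<close>
  have "((\<lambda>t. (u t + g t) * exp (- t)) has_real_derivative 0) (at t)" for t
    by (auto intro!: derivative_eq_intros du dg simp: algebra_simps)
  then have a: "(u t + g t) * exp (- t) = (u 0 + g 0) * exp (- 0)" for t
    by (intro DERIV_isconst_all) simp
  have "((\<lambda>t. (u t - g t) * exp t) has_real_derivative 0) (at t)" for t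
    by (auto intro!: derivative_eq_intros du dg simp: algebra_simps)
  then have b: "(u t - g t) * exp t = (u 0 - g 0) * exp 0" for t
    by (intro DERIV_isconst_all) simp
  have pm: "u t + g t = 2 * A * exp t" "u t - g t = 2 * B * exp (- t)" for t
  proof -
    have "u t + g t = (u t + g t) * exp (- t) * exp t" "u t - g t = (u t - g t) * exp t * exp (- t)"
      by (simp_all add: exp_minus)
    then show "u t + g t = 2 * A * exp t" "u t - g t = 2 * B * exp (- t)"
      unfolding a[of t] b[of t] by (simp_all add: A_def B_def u_def)
  qed
  have u: "1 / z t = A * exp t + B * exp (- t)" for t
    using pm[of t] unfolding u_def by simp
  define q where "q = snd (V 0) /\<^sub>R (z 0)\<^sup>2"
  have dsV: "((\<lambda>t. snd (V t)) has_vector_derivative (2 * fst (V t) / z t) *\<^sub>R snd (V t)) (at t)" for t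
    using bounded_linear.has_vector_derivative[OF bounded_linear_snd V'] by simp
  have "((\<lambda>t. (1 / (z t)\<^sup>2) *\<^sub>R snd (V t)) has_vector_derivative 0) (at t)" for t
  proof -
    have "((\<lambda>t. 1 / (z t)\<^sup>2) has_real_derivative - 2 * fst (V t) / (z t) ^ 3) (at t)"
      using z[of t]
      by (auto intro!: derivative_eq_intros dz simp: power2_eq_square power3_eq_cube field_simps)
    from has_vector_derivative_scaleR[OF this dsV] show ?thesis
      using z[of t] by (simp add: power2_eq_square power3_eq_cube mult.commute flip: scaleR_add_left)
  qed
  then obtain q' where "\<And>t. (1 / (z t)\<^sup>2) *\<^sub>R snd (V t) = q'"
    using has_vector_derivative_zero_constant[of UNIV "\<lambda>t. (1 / (z t)\<^sup>2) *\<^sub>R snd (V t)"] by auto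
  then have q: "(1 / (z t)\<^sup>2) *\<^sub>R snd (V t) = q" for t
    by (metis q_def inverse_eq_divide)
  have sV: "snd (V t) = (z t)\<^sup>2 *\<^sub>R q" for t
    using z[of t] by (simp flip: q[of t])
  have V0: "inner (V 0) (V 0) = fst (V 0) * fst (V 0) + inner (snd (V 0)) (snd (V 0))"
    by (simp add: inner_prod_def)
  \<comment> \<open>The unit speed condition at time 0, rewritten in the conserved
    quantities.\<close>
  have qq: "4 * A * B = inner q q"
  proof -
    have "4 * A * B = (1 / z 0)\<^sup>2 - (g 0)\<^sup>2"
    proof -
      have "4 * ((x + y) / 2) * ((x - y) / 2) = x\<^sup>2 - y\<^sup>2" for x y :: real
        by (simp add: power2_eq_square field_simps)
      then show ?thesis unfolding A_def B_def .
    qed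
    also have "\<dots> = ((z 0)\<^sup>2 - fst (V 0) * fst (V 0)) / (z 0) ^ 4"
      using z[of 0] by (simp add: g_def field_simps power2_eq_square power4_eq_xxxx)
    also have "\<dots> = (z 0) ^ 4 * inner q q / (z 0) ^ 4"
    proof -
      have "(z 0)\<^sup>2 - fst (V 0) * fst (V 0) = (z 0) ^ 4 * inner q q"
        using V0 unfolding VV sV by (simp add: power2_eq_square power4_eq_xxxx)
      then show ?thesis by simp
    qed
    finally show ?thesis using z[of 0] by simp
  qed
  have AB: "A \<ge> 0 \<and> B \<ge> 0"
  proof -
    have "A * B = inner q q / 4" using qq by simp
    then have "A * B \<ge> 0" using inner_ge_zero[of q] by linarith
    moreover have "A + B > 0" using u[of 0] z[of 0] by simp (metis zero_less_divide_1_iff)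
    ultimately show ?thesis by (auto simp: zero_le_mult_iff)
  qed
  have "q \<in> paravectors n"
  proof -
    have x: "((\<lambda>t. snd (c t)) has_vector_derivative (z t)\<^sup>2 *\<^sub>R q) (at t)" for t
      using bounded_linear.has_vector_derivative[OF bounded_linear_snd c[of t]] sV[of t] by simp
    show ?thesis
      \<comment> \<open>Coefficientwise, as the type is infinite-dimensional and the closedness of the subspace is not at hand.\<close>
    proof (rule paraI)
      fix M :: "nat set" assume M: "M \<noteq> {}" "\<And>j. j \<in> {1..n} \<Longrightarrow> M \<noteq> {j}"
      show "cl_coeff q M = 0"
      proof (cases "finite M")
        case True
        have ib: "inner p (blade M) = cl_coeff p M" for p
          using True by (subst inner_commute) (simp add: inner_clifford_def supp_blade cl_coeff_blade)
        have "cl_coeff (snd (c t)) M = 0" for t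
          using upper_halfD(1)[OF up] M by (intro para_coeff_eq_0[of _ n]) (simp_all add: tangent_iff)
        then have "((\<lambda>t. inner (snd (c t)) (blade M)) has_real_derivative 0) (at 0)" by (simp add: ib)
        moreover have "((\<lambda>t. inner (snd (c t)) (blade M)) has_real_derivative inner ((z 0)\<^sup>2 *\<^sub>R q) (blade M)) (at 0)"
          using has_real_derivative_inner[OF x has_vector_derivative_const] by simp
        ultimately have "inner ((z 0)\<^sup>2 *\<^sub>R q) (blade M) = 0" using DERIV_unique by blast
        then show ?thesis using z[of 0] by (simp add: ib)
      next
        case False
        then show ?thesis using supp_finite[of M q] by (auto simp: supp_def)
      qed
    qed
  qed
  moreover have "((\<lambda>t. snd (c t)) has_vector_derivative (fst (c t))\<^sup>2 *\<^sub>R q) (at t)" for t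
    using bounded_linear.has_vector_derivative[OF bounded_linear_snd c[of t]] sV[of t] by (simp add: z_def)
  ultimately show ?thesis
    using AB qq u z by (intro that[of A B q]) (simp_all add: z_def)
qed

lemma has_real_derivative_geo_height:
  assumes "B > 0"
  shows "(geo_height v B has_real_derivative
     - (B * (inner v v * exp t - exp (- t))) * (geo_height v B t)\<^sup>2) (at t)"
  unfolding geo_height_def using geo_height_denominator[OF assms, of v t]
  by (auto intro!: derivative_eq_intros simp: power2_eq_square divide_simps)

text \<open>The horizontal velocity of \<open>geo_from\<close> is z^2 times \<open>2 * B\<close>
  times \<open>v\<close>, which matches the conserved \<open>q\<close> of a general
  geodesic.\<close>

lemma has_real_derivative_geo_height_exp:
  assumes "B > 0"
  shows "((\<lambda>t. geo_height v B t * exp t) has_real_derivative 2 * B * (geo_height v B t)\<^sup>2) (at t)"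
proof -
  let ?h = "geo_height v B t"
  have h: "?h = ?h * ?h * (B * (inner v v * exp t + exp (- t)))"
    using geo_height_denominator[OF assms, of v t] by (simp add: geo_height_def)
  have ee: "exp (- t) * exp t = 1" by (simp add: exp_minus)
  have "- (B * (inner v v * exp t - exp (- t))) * ?h\<^sup>2 * exp t + ?h * exp t
     = - (B * (inner v v * exp t - exp (- t))) * ?h\<^sup>2 * exp t + ?h * ?h * (B * (inner v v * exp t + exp (- t))) * exp t"
    using h by simp
  also have "\<dots> = 2 * B * ?h\<^sup>2 * (exp (- t) * exp t)" by (simp add: algebra_simps power2_eq_square)
  also have "\<dots> = 2 * B * ?h\<^sup>2" unfolding ee by simp
  finally show ?thesis
    by (auto intro!: derivative_eq_intros has_real_derivative_geo_height[OF assms] simp: mult.commute)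
qed

text \<open>If \<open>B = 0\<close>, then \<open>q = 0\<close> and the curve descends vertically
  from infinity. Otherwise \<open>v = q / (2 B)\<close>, and the relation between \<open>A\<close>,
  \<open>B\<close> and \<open>q\<close> eliminates \<open>A\<close>; the horizontal parts then
  differ by a constant, the starting point.\<close>

lemma geodesic_classification:
  assumes "unit_speed_geodesic n c"
  shows "(\<exists>A a. A > 0 \<and> (\<forall>t. c t = geo_down a A t)) \<or>
    (\<exists>B v a. B > 0 \<and> v \<in> paravectors n \<and> (\<forall>t. c t = geo_from a v B t))"
proof -
  obtain A B q where AB: "A \<ge> 0" "B \<ge> 0" and q: "q \<in> paravectors n" "4 * A * B = inner q q"
    and u: "\<And>t. 1 / fst (c t) = A * exp t + B * exp (- t)"
    and x: "\<And>t. ((\<lambda>t. snd (c t)) has_vector_derivative (fst (c t))\<^sup>2 *\<^sub>R q) (at t)"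
    and z: "\<And>t. fst (c t) > 0"
    using geodesic_first_integrals[OF assms] by blast
  have const: "\<exists>a. \<forall>t. f t = a" if f: "\<And>t. (f has_vector_derivative 0) (at t)" for f :: "real \<Rightarrow> clifford"
  proof -
    obtain a where "\<And>t. f t = a" using has_vector_derivative_zero_constant[of UNIV f] f by auto
    then show ?thesis by blast
  qed
  show ?thesis
  proof (cases "B = 0")
    case True
    then have "q = 0" using q by simp
    then obtain a where a: "\<And>t. snd (c t) = a" using const[of "\<lambda>t. snd (c t)"] x by auto
    have u': "1 / fst (c t) = A * exp t" for t using u[of t] True by simp
    have "A > 0" using u'[of 0] z[of 0] AB by (cases "A = 0") auto
    moreover have "c t = geo_down a A t" for t
    proof -
      have "fst (c t) = 1 / (1 / fst (c t))" by simp
      also have "\<dots> = exp (- t) / A" unfolding u' by (simp add: exp_minus field_simps)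
      finally show ?thesis using a by (simp add: geo_down_def prod_eq_iff)
    qed
    ultimately show ?thesis by blast
  next
    case False
    then have B: "B > 0" using AB by simp
    define v where "v = q /\<^sub>R (2 * B)"
    have qv: "q = (2 * B) *\<^sub>R v" using B by (simp add: v_def)
    have "A = B * inner v v" using q(2) B unfolding qv by simp
    then have h: "fst (c t) = geo_height v B t" for t
    proof -
      have "fst (c t) = 1 / (1 / fst (c t))" by simp
      also have "\<dots> = geo_height v B t"
        unfolding u \<open>A = B * inner v v\<close> by (simp add: geo_height_def algebra_simps)
      finally show ?thesis .
    qed
    have "((\<lambda>t. snd (c t) - (geo_height v B t * exp t) *\<^sub>R v) has_vector_derivative 0) (at t)" for t
    proof -
      have "((\<lambda>t. (geo_height v B t * exp t) *\<^sub>R v) has_vector_derivative (2 * B * (geo_height v B t)\<^sup>2) *\<^sub>R v) (at t)"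
        using has_vector_derivative_scaleR[OF has_real_derivative_geo_height_exp[OF B] has_vector_derivative_const]
        by simp
      from has_vector_derivative_diff[OF x this] show ?thesis
        by (simp add: h qv mult.commute)
    qed
    from const[OF this] obtain a where "\<And>t. snd (c t) - (geo_height v B t * exp t) *\<^sub>R v = a" by blast
    then have "c t = geo_from a v B t" for t
      by (simp add: geo_from_def prod_eq_iff h algebra_simps)
    moreover have "v \<in> paravectors n" using q(1) by (simp add: v_def para_scaleR)
    ultimately show ?thesis using B by blast
  qed
qed

section \<open>The explicit curves as unit-speed geodesics and rays\<close>

lemma geo_from_upper: "B > 0 \<Longrightarrow> a \<in> paravectors n \<Longrightarrow> v \<in> paravectors n \<Longrightarrow> geo_from a v B t \<in> upper_half n"
  using geo_height_pos[of B v t] by (auto simp: upper_half_def tangent_iff geo_from_def intro!: para_add para_scaleR)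

lemma geo_down_upper: "A > 0 \<Longrightarrow> a \<in> paravectors n \<Longrightarrow> geo_down a A t \<in> upper_half n"
  by (simp add: upper_half_def tangent_iff geo_down_def)

lemma has_vector_derivative_geo_from:
  assumes "B > 0"
  shows "(geo_from a v B has_vector_derivative
    (- (B * (inner v v * exp t - exp (- t))) * (geo_height v B t)\<^sup>2, (2 * B * (geo_height v B t)\<^sup>2) *\<^sub>R v)) (at t)"
proof -
  have "((\<lambda>t. a + (geo_height v B t * exp t) *\<^sub>R v) has_vector_derivative
      0 + ((geo_height v B t * exp t) *\<^sub>R 0 + (2 * B * (geo_height v B t)\<^sup>2) *\<^sub>R v)) (at t)"
    by (intro has_vector_derivative_add has_vector_derivative_const has_vector_derivative_scaleR
        has_real_derivative_geo_height_exp[OF assms])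
  with has_real_derivative_geo_height[OF assms, of v t] show ?thesis
    unfolding geo_from_def has_real_derivative_iff_has_vector_derivative
    by (intro has_vector_derivative_Pair) simp_all
qed

lemma has_vector_derivative_geo_down:
  "(geo_down a A has_vector_derivative - fst (geo_down a A t) *\<^sub>R (1, 0)) (at t)"
proof -
  have "((\<lambda>t. exp (- t)) has_real_derivative - exp (- t)) (at t)"
    by (auto intro!: derivative_eq_intros)
  from DERIV_cdivide[OF this, of A]
  have "((\<lambda>t. exp (- t) / A) has_real_derivative - (exp (- t) / A)) (at t)"
    by simp
  then show ?thesis
    unfolding geo_down_def has_real_derivative_iff_has_vector_derivative
    by (simp add: has_vector_derivative_Pair)
qed

text \<open>Being linear in the height, this makes the horosphere equation |y|^2 = 2 r z at the
  starting point an equation for \<open>exp t\<close> alone.\<close>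

lemma geo_from_norm:
  assumes "B > 0"
  shows "inner (geo_from a v B t - (0, a)) (geo_from a v B t - (0, a)) = geo_height v B t * exp t / B"
proof -
  let ?h = "geo_height v B t"
  have "inner (geo_from a v B t - (0, a)) (geo_from a v B t - (0, a)) = ?h * (?h * (1 + exp t * exp t * inner v v))"
    by (simp add: geo_from_def algebra_simps)
  also have "1 + exp t * exp t * inner v v = exp t * (inner v v * exp t + exp (- t))"
    by (simp add: algebra_simps exp_minus)
  also have "?h * (exp t * (inner v v * exp t + exp (- t))) = exp t / B"
  proof -
    have "?h * (exp t * (inner v v * exp t + exp (- t))) = ?h * (B * (inner v v * exp t + exp (- t))) * exp t / B"
      using assms by simp
    then show ?thesis unfolding geo_height_mult_denominator[OF assms] by simp
  qed
  finally show ?thesis by simp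
qed

lemma geodesic_ray_geo_from:
  assumes B: "B > 0" and a: "a \<in> paravectors n" and v: "v \<in> paravectors n"
  shows "geodesic_ray n (Boundary a) (geo_from a v B)"
  unfolding geodesic_ray_def
proof (intro allI conjI)
  fix t
  let ?h = "geo_height v B t"
  show "geo_from a v B t \<in> upper_half n" by (rule geo_from_upper[OF B a v])
  have h: "?h = ?h * ?h * (B * (inner v v * exp t + exp (- t)))"
    using geo_height_denominator[OF B, of v t] by (simp add: geo_height_def)
  have f: "fst (geo_from a v B t) = ?h" by (simp add: geo_from_def)
  have m: "2 * ?h\<^sup>2 / (?h * exp t / B) = 2 * B * ?h * exp (- t)"
    using geo_height_pos[OF B, of v t] B by (simp add: exp_minus power2_eq_square field_simps)
  have "(- (B * (inner v v * exp t - exp (- t))) * ?h\<^sup>2, (2 * B * ?h\<^sup>2) *\<^sub>R v) =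
    (2 * B * ?h * exp (- t)) *\<^sub>R (geo_from a v B t - (0, a)) - ?h *\<^sub>R (1, 0)"
  proof (rule prod_eqI)
    have "- (B * (inner v v * exp t - exp (- t))) * ?h\<^sup>2 =
      2 * B * ?h * exp (- t) * ?h - ?h * ?h * (B * (inner v v * exp t + exp (- t)))"
      by (simp add: algebra_simps power2_eq_square)
    then show "fst (- (B * (inner v v * exp t - exp (- t))) * ?h\<^sup>2, (2 * B * ?h\<^sup>2) *\<^sub>R v) =
      fst ((2 * B * ?h * exp (- t)) *\<^sub>R (geo_from a v B t - (0, a)) - ?h *\<^sub>R (1, 0))"
      unfolding h[symmetric] by (simp add: geo_from_def)
    show "snd (- (B * (inner v v * exp t - exp (- t))) * ?h\<^sup>2, (2 * B * ?h\<^sup>2) *\<^sub>R v) =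
      snd ((2 * B * ?h * exp (- t)) *\<^sub>R (geo_from a v B t - (0, a)) - ?h *\<^sub>R (1, 0))"
      by (simp add: geo_from_def power2_eq_square exp_minus)
  qed
  then show "(geo_from a v B has_vector_derivative
     (case Boundary a of Infinity \<Rightarrow> - fst (geo_from a v B t) *\<^sub>R (1, 0)
      | Boundary b \<Rightarrow> (2 * (fst (geo_from a v B t))\<^sup>2 / inner (geo_from a v B t - (0, b)) (geo_from a v B t - (0, b))) *\<^sub>R
          (geo_from a v B t - (0, b)) - fst (geo_from a v B t) *\<^sub>R (1, 0))) (at t)"
    unfolding ideal_point.case geo_from_norm[OF B] f m
    using has_vector_derivative_geo_from[OF B, of a v t] by simp
qed

lemma geodesic_ray_geo_down:
  "A > 0 \<Longrightarrow> a \<in> paravectors n \<Longrightarrow> geodesic_ray n Infinity (geo_down a A)"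
  unfolding geodesic_ray_def ideal_point.case
  by (intro allI conjI geo_down_upper has_vector_derivative_geo_down)

lemma unit_speed_geo_down:
  assumes A: "A > 0" and a: "a \<in> paravectors n"
  shows "unit_speed_geodesic n (geo_down a A)"
  unfolding unit_speed_geodesic_def parallel_along_def
proof (intro conjI allI)
  fix t
  note d = has_vector_derivative_geo_down[of a A]
  have vd: "vector_derivative (geo_down a A) (at t) = - fst (geo_down a A t) *\<^sub>R (1, 0)" for t
    by (rule vector_derivative_at[OF d])
  have z: "fst (geo_down a A t) > 0" using A by (simp add: geo_down_def)
  show "geo_down a A t \<in> upper_half n" by (rule geo_down_upper[OF A a])
  show "geo_down a A differentiable (at t)" using d by (rule differentiableI_vector)
  show "hmetric (geo_down a A t) (vector_derivative (geo_down a A) (at t)) (vector_derivative (geo_down a A) (at t)) = 1"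
    unfolding vd hmetric_def using z by (simp add: power2_eq_square)
  have "((\<lambda>t. fst (geo_down a A t)) has_real_derivative - fst (geo_down a A t)) (at t)"
    using has_real_derivative_fst[OF d] by simp
  then have "((\<lambda>t. - fst (geo_down a A t)) has_real_derivative fst (geo_down a A t)) (at t)"
    using DERIV_minus by fastforce
  from has_vector_derivative_scaleR[OF this has_vector_derivative_const[of "(1, 0)"]]
  have "((\<lambda>t. - fst (geo_down a A t) *\<^sub>R (1, 0 :: clifford)) has_vector_derivative fst (geo_down a A t) *\<^sub>R (1, 0)) (at t)"
    by (simp del: scaleR_Pair)
  moreover have "- christoffel (geo_down a A t) (- fst (geo_down a A t) *\<^sub>R (1, 0)) (- fst (geo_down a A t) *\<^sub>R (1, 0))
     = fst (geo_down a A t) *\<^sub>R (1, 0)"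
    unfolding christoffel_def using z by (simp add: power2_eq_square)
  ultimately show "((\<lambda>t. vector_derivative (geo_down a A) (at t)) has_vector_derivative
     - christoffel (geo_down a A t) (vector_derivative (geo_down a A) (at t)) (vector_derivative (geo_down a A) (at t))) (at t)"
    unfolding vd by (simp only:)
qed

lemma unit_speed_geo_from:
  assumes B: "B > 0" and a: "a \<in> paravectors n" and v: "v \<in> paravectors n"
  shows "unit_speed_geodesic n (geo_from a v B)"
  unfolding unit_speed_geodesic_def parallel_along_def
proof (intro conjI allI)
  fix t
  define h where "h = geo_height v B"
  \<comment> \<open>\<open>\<kappa>\<close> and \<open>\<sigma>\<close> are derivatives of each
    other and \<open>\<sigma>\<close> is 1 / \<open>h\<close>. The identity \<open>sk\<close>
    between their squares plays the part of cosh^2 - sinh^2 = 1 and yields unit speed.\<close>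
  define \<kappa> where "\<kappa> t = B * (inner v v * exp t - exp (- t))" for t
  define \<sigma> where "\<sigma> t = B * (inner v v * exp t + exp (- t))" for t
  have d: "(geo_from a v B has_vector_derivative (- \<kappa> t * (h t)\<^sup>2, (2 * B * (h t)\<^sup>2) *\<^sub>R v)) (at t)" for t
    using has_vector_derivative_geo_from[OF B] by (simp add: \<kappa>_def h_def)
  have vd: "vector_derivative (geo_from a v B) (at t) = (- \<kappa> t * (h t)\<^sup>2, (2 * B * (h t)\<^sup>2) *\<^sub>R v)" for t
    by (rule vector_derivative_at[OF d])
  have h0: "h t > 0" using geo_height_pos[OF B] by (simp add: h_def)
  have hs: "h t * \<sigma> t = 1"
    unfolding h_def \<sigma>_def by (rule geo_height_mult_denominator[OF B])
  have sk: "(\<sigma> t)\<^sup>2 = (\<kappa> t)\<^sup>2 + 4 * B\<^sup>2 * inner v v"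
  proof -
    have "(\<sigma> t)\<^sup>2 = (\<kappa> t)\<^sup>2 + 4 * B\<^sup>2 * inner v v * (exp t * exp (- t))"
    proof -
      have "(b * (p * x + y))\<^sup>2 = (b * (p * x - y))\<^sup>2 + 4 * b\<^sup>2 * p * (x * y)" for b p x y :: real
        by (simp add: power2_eq_square algebra_simps)
      then show ?thesis unfolding \<sigma>_def \<kappa>_def .
    qed
    then show ?thesis by (simp add: exp_minus)
  qed
  have VV: "inner (- \<kappa> t * (h t)\<^sup>2, (2 * B * (h t)\<^sup>2) *\<^sub>R v) (- \<kappa> t * (h t)\<^sup>2, (2 * B * (h t)\<^sup>2) *\<^sub>R v) = (h t)\<^sup>2"
  proof -
    have "inner (- \<kappa> t * (h t)\<^sup>2, (2 * B * (h t)\<^sup>2) *\<^sub>R v) (- \<kappa> t * (h t)\<^sup>2, (2 * B * (h t)\<^sup>2) *\<^sub>R v)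
      = (h t)\<^sup>2 * (h t)\<^sup>2 * ((\<kappa> t)\<^sup>2 + 4 * B\<^sup>2 * inner v v)"
      by (simp add: power2_eq_square algebra_simps)
    also have "\<dots> = (h t)\<^sup>2 * (h t * \<sigma> t)\<^sup>2"
      unfolding sk[symmetric] by (simp add: power2_eq_square)
    finally show ?thesis unfolding hs by simp
  qed
  have f: "fst (geo_from a v B t) = h t" by (simp add: geo_from_def h_def)
  show "geo_from a v B t \<in> upper_half n" by (rule geo_from_upper[OF B a v])
  show "geo_from a v B differentiable (at t)" using d by (rule differentiableI_vector)
  show "hmetric (geo_from a v B t) (vector_derivative (geo_from a v B) (at t)) (vector_derivative (geo_from a v B) (at t)) = 1"
    unfolding vd hmetric_def VV f using h0 by simp
  have dh: "(h has_real_derivative - \<kappa> t * (h t)\<^sup>2) (at t)"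
    using has_real_derivative_geo_height[OF B] by (simp add: h_def \<kappa>_def)
  have dk: "(\<kappa> has_real_derivative \<sigma> t) (at t)"
    unfolding \<kappa>_def \<sigma>_def by (auto intro!: derivative_eq_intros)
  have "((\<lambda>t. - \<kappa> t * (h t)\<^sup>2) has_real_derivative - (h t) + 2 * (\<kappa> t)\<^sup>2 * (h t) ^ 3) (at t)"
  proof -
    have "- \<sigma> t * (h t)\<^sup>2 + 2 * (\<kappa> t)\<^sup>2 * (h t) ^ 3 = - (h t * \<sigma> t) * h t + 2 * (\<kappa> t)\<^sup>2 * (h t) ^ 3"
      by (simp add: power2_eq_square)
    then have e: "- (h t) + 2 * (\<kappa> t)\<^sup>2 * (h t) ^ 3 = - \<sigma> t * (h t)\<^sup>2 + 2 * (\<kappa> t)\<^sup>2 * (h t) ^ 3"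
      unfolding hs by simp
    show ?thesis
      unfolding e by (auto intro!: derivative_eq_intros dh dk simp: power2_eq_square power3_eq_cube)
  qed
  moreover have "((\<lambda>t. (2 * B * (h t)\<^sup>2) *\<^sub>R v) has_vector_derivative (- 4 * B * \<kappa> t * (h t) ^ 3) *\<^sub>R v) (at t)"
  proof -
    have "((\<lambda>t. 2 * B * (h t)\<^sup>2) has_real_derivative (- 4 * B * \<kappa> t * (h t) ^ 3)) (at t)"
      by (auto intro!: derivative_eq_intros dh simp: power2_eq_square power3_eq_cube)
    from has_vector_derivative_scaleR[OF this has_vector_derivative_const] show ?thesis by simp
  qed
  ultimately have "((\<lambda>t. (- \<kappa> t * (h t)\<^sup>2, (2 * B * (h t)\<^sup>2) *\<^sub>R v)) has_vector_derivative
      (- (h t) + 2 * (\<kappa> t)\<^sup>2 * (h t) ^ 3, (- 4 * B * \<kappa> t * (h t) ^ 3) *\<^sub>R v)) (at t)"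
    unfolding has_real_derivative_iff_has_vector_derivative by (rule has_vector_derivative_Pair)
  moreover have "- christoffel (geo_from a v B t) (- \<kappa> t * (h t)\<^sup>2, (2 * B * (h t)\<^sup>2) *\<^sub>R v)
      (- \<kappa> t * (h t)\<^sup>2, (2 * B * (h t)\<^sup>2) *\<^sub>R v)
    = (- (h t) + 2 * (\<kappa> t)\<^sup>2 * (h t) ^ 3, (- 4 * B * \<kappa> t * (h t) ^ 3) *\<^sub>R v)"
    unfolding christoffel_def VV f using h0
    by (simp add: power2_eq_square power3_eq_cube field_simps flip: scaleR_add_left)
  ultimately show "((\<lambda>t. vector_derivative (geo_from a v B) (at t)) has_vector_derivative
     - christoffel (geo_from a v B t) (vector_derivative (geo_from a v B) (at t)) (vector_derivative (geo_from a v B) (at t))) (at t)"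
    unfolding vd by simp
qed


subsection \<open>Ideal endpoints\<close>

lemma exp_uminus_at_top: "((\<lambda>t :: real. exp (- t)) \<longlongrightarrow> 0) at_top"
  by (rule filterlim_compose[OF exp_at_bot filterlim_uminus_at_bot_at_top])

lemma exp_uminus_at_bot: "filterlim (\<lambda>t :: real. exp (- t)) at_top at_bot"
  by (rule filterlim_compose[OF exp_at_top filterlim_uminus_at_top_at_bot])

text \<open>Each bound drops one of the two exponentials from the denominator; the first tends to 0
  in the past, the second in the future.\<close>

lemma geo_height_le:
  assumes "B > 0"
  shows "geo_height v B t \<le> exp t / B"
    "v \<noteq> 0 \<Longrightarrow> geo_height v B t \<le> exp (- t) / (B * inner v v)"
proof -
  have den: "inner v v * exp t + exp (- t) > 0" by (intro add_nonneg_pos) simp_all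
  have "geo_height v B t \<le> 1 / (B * exp (- t))"
    unfolding geo_height_def using assms den
    by (intro divide_left_mono mult_left_mono mult_pos_pos) simp_all
  also have "\<dots> = exp t / B" by (simp add: exp_minus field_simps)
  finally show "geo_height v B t \<le> exp t / B" .
  assume "v \<noteq> 0"
  then have "inner v v > 0" by simp
  then have "geo_height v B t \<le> 1 / (B * (inner v v * exp t))"
    unfolding geo_height_def using assms den
    by (intro divide_left_mono mult_left_mono mult_pos_pos) simp_all
  also have "\<dots> = exp (- t) / (B * inner v v)" by (simp add: exp_minus field_simps)
  finally show "geo_height v B t \<le> exp (- t) / (B * inner v v)" .
qed

lemma geo_from_at_bot:
  assumes B: "B > 0"
  shows "(geo_from a v B \<longlongrightarrow> (0, a)) at_bot"
proof -
  have "((\<lambda>t. exp t / B) \<longlongrightarrow> 0 / B) at_bot"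
    using B by (intro tendsto_divide exp_at_bot tendsto_const) simp
  then have e: "((\<lambda>t. exp t / B) \<longlongrightarrow> 0) at_bot" by simp
  have h: "(geo_height v B \<longlongrightarrow> 0) at_bot"
    by (rule tendsto_sandwich[OF _ _ tendsto_const e])
      (simp_all add: less_imp_le[OF geo_height_pos[OF B]] geo_height_le[OF B])
  have "((\<lambda>t. (geo_height v B t, a + (geo_height v B t * exp t) *\<^sub>R v)) \<longlongrightarrow> (0, a + (0 * 0) *\<^sub>R v)) at_bot"
    by (intro tendsto_intros h exp_at_bot)
  then show ?thesis by (simp add: geo_from_def[abs_def])
qed

lemma geo_from_at_top:
  assumes B: "B > 0" and v: "v \<noteq> 0"
  shows "(geo_from a v B \<longlongrightarrow> (0, a + (1 / (B * inner v v)) *\<^sub>R v)) at_top"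
proof -
  have vv: "inner v v > 0" using v by simp
  have "((\<lambda>t. exp (- t) / (B * inner v v)) \<longlongrightarrow> 0 / (B * inner v v)) at_top"
    using B vv by (intro tendsto_divide exp_uminus_at_top tendsto_const) simp
  then have e: "((\<lambda>t. exp (- t) / (B * inner v v)) \<longlongrightarrow> 0) at_top" by simp
  have h: "(geo_height v B \<longlongrightarrow> 0) at_top"
    by (rule tendsto_sandwich[OF _ _ tendsto_const e])
      (simp_all add: less_imp_le[OF geo_height_pos[OF B]] geo_height_le(2)[OF B v])
  have he: "geo_height v B t * exp t = 1 / (B * (inner v v + exp (- t) * exp (- t)))" for t
    by (simp add: geo_height_def exp_minus field_simps)
  have "((\<lambda>t. 1 / (B * (inner v v + exp (- t) * exp (- t)))) \<longlongrightarrow> 1 / (B * (inner v v + 0 * 0))) at_top"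
    using B vv by (intro tendsto_intros exp_uminus_at_top) simp
  then have "((\<lambda>t. geo_height v B t * exp t) \<longlongrightarrow> 1 / (B * inner v v)) at_top"
    unfolding he by simp
  then show ?thesis
    unfolding geo_from_def[abs_def] by (intro tendsto_intros h)
qed

lemma filterlim_Pair_at_infinity:
  assumes "filterlim f at_top F"
  shows "filterlim (\<lambda>t. (f t :: real, a :: clifford)) at_infinity F"
proof (rule filterlim_norm_at_top_imp_at_infinity, rule filterlim_at_top_mono[OF assms])
  have "f t \<le> norm (f t, a)" for t
    using norm_fst_le[of "f t" a] by simp
  then show "\<forall>\<^sub>F t in F. f t \<le> norm (f t, a)" by simp
qed

lemma filterlim_exp_divide:
  assumes "A > 0" "filterlim f at_top F"
  shows "filterlim (\<lambda>t. f t / A :: real) at_top F"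
  using filterlim_tendsto_pos_mult_at_top[OF tendsto_const[of "1 / A"] _ assms(2)] assms(1) by simp

lemma geo_from_0: "geo_from a 0 B t = (exp t / B, a)"
  by (simp add: geo_from_def geo_height_def exp_minus field_simps)

lemma geo_from_0_at_top: "B > 0 \<Longrightarrow> filterlim (geo_from a 0 B) at_infinity at_top"
  unfolding geo_from_0[abs_def] by (intro filterlim_Pair_at_infinity filterlim_exp_divide exp_at_top)

lemma geo_down_at_bot: "A > 0 \<Longrightarrow> filterlim (geo_down a A) at_infinity at_bot"
  unfolding geo_down_def[abs_def] by (intro filterlim_Pair_at_infinity filterlim_exp_divide exp_uminus_at_bot)

lemma geo_down_at_top:
  assumes "A > 0"
  shows "(geo_down a A \<longlongrightarrow> (0, a)) at_top"
proof -
  have "((\<lambda>t. (exp (- t) / A, a)) \<longlongrightarrow> (0 / A, a)) at_top"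
    using assms by (intro tendsto_intros exp_uminus_at_top) simp
  then show ?thesis by (simp add: geo_down_def[abs_def])
qed

text \<open>The limits of the explicit curves are known, and limits along a proper filter are
  unique, convergence also excluding divergence to infinity; so the ideal points can be read off
  from the classification.\<close>

lemma geodesic_from_to_cases:
  assumes "geodesic_from_to n e e' c"
  obtains (down) A a where "A > 0" "c = geo_down a A" "e = Infinity" "e' = Boundary a"
  | (up) B a where "B > 0" "c = geo_from a 0 B" "e = Boundary a" "e' = Infinity"
  | (across) B v a where "B > 0" "v \<noteq> 0" "v \<in> paravectors n" "c = geo_from a v B" "e = Boundary a"
      "e' = Boundary (a + (1 / (B * inner v v)) *\<^sub>R v)"
proof -
  have lim: "e = Boundary a" if "(c \<longlongrightarrow> (0, a)) F" "F \<noteq> bot" "tends_to_ideal c e F" for e a F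
  proof (cases e)
    case Infinity
    then show ?thesis
      using that not_tendsto_and_filterlim_at_infinity[of F c] by (auto simp: tends_to_ideal_def)
  next
    case (Boundary b)
    then show ?thesis
      using that tendsto_unique[of F c "(0, a)" "(0, b)"] by (auto simp: tends_to_ideal_def)
  qed
  have inf: "e = Infinity" if "filterlim c at_infinity F" "F \<noteq> bot" "tends_to_ideal c e F" for e F
    using that not_tendsto_and_filterlim_at_infinity[of F c]
    by (cases e) (auto simp: tends_to_ideal_def)
  have c: "unit_speed_geodesic n c" "tends_to_ideal c e at_bot" "tends_to_ideal c e' at_top"
    using assms by (simp_all add: geodesic_from_to_def)
  have nb: "at_bot \<noteq> (bot :: real filter)" "at_top \<noteq> (bot :: real filter)"
    by (simp_all add: trivial_limit_at_bot_linorder trivial_limit_at_top_linorder)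
  from geodesic_classification[OF c(1)] show ?thesis
  proof (elim disjE exE conjE)
    fix A a assume A: "A > 0" and "\<forall>t. c t = geo_down a A t"
    then have cc: "c = geo_down a A" by blast
    show ?thesis
      using lim[OF _ nb(2) c(3)] geo_down_at_top[OF A] inf[OF _ nb(1) c(2)] geo_down_at_bot[OF A]
      by (intro down[OF A cc]) (auto simp: cc)
  next
    fix B v a assume B: "B > 0" and v: "v \<in> paravectors n" and "\<forall>t. c t = geo_from a v B t"
    then have cc: "c = geo_from a v B" by blast
    have e: "e = Boundary a" using lim[OF _ nb(1) c(2)] geo_from_at_bot[OF B] by (simp add: cc)
    show ?thesis
    proof (cases "v = 0")
      case True
      show ?thesis
        using inf[OF _ nb(2) c(3)] geo_from_0_at_top[OF B] True e cc by (intro up[OF B]) auto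
    next
      case False
      show ?thesis
        using lim[OF _ nb(2) c(3)] geo_from_at_top[OF B False] e cc by (intro across[OF B False v]) auto
    qed
  qed
qed

section \<open>Parallel transport of spin frames\<close>

lemma geodesic_rayD:
  assumes "geodesic_ray n e c"
  shows "c t \<in> upper_half n" "continuous_on UNIV c" "(c has_vector_derivative vector_derivative c (at t)) (at t)"
proof -
  show "c t \<in> upper_half n" using assms by (simp add: geodesic_ray_def)
  have d: "(c has_vector_derivative vector_derivative c (at t)) (at t)" for t
  proof -
    obtain D where "(c has_vector_derivative D) (at t)"
      using assms unfolding geodesic_ray_def by blast
    then show ?thesis using vector_derivative_at[of c D t] by simp
  qed
  show "(c has_vector_derivative vector_derivative c (at t)) (at t)" by (rule d)
  show "continuous_on UNIV c"
    using d has_vector_derivative_continuous by (blast intro: continuous_at_imp_continuous_on)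
qed

lemma spin_parallel_along_nav:
  assumes c: "geodesic_ray n e c" and e: "ideal n e" and k: "k \<in> para_unitary (n + 1)"
  shows "spin_parallel_along n c (\<lambda>t. nav n e (c t) * k)"
  unfolding spin_parallel_along_def spin_group_eq frame_of_nav
proof (intro conjI allI impI)
  show "continuous_on UNIV (\<lambda>t. nav n e (c t) * k)"
    by (intro bounded_linear.continuous_on[OF bounded_linear_mult_right_clifford] continuous_on_nav[OF _ _ e]
        geodesic_rayD[OF c])
  show "nav n e (c t) * k \<in> para_unitary (n + 1)" for t
    by (intro para_unitary_mult nav_unitary geodesic_rayD[OF c] e k)
  show "parallel_along c (\<lambda>t. nav_field n e (sigma k (to_para n (std_vec n j))) (c t))" for j
    by (intro nav_field_parallel_along[OF c e] para_unitaryD(6)[OF k] to_para_std_vec_in)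
qed

text \<open>Uniqueness of parallel transport: the frame vectors of \<open>w\<close> and the fields
  of \<open>nav\<close> are both parallel, so their metric products have derivative 0.\<close>

lemma spin_parallel_along_imp_nav:
  assumes c: "geodesic_ray n e c" and e: "ideal n e" and w: "spin_parallel_along n c w"
  shows "w t = nav n e (c t) * (cl_conj (nav n e (c t0)) * w t0)"
proof (rule lift_unique_inner[where I = UNIV and w = w and Y = "\<lambda>t. nav n e (c t)" and m = "n + 1"])
  note up = geodesic_rayD(1)[OF c]
  have wU: "w t \<in> para_unitary (n + 1)" for t
    using w by (simp add: spin_parallel_along_def spin_group_eq)
  then show "w t \<in> para_unitary (n + 1)" for t .
  show "nav n e (c t) \<in> para_unitary (n + 1)" for t by (rule nav_unitary[OF up e])
  show "continuous_on UNIV w" using w by (simp add: spin_parallel_along_def)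
  show "continuous_on UNIV (\<lambda>t. nav n e (c t))"
    by (rule continuous_on_nav[OF geodesic_rayD(2)[OF c] up e])
  fix t j d assume j: "j \<in> {1..n + 1}" and d: "d \<in> paravectors (n + 1)"
  \<comment> \<open>The frame index whose standard vector is represented by the generator
    \<open>j\<close>.\<close>
  define i where "i = (if j = n + 1 then 0 else j)"
  have i: "i \<le> n + 1" "to_para n (std_vec n i) = gen j"
    using j to_para_std_vec(1)[of n] to_para_std_vec(2)[of j n] by (auto simp: i_def)
  let ?V = "\<lambda>t. frame_of n (c t) (w t) i" and ?P = "\<lambda>t. nav_field n e d (c t)"
  have V: "(?V has_vector_derivative - christoffel (c s) (vector_derivative c (at s)) (?V s)) (at s)" for s
    using w i(1) by (simp add: spin_parallel_along_def parallel_along_def)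
  have P: "(?P has_vector_derivative - christoffel (c s) (vector_derivative c (at s)) (?P s)) (at s)" for s
    using nav_field_parallel_along[OF c e d] by (simp add: parallel_along_def)
  have "((\<lambda>s. hmetric (c s) (?V s) (?P s)) has_real_derivative 0) (at s)" for s
    using has_real_derivative_hmetric[OF upper_halfD(2)[OF up] geodesic_rayD(3)[OF c] V P]
    by (simp add: hmetric_def)
  then have "hmetric (c t) (?V t) (?P t) = hmetric (c t0) (?V t0) (?P t0)"
    by (intro DERIV_isconst_all) simp
  then show "inner (sigma (w t) (gen j)) (sigma (nav n e (c t)) d) =
      inner (sigma (w t0) (gen j)) (sigma (nav n e (c t0)) d)"
    unfolding hmetric_frame_nav[OF up e wU d] i(2) .
qed simp_all

section \<open>Lambda lengths in terms of spinors\<close>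

definition spin_const :: "nat \<Rightarrow> spin_horosphere \<Rightarrow> clifford \<Rightarrow> bool" where
  "spin_const n S \<kappa> \<longleftrightarrow> \<kappa> \<in> para_unitary n \<and>
     (\<forall>p\<in>horo n S. W_out S p = nav n (centre S) p * \<kappa> \<and> W_in S p = - (nav n (centre S) p * \<kappa> * gen (n + 1)))"

text \<open>Passing the new generator across k old ones costs the sign of \<open>grade\<close>. The
  sum over the support is used instead of \<open>clifford_induct\<close> because all blades involved
  must stay inside \<open>{1..n}\<close>.\<close>

lemma gen_commute_cl: "x \<in> cl n \<Longrightarrow> x * gen (n + 1) = gen (n + 1) * grade x"
proof -
  have b: "blade A * gen (n + 1) = gen (n + 1) * grade (blade A)" if "A \<subseteq> {1..n}" for A
  proof -
    have fin: "finite A" using that by (rule finite_subset) simp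
    have 1: "{(a, b). a \<in> A \<and> b \<in> {n + 1} \<and> b \<le> a} = {}" using that by auto
    have 2: "{(a, b). a \<in> {n + 1} \<and> b \<in> A \<and> b \<le> a} = Pair (n + 1) ` A" using that by force
    have s: "blade_sign A {n + 1} = 1" "blade_sign {n + 1} A = (-1) ^ card A"
      unfolding blade_sign_def 1 2 by (simp_all add: card_image inj_on_def)
    have "(-1) ^ card A * (-1) ^ card A = (1 :: real)" by (simp flip: power_mult_distrib)
    then show ?thesis
      using fin by (simp only: gen_def grade_blade mult_scaleR_right blade_times_blade finite.intros s Un_commute)
        simp
  qed
  have "(\<Sum>A\<in>M. cl_coeff x A *\<^sub>R blade A) * gen (n + 1) = gen (n + 1) * grade (\<Sum>A\<in>M. cl_coeff x A *\<^sub>R blade A)"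
    if "finite M" "\<forall>A\<in>M. A \<subseteq> {1..n}" for M
    using that
    by (induction M rule: finite_induct) (simp_all add: grade_linear distrib_left distrib_right b[simplified])
  then show "x * gen (n + 1) = gen (n + 1) * grade x" if "x \<in> cl n"
    using that by (metis (mono_tags, lifting) cl_def clifford_expand finite_supp mem_Collect_eq supp_def)
qed

text \<open>The transported frame of any candidate is \<open>nav * k\<close> with
  \<open>k = - (\<kappa>\<^sub>1 * gen (n + 1))\<close>, so its spin element must be
  \<open>cl_conj k * g * \<kappa>\<^sub>2\<close>, where \<open>g\<close> compares the two values of
  \<open>nav\<close> at the second point. Thus \<open>uniq\<close> only has to make \<rho> and
  \<open>g\<close> independent of the candidate, and \<open>ex\<close> supplies one
  candidate.\<close>

lemma lambda_length_eqI:
  assumes S: "spin_decorated_horosphere n S\<^sub>1" "spin_decorated_horosphere n S\<^sub>2"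
    and \<kappa>: "spin_const n S\<^sub>1 \<kappa>\<^sub>1" "spin_const n S\<^sub>2 \<kappa>\<^sub>2"
    and ne: "centre S\<^sub>1 \<noteq> centre S\<^sub>2"
    and uniq: "\<And>c t\<^sub>1 t\<^sub>2. geodesic_from_to n (centre S\<^sub>1) (centre S\<^sub>2) c \<Longrightarrow> c t\<^sub>1 \<in> horo n S\<^sub>1 \<Longrightarrow> c t\<^sub>2 \<in> horo n S\<^sub>2 \<Longrightarrow>
      geodesic_ray n (centre S\<^sub>1) c \<and> exp (t\<^sub>2 - t\<^sub>1) = \<rho>\<^sup>2 \<and>
      cl_conj (nav n (centre S\<^sub>1) (c t\<^sub>2)) * nav n (centre S\<^sub>2) (c t\<^sub>2) = g"
    and ex: "geodesic_from_to n (centre S\<^sub>1) (centre S\<^sub>2) c" "c t\<^sub>1 \<in> horo n S\<^sub>1" "c t\<^sub>2 \<in> horo n S\<^sub>2"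
    and s: "gen (n + 1) * (cl_conj \<kappa>\<^sub>1 * (g * \<kappa>\<^sub>2)) = s" "s \<in> para_unitary n" and \<rho>: "\<rho> > 0"
  shows "lambda_length n S\<^sub>1 S\<^sub>2 = \<rho> *\<^sub>R s"
proof -
  let ?e = "centre S\<^sub>1" and ?e' = "centre S\<^sub>2"
  define k where "k = - (\<kappa>\<^sub>1 * gen (n + 1))"
  have e: "ideal n ?e" "ideal n ?e'" using S spin_decorated_horosphereD by blast+
  have gU: "gen (n + 1) \<in> para_unitary (n + 1)"
    by (intro para_unitary_paravector para_gen) (simp_all add: inner_one_gen)
  \<comment> \<open>Enlarging \<open>n\<close> is evident for generators but not for the conditions
    on all paravectors, hence the passage through the Clifford group.\<close>
  have U: "\<kappa> \<in> para_unitary (n + 1)" if "\<kappa> \<in> para_unitary n" for \<kappa>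
  proof -
    have "\<kappa> \<in> clifford_group (n + 1)"
      using para_unitary_clifford_group[OF that] by (rule clifford_group_mono) simp
    moreover have "cl_norm \<kappa> = 1" using that by (simp add: spin_group_eq[symmetric] spin_group_def)
    ultimately show ?thesis by (simp add: spin_group_eq[symmetric] spin_group_def)
  qed
  have k1: "\<kappa>\<^sub>1 \<in> para_unitary (n + 1)" and k2: "\<kappa>\<^sub>2 \<in> para_unitary (n + 1)"
    using \<kappa> U by (simp_all add: spin_const_def)
  have kU: "k \<in> para_unitary (n + 1)"
    unfolding k_def by (intro para_unitary_uminus para_unitary_mult k1 gU)
  have ck: "cl_conj k = gen (n + 1) * cl_conj \<kappa>\<^sub>1"
    by (simp add: k_def cl_conj_uminus cl_conj_mult cl_conj_gen)
  have W: "W_in S\<^sub>1 p = nav n ?e p * k" if "p \<in> horo n S\<^sub>1" for p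
    using \<kappa> that by (simp add: spin_const_def k_def mult.assoc)
  have W2: "W_out S\<^sub>2 q = nav n ?e' q * \<kappa>\<^sub>2" if "q \<in> horo n S\<^sub>2" for q
    using \<kappa> that by (simp add: spin_const_def)
  have rho: "exp ((t\<^sub>2 - t\<^sub>1) / 2) = \<rho>" if "exp (t\<^sub>2 - t\<^sub>1) = \<rho>\<^sup>2" for t\<^sub>1 t\<^sub>2
  proof -
    have "(exp ((t\<^sub>2 - t\<^sub>1) / 2))\<^sup>2 = exp (t\<^sub>2 - t\<^sub>1)" by (simp add: power2_eq_square flip: exp_add)
    then show ?thesis using that \<rho> by (simp add: power2_eq_iff_nonneg)
  qed
  have main: "nav n ?e p * k * s' = W_out S\<^sub>2 p \<longleftrightarrow> s' = s"
    if "p \<in> horo n S\<^sub>2" "cl_conj (nav n ?e p) * nav n ?e' p = g" for p s'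
  proof -
    have NU: "nav n ?e p \<in> para_unitary (n + 1)" by (rule nav_unitary[OF horo_upper[OF that(1)] e(1)])
    have "s = cl_conj k * (cl_conj (nav n ?e p) * W_out S\<^sub>2 p)"
      unfolding W2[OF that(1)] s(1)[symmetric] ck that(2)[symmetric] by (simp add: mult.assoc)
    then have "nav n ?e p * k * s = W_out S\<^sub>2 p"
      by (simp only: mult.assoc para_unitaryD(7)[OF kU] para_unitaryD(7)[OF NU])
    moreover have "s' = s" if "nav n ?e p * k * s' = nav n ?e p * k * s"
    proof -
      have "cl_conj k * (cl_conj (nav n ?e p) * (nav n ?e p * (k * s'))) =
        cl_conj k * (cl_conj (nav n ?e p) * (nav n ?e p * (k * s)))"
        using that by (simp add: mult.assoc)
      then show ?thesis by (simp only: para_unitaryD(8)[OF kU] para_unitaryD(8)[OF NU])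
    qed
    ultimately show ?thesis by metis
  qed
  have "(THE l. \<exists>c t\<^sub>1 t\<^sub>2 w s.
        geodesic_from_to n ?e ?e' c \<and> c t\<^sub>1 \<in> horo n S\<^sub>1 \<and> c t\<^sub>2 \<in> horo n S\<^sub>2 \<and>
        spin_parallel_along n c w \<and> w t\<^sub>1 = W_in S\<^sub>1 (c t\<^sub>1) \<and>
        s \<in> spin_group n \<and> w t\<^sub>2 * s = W_out S\<^sub>2 (c t\<^sub>2) \<and>
        l = exp ((t\<^sub>2 - t\<^sub>1) / 2) *\<^sub>R s) = \<rho> *\<^sub>R s"
  proof (rule the_equality)
    note u = uniq[OF ex]
    show "\<exists>c t\<^sub>1 t\<^sub>2 w s'.
        geodesic_from_to n ?e ?e' c \<and> c t\<^sub>1 \<in> horo n S\<^sub>1 \<and> c t\<^sub>2 \<in> horo n S\<^sub>2 \<and>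
        spin_parallel_along n c w \<and> w t\<^sub>1 = W_in S\<^sub>1 (c t\<^sub>1) \<and>
        s' \<in> spin_group n \<and> w t\<^sub>2 * s' = W_out S\<^sub>2 (c t\<^sub>2) \<and>
        \<rho> *\<^sub>R s = exp ((t\<^sub>2 - t\<^sub>1) / 2) *\<^sub>R s'"
    proof (intro exI conjI)
      show "spin_parallel_along n c (\<lambda>t. nav n ?e (c t) * k)"
        using u by (intro spin_parallel_along_nav e kU) simp
      show "nav n ?e (c t\<^sub>1) * k = W_in S\<^sub>1 (c t\<^sub>1)" by (simp only: W[OF ex(2)])
      show "s \<in> spin_group n" using s(2) by (simp only: spin_group_eq)
      show "nav n ?e (c t\<^sub>2) * k * s = W_out S\<^sub>2 (c t\<^sub>2)" using main[OF ex(3)] u by simp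
      show "\<rho> *\<^sub>R s = exp ((t\<^sub>2 - t\<^sub>1) / 2) *\<^sub>R s" using rho u by simp
    qed (fact ex)+
  next
    fix l assume "\<exists>c t\<^sub>1 t\<^sub>2 w s.
        geodesic_from_to n ?e ?e' c \<and> c t\<^sub>1 \<in> horo n S\<^sub>1 \<and> c t\<^sub>2 \<in> horo n S\<^sub>2 \<and>
        spin_parallel_along n c w \<and> w t\<^sub>1 = W_in S\<^sub>1 (c t\<^sub>1) \<and>
        s \<in> spin_group n \<and> w t\<^sub>2 * s = W_out S\<^sub>2 (c t\<^sub>2) \<and>
        l = exp ((t\<^sub>2 - t\<^sub>1) / 2) *\<^sub>R s"
    then obtain c t\<^sub>1 t\<^sub>2 w s' where c: "geodesic_from_to n ?e ?e' c" "c t\<^sub>1 \<in> horo n S\<^sub>1" "c t\<^sub>2 \<in> horo n S\<^sub>2"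
      and w: "spin_parallel_along n c w" "w t\<^sub>1 = W_in S\<^sub>1 (c t\<^sub>1)" "w t\<^sub>2 * s' = W_out S\<^sub>2 (c t\<^sub>2)"
      and l: "l = exp ((t\<^sub>2 - t\<^sub>1) / 2) *\<^sub>R s'" by blast
    have u: "geodesic_ray n ?e c" "exp (t\<^sub>2 - t\<^sub>1) = \<rho>\<^sup>2"
      "cl_conj (nav n ?e (c t\<^sub>2)) * nav n ?e' (c t\<^sub>2) = g"
      using uniq[OF c] by simp_all
    have NU: "nav n ?e (c t\<^sub>1) \<in> para_unitary (n + 1)" by (rule nav_unitary[OF horo_upper[OF c(2)] e(1)])
    have "w t\<^sub>2 = nav n ?e (c t\<^sub>2) * k"
      using spin_parallel_along_imp_nav[OF u(1) e(1) w(1), of t\<^sub>2 t\<^sub>1]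
      unfolding w(2) W[OF c(2)] para_unitaryD(8)[OF NU] .
    then have "s' = s" using main[OF c(3) u(3)] w(3) by simp
    then show "l = \<rho> *\<^sub>R s" using l rho[OF u(2)] by simp
  qed
  then show ?thesis using ne by (simp add: lambda_length_def)
qed


section \<open>Relative position of the two directions \<open>nav\<close> along a geodesic\<close>

lemma nav_above:
  assumes "p - (0, a) = (z, 0)" "z > 0"
  shows "nav n (Boundary a) p = gen (n + 1)"
  using assms by (simp add: nav_def to_para_def)

lemma nav_geo_down: "A > 0 \<Longrightarrow> nav n (Boundary a) (geo_down a A t) = gen (n + 1)"
  by (rule nav_above[of _ _ "exp (- t) / A"]) (simp_all add: geo_down_def)

lemma nav_geo_up: "B > 0 \<Longrightarrow> nav n (Boundary a) (geo_from a 0 B t) = gen (n + 1)"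
  by (rule nav_above[of _ _ "exp t / B"]) (simp_all add: geo_from_0)

definition geo_end :: "clifford \<Rightarrow> clifford \<Rightarrow> real \<Rightarrow> clifford" where
  "geo_end a v B = a + (1 / (B * inner v v)) *\<^sub>R v"

text \<open>The counterpart of \<open>geo_from_norm\<close> at the other end: time is reversed and
  \<open>B\<close> is replaced by \<open>B * inner v v\<close>. Inserting height times denominator,
  which is 1, brings both terms over a common factor.\<close>

lemma geo_from_end:
  assumes B: "B > 0" and v: "v \<noteq> 0"
  shows "geo_from a v B t - (0, geo_end a v B) =
      geo_height v B t *\<^sub>R (1, - (exp (- t) / inner v v) *\<^sub>R v)"
    "inner (geo_from a v B t - (0, geo_end a v B)) (geo_from a v B t - (0, geo_end a v B)) =
      geo_height v B t * exp (- t) / (B * inner v v)"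
proof -
  let ?h = "geo_height v B t"
  have vv: "inner v v > 0" using v by simp
  note hd = geo_height_mult_denominator[OF B, of v t]
  have "?h * exp t - 1 / (B * inner v v) = ?h * exp t - ?h * (B * (inner v v * exp t + exp (- t))) / (B * inner v v)"
    unfolding hd ..
  also have "\<dots> = ?h * - (exp (- t) / inner v v)"
    using B vv by (simp add: field_simps)
  finally have c: "?h * exp t - 1 / (B * inner v v) = ?h * - (exp (- t) / inner v v)" .
  have "snd (geo_from a v B t - (0, geo_end a v B)) = (?h * exp t - 1 / (B * inner v v)) *\<^sub>R v"
    by (simp add: geo_from_def geo_end_def scaleR_diff_left)
  then show *: "geo_from a v B t - (0, geo_end a v B) = ?h *\<^sub>R (1, - (exp (- t) / inner v v) *\<^sub>R v)"
    unfolding c by (simp add: prod_eq_iff geo_from_def)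
  have "inner (geo_from a v B t - (0, geo_end a v B)) (geo_from a v B t - (0, geo_end a v B)) =
    ?h * (?h * (1 + exp (- t) * exp (- t) / inner v v))"
    unfolding * using vv by (simp add: inner_prod_def algebra_simps)
  also have "?h * (1 + exp (- t) * exp (- t) / inner v v) =
      (?h * (B * (inner v v * exp t + exp (- t)))) * exp (- t) / (B * inner v v)"
  proof -
    have "exp t * exp (- t) = 1" by (simp add: exp_minus)
    then have "1 + exp (- t) * exp (- t) / inner v v = (inner v v * exp t + exp (- t)) * exp (- t) / inner v v"
      using vv by (simp add: distrib_right add_divide_distrib mult.assoc)
    then show ?thesis using B by simp
  qed
  finally show "inner (geo_from a v B t - (0, geo_end a v B)) (geo_from a v B t - (0, geo_end a v B)) =
      ?h * exp (- t) / (B * inner v v)"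
    unfolding hd by simp
qed

text \<open>The directions from a point of a semicircle to its two ends are orthogonal.\<close>

lemma nav_across:
  assumes B: "B > 0" and v: "v \<noteq> 0" "v \<in> paravectors n"
  shows "cl_conj (nav n (Boundary a) (geo_from a v B t)) * nav n (Boundary (geo_end a v B)) (geo_from a v B t)
    = (1 / norm v) *\<^sub>R (cl_conj v * gen (n + 1))"
proof -
  let ?h = "geo_height v B t" and ?i = "gen (n + 1)" and ?p = "geo_from a v B t" and ?b = "geo_end a v B"
  let ?\<beta> = "exp (- t) / inner v v"
  have vv: "inner v v > 0" using v by simp
  have nv: "norm v > 0" "inner v v = norm v * norm v"
    using v by (simp_all flip: power2_norm_eq_inner add: power2_eq_square)
  note hd = geo_height_mult_denominator[OF B, of v t] and h = geo_height_pos[OF B, of v t]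
  have ya: "to_para n (?p - (0, a)) = ?h *\<^sub>R (exp t *\<^sub>R v + ?i)"
    by (simp add: to_para_def geo_from_def scaleR_add_right)
  have yb: "to_para n (?p - (0, ?b)) = ?h *\<^sub>R (?i - ?\<beta> *\<^sub>R v)"
    unfolding geo_from_end(1)[OF B v(1)] to_para_linear(2) by (simp add: to_para_def)
  \<comment> \<open>The new generator turns a paravector into its conjugate when it passes
    it.\<close>
  have iv: "?i * v = cl_conj v * ?i"
    using gen_commute_cl[OF cl_conj[OF para_cl[OF v(2)]]] by (simp add: star_cl_conj para_star[OF v(2)])
  have ii: "?i * ?i = - 1" by (rule gen_square)
  \<comment> \<open>The scalar part of this product is the inner product of the two directions; it
    vanishes because the term with \<open>cl_conj v * v\<close> is 1 and \<open>?i * ?i\<close> is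
    -1.\<close>
  have "cl_conj (exp t *\<^sub>R v + ?i) * (?i - ?\<beta> *\<^sub>R v) =
     exp t *\<^sub>R (cl_conj v * ?i) - (exp t * ?\<beta>) *\<^sub>R (cl_conj v * v) - ?i * ?i + ?\<beta> *\<^sub>R (?i * v)"
    by (simp add: cl_conj_linear cl_conj_gen algebra_simps)
  also have "(exp t * ?\<beta>) *\<^sub>R (cl_conj v * v) = 1"
    unfolding para_mult_conj(2)[OF v(2)] using vv by (simp add: exp_minus)
  also have "exp t *\<^sub>R (cl_conj v * ?i) - 1 - ?i * ?i + ?\<beta> *\<^sub>R (?i * v) = (exp t + ?\<beta>) *\<^sub>R (cl_conj v * ?i)"
    unfolding iv ii by (simp add: scaleR_add_left)
  finally have prod: "cl_conj (exp t *\<^sub>R v + ?i) * (?i - ?\<beta> *\<^sub>R v) = (exp t + ?\<beta>) *\<^sub>R (cl_conj v * ?i)" .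
  have n: "norm (?p - (0, a)) * norm (?p - (0, ?b)) = ?h / (B * norm v)"
  proof (rule power2_eq_imp_eq)
    have "(norm (?p - (0, a)) * norm (?p - (0, ?b)))\<^sup>2 = (?h * exp t / B) * (?h * exp (- t) / (B * inner v v))"
      unfolding power_mult_distrib power2_norm_eq_inner geo_from_norm[OF B] geo_from_end(2)[OF B v(1)] ..
    also have "\<dots> = (?h / (B * norm v))\<^sup>2"
      unfolding nv(2) using B nv(1) by (simp add: exp_minus power2_eq_square field_simps)
    finally show "(norm (?p - (0, a)) * norm (?p - (0, ?b)))\<^sup>2 = (?h / (B * norm v))\<^sup>2" .
  qed (use B h nv in simp_all)
  have "cl_conj (nav n (Boundary a) ?p) * nav n (Boundary ?b) ?p =
    (inverse (norm (?p - (0, a)) * norm (?p - (0, ?b))) * (?h * ?h * (exp t + ?\<beta>))) *\<^sub>R (cl_conj v * ?i)"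
    unfolding nav_def ideal_point.case ya yb
    by (simp only: cl_conj_linear(2) mult_scaleR_left mult_scaleR_right prod scaleR_scaleR
        inverse_mult_distrib) (simp add: mult_ac)
  also have "inverse (norm (?p - (0, a)) * norm (?p - (0, ?b))) * (?h * ?h * (exp t + ?\<beta>)) =
     ?h * (B * (inner v v * exp t + exp (- t))) / norm v"
    unfolding n nv(2) using B h nv(1) by (simp add: field_simps)
  finally show ?thesis unfolding hd .
qed

section \<open>Parameters at which a geodesic meets a horosphere\<close>

lemma horo_geo_down:
  assumes "A > 0" "a \<in> paravectors n"
  shows "centre S = Infinity \<Longrightarrow> geo_down a A t \<in> horo n S \<longleftrightarrow> exp (- t) / A = hsize S"
    "centre S = Boundary a \<Longrightarrow> hsize S > 0 \<Longrightarrow> geo_down a A t \<in> horo n S \<longleftrightarrow> exp (- t) / A = 2 * hsize S"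
proof -
  note up = geo_down_upper[OF assms, of t]
  show "centre S = Infinity \<Longrightarrow> geo_down a A t \<in> horo n S \<longleftrightarrow> exp (- t) / A = hsize S"
    using up by (simp add: horo_def geo_down_def)
  assume S: "centre S = Boundary a" "hsize S > 0"
  define x where "x = exp (- t) / A"
  have x: "x > 0" using assms by (simp add: x_def)
  have "geo_down a A t \<in> horo n S \<longleftrightarrow> x * x = 2 * hsize S * x"
    unfolding horo_Boundary_iff[OF S(1) up S(2)] by (simp add: geo_down_def x_def)
  also have "\<dots> \<longleftrightarrow> x = 2 * hsize S" using x by simp
  finally show "geo_down a A t \<in> horo n S \<longleftrightarrow> exp (- t) / A = 2 * hsize S"
    by (simp only: x_def)
qed

lemma horo_geo_from:
  assumes "B > 0" "a \<in> paravectors n" "v \<in> paravectors n"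
  shows "centre S = Boundary a \<Longrightarrow> hsize S > 0 \<Longrightarrow> geo_from a v B t \<in> horo n S \<longleftrightarrow> exp t / B = 2 * hsize S"
    "centre S = Infinity \<Longrightarrow> geo_from a 0 B t \<in> horo n S \<longleftrightarrow> exp t / B = hsize S"
    "v \<noteq> 0 \<Longrightarrow> centre S = Boundary (geo_end a v B) \<Longrightarrow> hsize S > 0 \<Longrightarrow>
       geo_from a v B t \<in> horo n S \<longleftrightarrow> exp (- t) / (B * inner v v) = 2 * hsize S"
proof -
  note up = geo_from_upper[OF assms, of t]
  have h: "geo_height v B t > 0" by (rule geo_height_pos[OF assms(1)])
  have f: "fst (geo_from a v B t) = geo_height v B t" by (simp add: geo_from_def)
  have eq: "h * x / y = 2 * r * h \<longleftrightarrow> x / y = 2 * r" if "h > 0" for h x y r :: real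
  proof -
    have "h * x / y = 2 * r * h \<longleftrightarrow> h * (x / y) = h * (2 * r)" by (simp add: mult_ac)
    also have "\<dots> \<longleftrightarrow> x / y = 2 * r" using that by (simp only: mult_cancel_left) simp
    finally show ?thesis .
  qed
  show "geo_from a v B t \<in> horo n S \<longleftrightarrow> exp t / B = 2 * hsize S" if "centre S = Boundary a" "hsize S > 0"
    unfolding horo_Boundary_iff[OF that(1) up that(2)] geo_from_norm[OF assms(1)] f by (rule eq[OF h])
  show "geo_from a v B t \<in> horo n S \<longleftrightarrow> exp (- t) / (B * inner v v) = 2 * hsize S"
    if "v \<noteq> 0" "centre S = Boundary (geo_end a v B)" "hsize S > 0"
    unfolding horo_Boundary_iff[OF that(2) up that(3)] geo_from_end(2)[OF assms(1) that(1)] f by (rule eq[OF h])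
  show "geo_from a 0 B t \<in> horo n S \<longleftrightarrow> exp t / B = hsize S" if "centre S = Infinity"
    using geo_from_upper[OF assms(1,2) para_zero, of t] that by (simp add: horo_def geo_from_0)
qed

lemma exp_diff_quotient: "exp (t\<^sub>2 - t\<^sub>1) = exp (- t\<^sub>1) / exp (- t\<^sub>2)" for t\<^sub>1 t\<^sub>2 :: real
  by (simp add: exp_diff exp_minus field_simps)

text \<open>\<open>2 * hsize S\<close> is the Euclidean diameter; the square root reflects that a
  lambda length is the exponential of half a distance. For a finite centre, \<xi> times the inverse
  of \<eta> gives the centre back.\<close>

definition spinor_eta :: "spin_horosphere \<Rightarrow> clifford \<Rightarrow> clifford" where
  "spinor_eta S \<kappa> = (case centre S of Infinity \<Rightarrow> 0 | Boundary a \<Rightarrow> (1 / sqrt (2 * hsize S)) *\<^sub>R \<kappa>)"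

text \<open>The sign at \<open>Infinity\<close> is forced: with it the same bracket gives the lambda lengths to and from
  \<open>Infinity\<close>.\<close>

definition spinor_xi :: "spin_horosphere \<Rightarrow> clifford \<Rightarrow> clifford" where
  "spinor_xi S \<kappa> = (case centre S of Infinity \<Rightarrow> - (sqrt (hsize S) *\<^sub>R \<kappa>) | Boundary a \<Rightarrow> a * spinor_eta S \<kappa>)"

text \<open>The Clifford analogue of the determinant of a 2 by 2 matrix with the given
  columns.\<close>

definition spinor_bracket :: "clifford \<times> clifford \<Rightarrow> clifford \<times> clifford \<Rightarrow> clifford" where
  "spinor_bracket k l = star (fst k) * snd l - star (snd k) * fst l"

definition spinor :: "spin_horosphere \<Rightarrow> clifford \<Rightarrow> clifford \<times> clifford" where
  "spinor S \<kappa> = (spinor_xi S \<kappa>, spinor_eta S \<kappa>)"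

text \<open>The two copies of \<open>gen (n + 1)\<close> meet after one has passed
  \<open>cl_conj \<kappa>\<close>, whose grade involution is \<open>star \<kappa>\<close>, and they
  square to -1.\<close>

lemma gen_conj_gen:
  assumes "\<kappa> \<in> cl n"
  shows "gen (n + 1) * (cl_conj \<kappa> * (gen (n + 1) * x)) = - (star \<kappa> * x)"
proof -
  have "gen (n + 1) * (cl_conj \<kappa> * (gen (n + 1) * x)) = gen (n + 1) * (cl_conj \<kappa> * gen (n + 1)) * x"
    by (simp add: mult.assoc)
  also have "\<dots> = gen (n + 1) * gen (n + 1) * (star \<kappa> * x)"
    unfolding gen_commute_cl[OF cl_conj[OF assms]] by (simp add: star_cl_conj mult.assoc)
  finally show ?thesis by (simp only: gen_square) simp
qed

text \<open>Along a vertical line \<open>nav\<close> is 1 for \<open>Infinity\<close> and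
  \<open>gen (n + 1)\<close> for \<open>b\<close>. The horospheres are met at height
  \<open>hsize S\<^sub>1\<close> and at the top of the sphere, and the quotient of these heights is
  the exponential of the distance.\<close>

lemma lambda_length_down:
  assumes S: "spin_decorated_horosphere n S\<^sub>1" "spin_decorated_horosphere n S\<^sub>2"
    and \<kappa>: "spin_const n S\<^sub>1 \<kappa>\<^sub>1" "spin_const n S\<^sub>2 \<kappa>\<^sub>2"
    and e: "centre S\<^sub>1 = Infinity" "centre S\<^sub>2 = Boundary b"
  shows "lambda_length n S\<^sub>1 S\<^sub>2 = sqrt (hsize S\<^sub>1 / (2 * hsize S\<^sub>2)) *\<^sub>R (- (star \<kappa>\<^sub>1 * \<kappa>\<^sub>2))"
proof -
  have r: "hsize S\<^sub>1 > 0" "hsize S\<^sub>2 > 0" and b: "b \<in> paravectors n"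
    using S e spin_decorated_horosphereD by (auto simp: ideal_def)
  have k: "\<kappa>\<^sub>1 \<in> para_unitary n" "\<kappa>\<^sub>2 \<in> para_unitary n" using \<kappa> by (simp_all add: spin_const_def)
  show ?thesis
  proof (rule lambda_length_eqI[OF S \<kappa>, where c = "geo_down b 1" and t\<^sub>1 = "- ln (hsize S\<^sub>1)"
        and t\<^sub>2 = "- ln (2 * hsize S\<^sub>2)" and g = "gen (n + 1)"])
    fix c t\<^sub>1 t\<^sub>2 assume c: "geodesic_from_to n (centre S\<^sub>1) (centre S\<^sub>2) c"
      and t: "c t\<^sub>1 \<in> horo n S\<^sub>1" "c t\<^sub>2 \<in> horo n S\<^sub>2"
    obtain A where A: "A > 0" "c = geo_down b A"
      using c unfolding e by (rule geodesic_from_to_cases) auto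
    have "exp (- t\<^sub>1) / A = hsize S\<^sub>1" "exp (- t\<^sub>2) / A = 2 * hsize S\<^sub>2"
      using t horo_geo_down[OF A(1) b] e r unfolding A(2) by simp_all
    then have "exp (t\<^sub>2 - t\<^sub>1) = (A * hsize S\<^sub>1) / (A * (2 * hsize S\<^sub>2))"
      unfolding exp_diff_quotient using A(1) by (simp add: field_simps)
    then have "exp (t\<^sub>2 - t\<^sub>1) = (sqrt (hsize S\<^sub>1 / (2 * hsize S\<^sub>2)))\<^sup>2"
      using A(1) r by simp
    then show "geodesic_ray n (centre S\<^sub>1) c \<and> exp (t\<^sub>2 - t\<^sub>1) = (sqrt (hsize S\<^sub>1 / (2 * hsize S\<^sub>2)))\<^sup>2 \<and>
        cl_conj (nav n (centre S\<^sub>1) (c t\<^sub>2)) * nav n (centre S\<^sub>2) (c t\<^sub>2) = gen (n + 1)"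
      using geodesic_ray_geo_down[OF A(1) b] nav_geo_down[OF A(1), of n b t\<^sub>2] unfolding e A(2)
      by (simp add: nav_def[of n Infinity])
  next
    show "geodesic_from_to n (centre S\<^sub>1) (centre S\<^sub>2) (geo_down b 1)"
      using unit_speed_geo_down[OF _ b, of 1] geo_down_at_bot[of 1 b] geo_down_at_top[of 1 b]
      by (simp add: geodesic_from_to_def e tends_to_ideal_def)
    show "geo_down b 1 (- ln (hsize S\<^sub>1)) \<in> horo n S\<^sub>1" "geo_down b 1 (- ln (2 * hsize S\<^sub>2)) \<in> horo n S\<^sub>2"
      using horo_geo_down[OF _ b, of 1] e r by simp_all
    show "gen (n + 1) * (cl_conj \<kappa>\<^sub>1 * (gen (n + 1) * \<kappa>\<^sub>2)) = - (star \<kappa>\<^sub>1 * \<kappa>\<^sub>2)"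
      by (rule gen_conj_gen[OF para_unitaryD(1)[OF k(1)]])
    show "- (star \<kappa>\<^sub>1 * \<kappa>\<^sub>2) \<in> para_unitary n"
      by (intro para_unitary_uminus para_unitary_mult para_unitary_star k)
  qed (use e r in simp_all)
qed

text \<open>The two values of \<open>nav\<close> trade places, so \<open>g\<close> is the conjugate
  of its value on a descending line; this gives the opposite sign.\<close>

lemma lambda_length_up:
  assumes S: "spin_decorated_horosphere n S\<^sub>1" "spin_decorated_horosphere n S\<^sub>2"
    and \<kappa>: "spin_const n S\<^sub>1 \<kappa>\<^sub>1" "spin_const n S\<^sub>2 \<kappa>\<^sub>2"
    and e: "centre S\<^sub>1 = Boundary a" "centre S\<^sub>2 = Infinity"
  shows "lambda_length n S\<^sub>1 S\<^sub>2 = sqrt (hsize S\<^sub>2 / (2 * hsize S\<^sub>1)) *\<^sub>R (star \<kappa>\<^sub>1 * \<kappa>\<^sub>2)"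
proof -
  have r: "hsize S\<^sub>1 > 0" "hsize S\<^sub>2 > 0" and a: "a \<in> paravectors n"
    using S e spin_decorated_horosphereD by (auto simp: ideal_def)
  have k: "\<kappa>\<^sub>1 \<in> para_unitary n" "\<kappa>\<^sub>2 \<in> para_unitary n" using \<kappa> by (simp_all add: spin_const_def)
  show ?thesis
  proof (rule lambda_length_eqI[OF S \<kappa>, where c = "geo_from a 0 1" and t\<^sub>1 = "ln (2 * hsize S\<^sub>1)"
        and t\<^sub>2 = "ln (hsize S\<^sub>2)" and g = "- gen (n + 1)"])
    fix c t\<^sub>1 t\<^sub>2 assume c: "geodesic_from_to n (centre S\<^sub>1) (centre S\<^sub>2) c"
      and t: "c t\<^sub>1 \<in> horo n S\<^sub>1" "c t\<^sub>2 \<in> horo n S\<^sub>2"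
    obtain B where B: "B > 0" "c = geo_from a 0 B"
      using c unfolding e by (rule geodesic_from_to_cases) auto
    have "exp t\<^sub>1 / B = 2 * hsize S\<^sub>1" "exp t\<^sub>2 / B = hsize S\<^sub>2"
      using t horo_geo_from[OF B(1) a para_zero] e r unfolding B(2) by simp_all
    then have "exp (t\<^sub>2 - t\<^sub>1) = (B * hsize S\<^sub>2) / (B * (2 * hsize S\<^sub>1))"
      unfolding exp_diff using B(1) by (simp add: field_simps)
    then have "exp (t\<^sub>2 - t\<^sub>1) = (sqrt (hsize S\<^sub>2 / (2 * hsize S\<^sub>1)))\<^sup>2"
      using B(1) r by simp
    then show "geodesic_ray n (centre S\<^sub>1) c \<and> exp (t\<^sub>2 - t\<^sub>1) = (sqrt (hsize S\<^sub>2 / (2 * hsize S\<^sub>1)))\<^sup>2 \<and>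
        cl_conj (nav n (centre S\<^sub>1) (c t\<^sub>2)) * nav n (centre S\<^sub>2) (c t\<^sub>2) = - gen (n + 1)"
      using geodesic_ray_geo_from[OF B(1) a para_zero] nav_geo_up[OF B(1), of n a t\<^sub>2] unfolding e B(2)
      by (simp add: nav_def[of n Infinity] cl_conj_gen)
  next
    show "geodesic_from_to n (centre S\<^sub>1) (centre S\<^sub>2) (geo_from a 0 1)"
      using unit_speed_geo_from[OF _ a para_zero, of 1] geo_from_at_bot[of 1 a 0] geo_from_0_at_top[of 1 a]
      by (simp add: geodesic_from_to_def e tends_to_ideal_def)
    show "geo_from a 0 1 (ln (2 * hsize S\<^sub>1)) \<in> horo n S\<^sub>1" "geo_from a 0 1 (ln (hsize S\<^sub>2)) \<in> horo n S\<^sub>2"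
      using horo_geo_from[OF _ a para_zero, of 1] e r by simp_all
    show "gen (n + 1) * (cl_conj \<kappa>\<^sub>1 * (- gen (n + 1) * \<kappa>\<^sub>2)) = star \<kappa>\<^sub>1 * \<kappa>\<^sub>2"
      using gen_conj_gen[OF para_unitaryD(1)[OF k(1)], of \<kappa>\<^sub>2] by simp
    show "star \<kappa>\<^sub>1 * \<kappa>\<^sub>2 \<in> para_unitary n"
      by (intro para_unitary_mult para_unitary_star k)
  qed (use e r in simp_all)
qed

text \<open>The exponential of the distance is the squared distance of the centres over the product
  of the two diameters. The factor \<open>cl_conj \<delta>\<close> from \<open>nav_across\<close> is
  absorbed into the first constant before \<open>gen_conj_gen\<close> is applied.\<close>

lemma lambda_length_across:
  assumes S: "spin_decorated_horosphere n S\<^sub>1" "spin_decorated_horosphere n S\<^sub>2"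
    and \<kappa>: "spin_const n S\<^sub>1 \<kappa>\<^sub>1" "spin_const n S\<^sub>2 \<kappa>\<^sub>2"
    and e: "centre S\<^sub>1 = Boundary a" "centre S\<^sub>2 = Boundary b" "a \<noteq> b"
  shows "lambda_length n S\<^sub>1 S\<^sub>2 =
      (norm (b - a) / sqrt (4 * hsize S\<^sub>1 * hsize S\<^sub>2)) *\<^sub>R (- (star \<kappa>\<^sub>1 * (((1 / norm (b - a)) *\<^sub>R (b - a)) * \<kappa>\<^sub>2)))"
    "(1 / norm (b - a)) *\<^sub>R (b - a) \<in> para_unitary n"
proof -
  have r: "hsize S\<^sub>1 > 0" "hsize S\<^sub>2 > 0" and ab: "a \<in> paravectors n" "b \<in> paravectors n"
    using S e spin_decorated_horosphereD by (auto simp: ideal_def)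
  have k: "\<kappa>\<^sub>1 \<in> para_unitary n" "\<kappa>\<^sub>2 \<in> para_unitary n" using \<kappa> by (simp_all add: spin_const_def)
  define \<delta> where "\<delta> = (1 / norm (b - a)) *\<^sub>R (b - a)"
  have nz: "norm (b - a) > 0" using e(3) by simp
  have \<delta>p: "\<delta> \<in> paravectors n" unfolding \<delta>_def by (intro para_scaleR para_diff ab)
  have "norm \<delta> = 1" using nz by (simp add: \<delta>_def)
  then have "inner \<delta> \<delta> = 1" by (simp add: norm_eq_sqrt_inner)
  then have \<delta>U: "\<delta> \<in> para_unitary n" by (rule para_unitary_paravector[OF \<delta>p])
  then show "(1 / norm (b - a)) *\<^sub>R (b - a) \<in> para_unitary n" by (simp only: \<delta>_def)
  \<comment> \<open>The two ends determine \<open>B\<close> and \<open>v\<close> only up to a time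
    shift, which scales them inversely; these two combinations are invariant.\<close>
  have ends: "(norm (b - a))\<^sup>2 = 1 / (B\<^sup>2 * inner v v) \<and> (1 / norm v) *\<^sub>R v = \<delta>"
    if "B > 0" "v \<noteq> 0" "b = geo_end a v B" for B v
  proof -
    have ba: "b - a = (1 / (B * inner v v)) *\<^sub>R v" using that(3) by (simp add: geo_end_def)
    have vv: "inner v v > 0" using that by simp
    have n: "norm (b - a) = (1 / (B * inner v v)) * norm v" unfolding ba using that(1) vv by simp
    have "(norm (b - a))\<^sup>2 = (1 / (B * inner v v))\<^sup>2 * inner v v"
      unfolding n power_mult_distrib power2_norm_eq_inner ..
    also have "\<dots> = 1 / (B\<^sup>2 * inner v v)" using that(1) vv by (simp add: power2_eq_square field_simps)
    finally show ?thesis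
      unfolding \<delta>_def n unfolding ba using that(1) vv by simp
  qed
  \<comment> \<open>For \<open>B = 1\<close> the geodesic ends at a + v / |v|^2, so \<open>v\<close>
    has to be the inverse point of \<open>b - a\<close>.\<close>
  define v where "v = (1 / inner (b - a) (b - a)) *\<^sub>R (b - a)"
  have baba: "inner (b - a) (b - a) > 0" using e(3) by simp
  have v: "v \<in> paravectors n" "v \<noteq> 0" using e(3) baba unfolding v_def by (auto intro!: para_scaleR para_diff ab)
  have vv: "inner v v = 1 / inner (b - a) (b - a)"
    using baba unfolding v_def inner_scaleR_left inner_scaleR_right by simp
  then have bv: "geo_end a v 1 = b" using baba unfolding geo_end_def vv by (simp add: v_def)
  have vv0: "inner v v > 0" using v by simp
  show "lambda_length n S\<^sub>1 S\<^sub>2 = (norm (b - a) / sqrt (4 * hsize S\<^sub>1 * hsize S\<^sub>2)) *\<^sub>R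
      (- (star \<kappa>\<^sub>1 * (((1 / norm (b - a)) *\<^sub>R (b - a)) * \<kappa>\<^sub>2)))"
    unfolding \<delta>_def[symmetric]
  proof (rule lambda_length_eqI[OF S \<kappa>, where c = "geo_from a v 1" and t\<^sub>1 = "ln (2 * hsize S\<^sub>1)"
        and t\<^sub>2 = "- ln (inner v v * (2 * hsize S\<^sub>2))" and g = "cl_conj \<delta> * gen (n + 1)"])
    fix c t\<^sub>1 t\<^sub>2 assume c: "geodesic_from_to n (centre S\<^sub>1) (centre S\<^sub>2) c"
      and t: "c t\<^sub>1 \<in> horo n S\<^sub>1" "c t\<^sub>2 \<in> horo n S\<^sub>2"
    obtain B v where B: "B > 0" and v: "v \<noteq> 0" "v \<in> paravectors n" and cc: "c = geo_from a v B" and bb: "b = geo_end a v B"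
      using c unfolding e by (rule geodesic_from_to_cases) (auto simp: geo_end_def)
    have vv: "inner v v > 0" using v by simp
    have t1: "exp t\<^sub>1 = 2 * hsize S\<^sub>1 * B"
      using t(1) horo_geo_from(1)[OF B ab(1) v(2) e(1) r(1)] B unfolding cc by (simp add: field_simps)
    have "exp (- t\<^sub>2) / (B * inner v v) = 2 * hsize S\<^sub>2"
      using t(2) horo_geo_from(3)[OF B ab(1) v(2) v(1) _ r(2)] e(2) unfolding cc bb by blast
    then have "exp (- t\<^sub>2) = 2 * hsize S\<^sub>2 * (B * inner v v)"
      using B vv by (simp add: field_simps)
    then have t2: "exp t\<^sub>2 = 1 / (2 * hsize S\<^sub>2 * (B * inner v v))"
      using exp_minus_inverse[of "t\<^sub>2"] by (metis divide_inverse exp_minus inverse_inverse_eq mult_1)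
    have "exp (t\<^sub>2 - t\<^sub>1) = (1 / (B\<^sup>2 * inner v v)) / (4 * hsize S\<^sub>1 * hsize S\<^sub>2)"
      unfolding exp_diff t1 t2 by (simp add: power2_eq_square mult_ac)
    also have "\<dots> = (norm (b - a) / sqrt (4 * hsize S\<^sub>1 * hsize S\<^sub>2))\<^sup>2"
      using ends[OF B v(1) bb] r by (simp add: power_divide)
    finally have "exp (t\<^sub>2 - t\<^sub>1) = (norm (b - a) / sqrt (4 * hsize S\<^sub>1 * hsize S\<^sub>2))\<^sup>2" .
    moreover have "cl_conj (nav n (centre S\<^sub>1) (c t\<^sub>2)) * nav n (centre S\<^sub>2) (c t\<^sub>2) = cl_conj \<delta> * gen (n + 1)"
      using nav_across[OF B v, of a t\<^sub>2] ends[OF B v(1) bb] unfolding e cc bb[symmetric]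
      by (metis cl_conj_linear(2) mult_scaleR_left)
    moreover have "geodesic_ray n (centre S\<^sub>1) c"
      unfolding e cc by (rule geodesic_ray_geo_from[OF B ab(1) v(2)])
    ultimately show "geodesic_ray n (centre S\<^sub>1) c \<and>
        exp (t\<^sub>2 - t\<^sub>1) = (norm (b - a) / sqrt (4 * hsize S\<^sub>1 * hsize S\<^sub>2))\<^sup>2 \<and>
        cl_conj (nav n (centre S\<^sub>1) (c t\<^sub>2)) * nav n (centre S\<^sub>2) (c t\<^sub>2) = cl_conj \<delta> * gen (n + 1)"
      by blast
  next
    show "geodesic_from_to n (centre S\<^sub>1) (centre S\<^sub>2) (geo_from a v 1)"
      using unit_speed_geo_from[OF _ ab(1) v(1), of 1] geo_from_at_bot[of 1 a v] geo_from_at_top[OF _ v(2), of 1 a]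
      by (simp add: geodesic_from_to_def e tends_to_ideal_def bv[unfolded geo_end_def, simplified])
    show "geo_from a v 1 (ln (2 * hsize S\<^sub>1)) \<in> horo n S\<^sub>1"
      using horo_geo_from(1)[OF _ ab(1) v(1) e(1) r(1), of 1] r by simp
    show "geo_from a v 1 (- ln (inner v v * (2 * hsize S\<^sub>2))) \<in> horo n S\<^sub>2"
      using horo_geo_from(3)[OF _ ab(1) v(1) v(2) _ r(2), of 1] e(2) r vv0 by (simp add: bv)
    have "gen (n + 1) * (cl_conj \<kappa>\<^sub>1 * (cl_conj \<delta> * gen (n + 1) * \<kappa>\<^sub>2)) =
      gen (n + 1) * (cl_conj (\<delta> * \<kappa>\<^sub>1) * (gen (n + 1) * \<kappa>\<^sub>2))"
      by (simp add: cl_conj_mult mult.assoc)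
    also have "\<dots> = - (star (\<delta> * \<kappa>\<^sub>1) * \<kappa>\<^sub>2)"
      by (rule gen_conj_gen) (intro cl_mult para_cl \<delta>p para_unitaryD(1)[OF k(1)])
    also have "\<dots> = - (star \<kappa>\<^sub>1 * (\<delta> * \<kappa>\<^sub>2))"
      by (simp add: star_mult para_star[OF \<delta>p] mult.assoc)
    finally show "gen (n + 1) * (cl_conj \<kappa>\<^sub>1 * (cl_conj \<delta> * gen (n + 1) * \<kappa>\<^sub>2)) = - (star \<kappa>\<^sub>1 * (\<delta> * \<kappa>\<^sub>2))" .
    show "- (star \<kappa>\<^sub>1 * (\<delta> * \<kappa>\<^sub>2)) \<in> para_unitary n"
      by (intro para_unitary_uminus para_unitary_mult para_unitary_star k \<delta>U)
  qed (use e r nz in simp_all)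
qed

text \<open>The four positions of the centres are matched with the formulas above. For equal centres
  both sides vanish: the bracket of two finite ones has the difference of the centres as a factor,
  and at \<open>Infinity\<close> both second components are 0.\<close>

lemma lambda_length_spinor_bracket:
  assumes S: "spin_decorated_horosphere n S\<^sub>1" "spin_decorated_horosphere n S\<^sub>2"
    and \<kappa>: "spin_const n S\<^sub>1 \<kappa>\<^sub>1" "spin_const n S\<^sub>2 \<kappa>\<^sub>2"
  shows "lambda_length n S\<^sub>1 S\<^sub>2 = spinor_bracket (spinor S\<^sub>1 \<kappa>\<^sub>1) (spinor S\<^sub>2 \<kappa>\<^sub>2)"
proof -
  have r: "hsize S\<^sub>1 > 0" "hsize S\<^sub>2 > 0" and i: "ideal n (centre S\<^sub>1)" "ideal n (centre S\<^sub>2)"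
    using S spin_decorated_horosphereD by auto
  note defs = spinor_bracket_def spinor_def spinor_xi_def spinor_eta_def
  show ?thesis
  proof (cases "centre S\<^sub>1"; cases "centre S\<^sub>2")
    assume "centre S\<^sub>1 = Infinity" "centre S\<^sub>2 = Infinity"
    then show ?thesis by (simp add: lambda_length_def defs)
  next
    fix b assume e: "centre S\<^sub>1 = Infinity" "centre S\<^sub>2 = Boundary b"
    show ?thesis
      unfolding lambda_length_down[OF S \<kappa> e]
      using r by (simp add: defs e star_uminus star_linear real_sqrt_divide)
  next
    fix a assume e: "centre S\<^sub>1 = Boundary a" "centre S\<^sub>2 = Infinity"
    show ?thesis
      unfolding lambda_length_up[OF S \<kappa> e]
      using r by (simp add: defs e star_uminus star_linear real_sqrt_divide)
  next
    fix a b assume e: "centre S\<^sub>1 = Boundary a" "centre S\<^sub>2 = Boundary b"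
    have ab: "a \<in> paravectors n" using i e by (simp add: ideal_def)
    have rhs: "spinor_bracket (spinor S\<^sub>1 \<kappa>\<^sub>1) (spinor S\<^sub>2 \<kappa>\<^sub>2) =
      (1 / (sqrt (2 * hsize S\<^sub>1) * sqrt (2 * hsize S\<^sub>2))) *\<^sub>R (- (star \<kappa>\<^sub>1 * ((b - a) * \<kappa>\<^sub>2)))"
      by (simp add: defs e star_mult star_linear para_star[OF ab] left_diff_distrib right_diff_distrib
          scaleR_diff_right mult.assoc mult.commute[of "sqrt (2 * hsize S\<^sub>2)" "sqrt (2 * hsize S\<^sub>1)"])
    show ?thesis
    proof (cases "a = b")
      case True
      then show ?thesis unfolding rhs by (simp add: lambda_length_def e)
    next
      case False
      have "sqrt (4 * hsize S\<^sub>1 * hsize S\<^sub>2) = sqrt (2 * hsize S\<^sub>1) * sqrt (2 * hsize S\<^sub>2)"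
        by (simp flip: real_sqrt_mult)
      moreover have "norm (b - a) > 0" using False by simp
      ultimately show ?thesis
        unfolding rhs lambda_length_across(1)[OF S \<kappa> e False] by (simp del: real_sqrt_mult)
    qed
  qed
qed

section \<open>Invertibility of non-zero lambda lengths\<close>

lemma para_unitary_inverse:
  assumes "s \<in> para_unitary n" "c \<noteq> 0"
  shows "inverse (c *\<^sub>R s) * (c *\<^sub>R s) = 1"
proof -
  have "inverse (c *\<^sub>R s) = (1 / c) *\<^sub>R cl_conj s"
    by (rule clifford_inverse_unique) (simp_all add: para_unitaryD[OF assms(1)] assms(2))
  then show ?thesis using assms by (simp add: para_unitaryD)
qed

text \<open>\<open>inverse\<close> is 0 on non-units, so non-vanishing alone does not suffice. In
  each position of the centres the length is a real multiple of an element of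
  \<open>para_unitary\<close>, whose conjugate is its inverse.\<close>

lemma lambda_length_invertible:
  assumes S: "spin_decorated_horosphere n S\<^sub>1" "spin_decorated_horosphere n S\<^sub>2"
    and \<kappa>: "spin_const n S\<^sub>1 \<kappa>\<^sub>1" "spin_const n S\<^sub>2 \<kappa>\<^sub>2" and nz: "lambda_length n S\<^sub>1 S\<^sub>2 \<noteq> 0"
  shows "inverse (lambda_length n S\<^sub>1 S\<^sub>2) * lambda_length n S\<^sub>1 S\<^sub>2 = 1"
    "lambda_length n S\<^sub>1 S\<^sub>2 * inverse (lambda_length n S\<^sub>1 S\<^sub>2) = 1"
proof -
  have k: "\<kappa>\<^sub>1 \<in> para_unitary n" "\<kappa>\<^sub>2 \<in> para_unitary n" using \<kappa> by (simp_all add: spin_const_def)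
  have r: "hsize S\<^sub>1 > 0" "hsize S\<^sub>2 > 0" using S spin_decorated_horosphereD by auto
  have "\<exists>c s. lambda_length n S\<^sub>1 S\<^sub>2 = c *\<^sub>R s \<and> s \<in> para_unitary n"
  proof (cases "centre S\<^sub>1"; cases "centre S\<^sub>2")
    assume "centre S\<^sub>1 = Infinity" "centre S\<^sub>2 = Infinity"
    then show ?thesis using nz by (simp add: lambda_length_def)
  next
    fix b assume e: "centre S\<^sub>1 = Infinity" "centre S\<^sub>2 = Boundary b"
    show ?thesis
      using lambda_length_down[OF S \<kappa> e] para_unitary_uminus[OF para_unitary_mult[OF para_unitary_star[OF k(1)] k(2)]]
      by blast
  next
    fix a assume e: "centre S\<^sub>1 = Boundary a" "centre S\<^sub>2 = Infinity"
    show ?thesis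
      using lambda_length_up[OF S \<kappa> e] para_unitary_mult[OF para_unitary_star[OF k(1)] k(2)] by blast
  next
    fix a b assume e: "centre S\<^sub>1 = Boundary a" "centre S\<^sub>2 = Boundary b"
    then have ne: "a \<noteq> b" using nz by (auto simp: lambda_length_def)
    show ?thesis
      using lambda_length_across[OF S \<kappa> e ne] para_unitary_uminus[OF para_unitary_mult[OF para_unitary_star[OF k(1)]
          para_unitary_mult[OF lambda_length_across(2)[OF S \<kappa> e ne] k(2)]]] by blast
  qed
  then obtain c s where cs: "lambda_length n S\<^sub>1 S\<^sub>2 = c *\<^sub>R s" "s \<in> para_unitary n" by blast
  have c: "c \<noteq> 0" using nz cs by auto
  show l: "inverse (lambda_length n S\<^sub>1 S\<^sub>2) * lambda_length n S\<^sub>1 S\<^sub>2 = 1"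
    unfolding cs(1) by (rule para_unitary_inverse[OF cs(2) c])
  have "inverse (c *\<^sub>R s) = (1 / c) *\<^sub>R cl_conj s"
    by (rule clifford_inverse_unique) (simp_all add: para_unitaryD[OF cs(2)] c)
  then show "lambda_length n S\<^sub>1 S\<^sub>2 * inverse (lambda_length n S\<^sub>1 S\<^sub>2) = 1"
    unfolding cs(1) using c by (simp add: para_unitaryD[OF cs(2)])
qed

section \<open>The Ptolemy relation\<close>

lemma star_spinor_bracket: "star (spinor_bracket k l) = - spinor_bracket l k"
  by (simp add: spinor_bracket_def star_diff star_mult)

text \<open>A finite centre is a paravector and thus fixed by \<open>star\<close>, so both terms
  agree; at \<open>Infinity\<close> the second component is 0.\<close>

lemma spinor_bracket_self:
  assumes "ideal n (centre S)"
  shows "spinor_bracket (spinor S \<kappa>) (spinor S \<kappa>) = 0"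
  using assms by (auto simp: spinor_bracket_def spinor_def spinor_xi_def star_mult star_linear para_star ideal_def mult.assoc
      spinor_eta_def split: ideal_point.splits)

lemma spinor_bracket_right:
  "spinor_bracket k (fst l - fst l' * x - fst l'' * y, snd l - snd l' * x - snd l'' * y) =
   spinor_bracket k l - spinor_bracket k l' * x - spinor_bracket k l'' * y"
  by (simp add: spinor_bracket_def left_diff_distrib right_diff_distrib mult.assoc)

lemma star_unitary_cancel:
  assumes "\<kappa> \<in> para_unitary n" "star \<kappa> * q = 0"
  shows "q = 0"
proof -
  have "q = grade \<kappa> * star \<kappa> * q" by (simp only: para_unitaryD(5)[OF assms(1)] mult_1_left)
  then show ?thesis using assms(2) by (simp add: mult.assoc)
qed

text \<open>A vanishing bracket with a spinor centred at \<open>a\<close> means that the first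
  component is \<open>a\<close> times the second, and at \<open>Infinity\<close> that the second is
  0. For two finite centres the difference is a non-zero paravector, hence invertible, and kills the
  second component.\<close>

lemma spinors_nondegenerate:
  assumes S: "spin_decorated_horosphere n S" "spin_decorated_horosphere n T"
    and \<kappa>: "\<kappa> \<in> para_unitary n" "\<mu> \<in> para_unitary n" and ne: "centre S \<noteq> centre T"
    and z: "spinor_bracket (spinor S \<kappa>) l = 0" "spinor_bracket (spinor T \<mu>) l = 0"
  shows "l = (0, 0)"
proof -
  have fin: "snd l = 0" if "centre S = Infinity" "spin_decorated_horosphere n S" "\<kappa> \<in> para_unitary n"
    "spinor_bracket (spinor S \<kappa>) l = 0" for S \<kappa>
  proof -
    have r: "hsize S > 0" using that spin_decorated_horosphereD by auto
    have "sqrt (hsize S) *\<^sub>R (star \<kappa> * snd l) = 0"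
      using that(4) by (simp add: spinor_bracket_def spinor_def spinor_xi_def spinor_eta_def that(1) star_uminus star_linear)
    then have "star \<kappa> * snd l = 0" using r by simp
    then show ?thesis by (rule star_unitary_cancel[OF that(3)])
  qed
  have bd: "a * snd l = fst l \<and> a \<in> paravectors n" if "centre S = Boundary a" "spin_decorated_horosphere n S" "\<kappa> \<in> para_unitary n"
    "spinor_bracket (spinor S \<kappa>) l = 0" for S \<kappa> a
  proof -
    have r: "hsize S > 0" and a: "a \<in> paravectors n"
      using that spin_decorated_horosphereD(1)[OF that(2)] spin_decorated_horosphereD(2)[OF that(2)]
      by (simp_all add: ideal_def)
    have "(1 / sqrt (2 * hsize S)) *\<^sub>R (star \<kappa> * (a * snd l - fst l)) = 0"
      using that(4) by (simp add: spinor_bracket_def spinor_def spinor_xi_def spinor_eta_def that(1) star_mult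
          star_linear para_star[OF a] right_diff_distrib scaleR_diff_right mult.assoc)
    then have "star \<kappa> * (a * snd l - fst l) = 0" using r by simp
    then have "a * snd l - fst l = 0" by (rule star_unitary_cancel[OF that(3)])
    then show ?thesis using a by simp
  qed
  have "snd l = 0 \<and> fst l = 0"
  proof (cases "centre S"; cases "centre T")
    assume "centre S = Infinity" "centre T = Infinity"
    then show ?thesis using ne by simp
  next
    fix b assume e: "centre S = Infinity" "centre T = Boundary b"
    show ?thesis using fin[OF e(1) S(1) \<kappa>(1) z(1)] bd[OF e(2) S(2) \<kappa>(2) z(2)] by simp
  next
    fix a assume e: "centre S = Boundary a" "centre T = Infinity"
    show ?thesis using fin[OF e(2) S(2) \<kappa>(2) z(2)] bd[OF e(1) S(1) \<kappa>(1) z(1)] by simp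
  next
    fix a b assume e: "centre S = Boundary a" "centre T = Boundary b"
    have a: "a * snd l = fst l" "a \<in> paravectors n" using bd[OF e(1) S(1) \<kappa>(1) z(1)] by simp_all
    have b: "b * snd l = fst l" "b \<in> paravectors n" using bd[OF e(2) S(2) \<kappa>(2) z(2)] by simp_all
    have "(a - b) * snd l = 0" using a b by (simp add: left_diff_distrib)
    then have "cl_conj (a - b) * (a - b) * snd l = 0" by (simp add: mult.assoc)
    then have "inner (a - b) (a - b) *\<^sub>R snd l = 0"
      unfolding para_mult_conj(2)[OF para_diff[OF a(2) b(2)]] by simp
    moreover have "inner (a - b) (a - b) \<noteq> 0" using ne e by simp
    ultimately have "snd l = 0" by simp
    then show ?thesis using a by simp
  qed
  then show ?thesis by (simp add: prod_eq_iff)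
qed


theorem mainTheorem4:
  fixes n :: nat and S\<^sub>1 S\<^sub>2 S\<^sub>3 S\<^sub>4 :: spin_horosphere
  assumes "spin_decorated_horosphere n S\<^sub>1" and "spin_decorated_horosphere n S\<^sub>2"
    and "spin_decorated_horosphere n S\<^sub>3" and "spin_decorated_horosphere n S\<^sub>4"
    and "lambda_length n S\<^sub>3 S\<^sub>1 \<noteq> 0" and "lambda_length n S\<^sub>4 S\<^sub>2 \<noteq> 0"
    and "lambda_length n S\<^sub>2 S\<^sub>4 \<noteq> 0"
  shows
    "inverse (lambda_length n S\<^sub>3 S\<^sub>1) * star (lambda_length n S\<^sub>2 S\<^sub>3) *
       inverse (lambda_length n S\<^sub>4 S\<^sub>2) * star (lambda_length n S\<^sub>1 S\<^sub>4) +
     inverse (lambda_length n S\<^sub>3 S\<^sub>1) * star (lambda_length n S\<^sub>4 S\<^sub>3) *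
       inverse (lambda_length n S\<^sub>2 S\<^sub>4) * star (lambda_length n S\<^sub>1 S\<^sub>2) = 1"

proof -
  note S = assms(1-4)
  have ex: "\<exists>\<kappa>. spin_const n S \<kappa>" if "spin_decorated_horosphere n S" for S
    using spin_frames_nav[OF that] unfolding spin_const_def by metis
  obtain \<kappa>\<^sub>1 \<kappa>\<^sub>2 \<kappa>\<^sub>3 \<kappa>\<^sub>4 where \<kappa>: "spin_const n S\<^sub>1 \<kappa>\<^sub>1" "spin_const n S\<^sub>2 \<kappa>\<^sub>2"
    "spin_const n S\<^sub>3 \<kappa>\<^sub>3" "spin_const n S\<^sub>4 \<kappa>\<^sub>4"
    using ex S by metis
  let ?L = "lambda_length n" and ?b = spinor_bracket
  define k\<^sub>1 k\<^sub>2 k\<^sub>3 k\<^sub>4 where k: "k\<^sub>1 = spinor S\<^sub>1 \<kappa>\<^sub>1" "k\<^sub>2 = spinor S\<^sub>2 \<kappa>\<^sub>2"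
    "k\<^sub>3 = spinor S\<^sub>3 \<kappa>\<^sub>3" "k\<^sub>4 = spinor S\<^sub>4 \<kappa>\<^sub>4"
  have L: "?L S\<^sub>3 S\<^sub>1 = ?b k\<^sub>3 k\<^sub>1" "?L S\<^sub>2 S\<^sub>3 = ?b k\<^sub>2 k\<^sub>3" "?L S\<^sub>4 S\<^sub>2 = ?b k\<^sub>4 k\<^sub>2" "?L S\<^sub>1 S\<^sub>4 = ?b k\<^sub>1 k\<^sub>4"
    "?L S\<^sub>4 S\<^sub>3 = ?b k\<^sub>4 k\<^sub>3" "?L S\<^sub>2 S\<^sub>4 = ?b k\<^sub>2 k\<^sub>4" "?L S\<^sub>1 S\<^sub>2 = ?b k\<^sub>1 k\<^sub>2"
    unfolding k by (intro lambda_length_spinor_bracket S \<kappa>)+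
  have inv31: "inverse (?b k\<^sub>3 k\<^sub>1) * ?b k\<^sub>3 k\<^sub>1 = 1"
    using lambda_length_invertible(1)[OF S(3,1) \<kappa>(3,1) assms(5)] unfolding L .
  have inv42: "?b k\<^sub>4 k\<^sub>2 * inverse (?b k\<^sub>4 k\<^sub>2) = 1"
    using lambda_length_invertible(2)[OF S(4,2) \<kappa>(4,2) assms(6)] unfolding L .
  have inv24: "?b k\<^sub>2 k\<^sub>4 * inverse (?b k\<^sub>2 k\<^sub>4) = 1"
    using lambda_length_invertible(2)[OF S(2,4) \<kappa>(2,4) assms(7)] unfolding L .
  have self: "?b k\<^sub>2 k\<^sub>2 = 0" "?b k\<^sub>4 k\<^sub>4 = 0"
    unfolding k using S spin_decorated_horosphereD(2) by (auto intro!: spinor_bracket_self)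
  have ne: "centre S\<^sub>2 \<noteq> centre S\<^sub>4" using assms(7) by (auto simp: lambda_length_def)
  define x where "x = inverse (?b k\<^sub>4 k\<^sub>2) * ?b k\<^sub>4 k\<^sub>1"
  define y where "y = inverse (?b k\<^sub>2 k\<^sub>4) * ?b k\<^sub>2 k\<^sub>1"
  let ?l = "(fst k\<^sub>1 - fst k\<^sub>2 * x - fst k\<^sub>4 * y, snd k\<^sub>1 - snd k\<^sub>2 * x - snd k\<^sub>4 * y)"
  have "?b k\<^sub>2 ?l = 0" "?b k\<^sub>4 ?l = 0"
    unfolding spinor_bracket_right self x_def y_def
    using inv24 inv42 by (simp_all flip: mult.assoc)
  then have "?l = (0, 0)"
    unfolding k(2,4) using \<kappa> by (intro spinors_nondegenerate[OF S(2,4) _ _ ne]) (simp_all add: spin_const_def)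
  then have "?b k\<^sub>3 ?l = 0" by (simp add: spinor_bracket_def)
  then have "?b k\<^sub>3 k\<^sub>1 = ?b k\<^sub>3 k\<^sub>2 * x + ?b k\<^sub>3 k\<^sub>4 * y"
    unfolding spinor_bracket_right by (simp add: algebra_simps)
  then have "1 = inverse (?b k\<^sub>3 k\<^sub>1) * (?b k\<^sub>3 k\<^sub>2 * x + ?b k\<^sub>3 k\<^sub>4 * y)"
    using inv31 by simp
  \<comment> \<open>Each summand of the claim contains two starred lengths, so the two signs from
    \<open>star_spinor_bracket\<close> cancel.\<close>
  then show ?thesis
    unfolding L star_spinor_bracket x_def y_def by (simp add: distrib_left mult.assoc)
qed

end
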